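(* Let $G$ be a finite abelian group acting without inversion on a finite graph $Y$ and let $V$ be an Artin representation of $G$. Then $c_V(u)=(1-u^2)^{-\chi_V(Y)}\in\mathbb{C}[[u]]$.
   Context: Graphs in Serre's sense (vertices $V_Y$, directed edges $\mathbf{E}_Y$, maps $o,t$, fixed-point-free involution $\varepsilon\mapsto\bar\varepsilon$ with $o(\bar\varepsilon)=t(\varepsilon)$); without inversion means $\sigma\varepsilon\ne\bar\varepsilon$. $C_0(Y)=\mathbb{C}V_Y$, $C_1(Y)=\mathbb{C}\mathbf{E}_Y/W$ ($W$ spanned by the $\varepsilon+\bar\varepsilon$), $\mathbb{C}[G]$-modules. $\chi_{\mathbb{C}[G]}(Y)=\mathrm{rank}_{\mathbb{C}[G]}C_0(Y)-\mathrm{rank}_{\mathbb{C}[G]}C_1(Y)$ (Hattori–Stallings ranks $\mathrm{tr}(\mathrm{id})$ of finitely generated projective modules), and $\gamma_Y(u)=(1-u^2)^{-\chi_{\mathbb{C}[G]}(Y)}:=\exp(-\chi_{\mathbb{C}[G]}(Y)\log(1-u^2))\in 1+u\mathbb{C}[G][[u]]$. An Artin representation is a finitely generated $\mathbb{C}[G]$-module $V$; $\chi_V(Y)=\dim_\mathbb{C}(V\otimes_{\mathbb{C}[G]}C_0(Y))-\dim_\mathbb{C}(V\otimes_{\mathbb{C}[G]}C_1(Y))$. $\sigma_V:\mathbb{C}[G][[u]]\to\mathbb{C}[[u]]$ sends $\sum\lambda_iu^i$ to $\det_{\mathbb{C}[[u]]}$ of the endomorphism of $V[[u]]$ given coefficientwise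 by $\sum\rho_V(\lambda_i)u^i$, where $\rho_V(\lambda)$ is the action of $\lambda$ on $V$. $c_V(u)=\sigma_V(\gamma_Y(u))$. *)

theory Defs
  imports
    "HOL-Library.Poly_Mapping"
    "HOL-Computational_Algebra.Formal_Power_Series"
    "HOL-Algebra.AbelCoset"
    "Jordan_Normal_Form.VS_Connect"
begin

text \<open>
  The finite abelian group \<open>G\<close> is a type \<open>'g :: {finite, ab_group_add}\<close>, written additively. Its
  group algebra \<open>\<complex>[G]\<close> is the type \<open>'g \<Rightarrow>\<^sub>0 complex\<close>, whose product is convolution; the scalar
  \<open>c \<in> \<complex>\<close> is \<open>Poly_Mapping.single 0 c\<close>. Modules are module records over \<open>class_ring\<close>, the ring
  record of a type class ring. The fields \<open>mult\<close> and \<open>one\<close> of a module record carry no meaning.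
\<close>

record ('x, 'e) serre_graph =
  vertices :: "'x set"
  edges :: "'e set"
  origin :: "'e \<Rightarrow> 'x"
  terminus :: "'e \<Rightarrow> 'x"
  bar :: "'e \<Rightarrow> 'e"

locale serre_graph =
  fixes Y :: "('x, 'e) serre_graph"
  assumes origin_closed: "e \<in> edges Y \<Longrightarrow> origin Y e \<in> vertices Y"
    and terminus_closed: "e \<in> edges Y \<Longrightarrow> terminus Y e \<in> vertices Y"
    and bar_closed: "e \<in> edges Y \<Longrightarrow> bar Y e \<in> edges Y"
    and bar_bar: "e \<in> edges Y \<Longrightarrow> bar Y (bar Y e) = e"
    and bar_neq: "e \<in> edges Y \<Longrightarrow> bar Y e \<noteq> e"
    and origin_bar: "e \<in> edges Y \<Longrightarrow> origin Y (bar Y e) = terminus Y e"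

definition finite_graph :: "('x, 'e) serre_graph \<Rightarrow> bool" where
  "finite_graph Y \<longleftrightarrow> serre_graph Y \<and> finite (vertices Y) \<and> finite (edges Y)"

definition set_action :: "'x set \<Rightarrow> ('g::ab_group_add \<Rightarrow> 'x \<Rightarrow> 'x) \<Rightarrow> bool" where
  "set_action X act \<longleftrightarrow>
     (\<forall>g. \<forall>x\<in>X. act g x \<in> X) \<and>
     (\<forall>x\<in>X. act 0 x = x) \<and>
     (\<forall>g h. \<forall>x\<in>X. act (g + h) x = act g (act h x))"

locale graph_action = serre_graph Y for Y :: "('x, 'e) serre_graph" +
  fixes actV :: "'g::ab_group_add \<Rightarrow> 'x \<Rightarrow> 'x"
    and actE :: "'g \<Rightarrow> 'e \<Rightarrow> 'e"
  assumes actV: "set_action (vertices Y) actV"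
    and actE: "set_action (edges Y) actE"
    and origin_act: "e \<in> edges Y \<Longrightarrow> origin Y (actE g e) = actV g (origin Y e)"
    and terminus_act: "e \<in> edges Y \<Longrightarrow> terminus Y (actE g e) = actV g (terminus Y e)"
    and bar_act: "e \<in> edges Y \<Longrightarrow> bar Y (actE g e) = actE g (bar Y e)"

definition without_inversion :: "('x, 'e) serre_graph \<Rightarrow> ('g \<Rightarrow> 'e \<Rightarrow> 'e) \<Rightarrow> bool" where
  "without_inversion Y actE \<longleftrightarrow> (\<forall>g. \<forall>e\<in>edges Y. actE g e \<noteq> bar Y e)"

definition finitely_generated :: "('r::comm_ring_1, 'm) module \<Rightarrow> bool" where
  "finitely_generated M \<longleftrightarrow>
     (\<exists>B. finite B \<and> B \<subseteq> carrier M \<and> module.span class_ring M B = carrier M)"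

definition regular_module :: "('r::comm_ring_1, 'r) module" where
  "regular_module =
     \<lparr>carrier = UNIV, mult = (*), one = 1, zero = 0, add = (+), smult = (*)\<rparr>"

definition free_module :: "'s set \<Rightarrow> ('r::comm_ring_1, 's \<Rightarrow>\<^sub>0 'r) module" where
  "free_module S =
     \<lparr>carrier = {f. Poly_Mapping.keys f \<subseteq> S}, mult = (\<lambda>_ _. 0), one = 0, zero = 0, add = (+),
      smult = (\<lambda>r. Poly_Mapping.map ((*) r))\<rparr>"

text \<open>In the scalar multiplication all the cosets in the union coincide.\<close>

definition quot_module :: "('r, 'm) module \<Rightarrow> 'm set \<Rightarrow> ('r, 'm set) module" where
  "quot_module M N =
     \<lparr>carrier = a_rcosets\<^bsub>M\<^esub> N, mult = (\<lambda>_ _. N), one = N, zero = N, add = set_add M,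
      smult = (\<lambda>r X. \<Union>x\<in>X. N +>\<^bsub>M\<^esub> (r \<odot>\<^bsub>M\<^esub> x))\<rparr>"

definition tensor_relations ::
  "('r::comm_ring_1, 'v) module \<Rightarrow> ('r, 'm) module \<Rightarrow> ('v \<times> 'm \<Rightarrow>\<^sub>0 'r) set" where
  "tensor_relations V M =
     {Poly_Mapping.single (v \<oplus>\<^bsub>V\<^esub> w, m) 1 - Poly_Mapping.single (v, m) 1
        - Poly_Mapping.single (w, m) 1 | v w m.
        v \<in> carrier V \<and> w \<in> carrier V \<and> m \<in> carrier M} \<union>
     {Poly_Mapping.single (v, m \<oplus>\<^bsub>M\<^esub> n) 1 - Poly_Mapping.single (v, m) 1
        - Poly_Mapping.single (v, n) 1 | v m n.
        v \<in> carrier V \<and> m \<in> carrier M \<and> n \<in> carrier M} \<union>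
     {Poly_Mapping.single (r \<odot>\<^bsub>V\<^esub> v, m) 1 - Poly_Mapping.single (v, m) r | r v m.
        v \<in> carrier V \<and> m \<in> carrier M} \<union>
     {Poly_Mapping.single (v, r \<odot>\<^bsub>M\<^esub> m) 1 - Poly_Mapping.single (v, m) r | r v m.
        v \<in> carrier V \<and> m \<in> carrier M}"

definition tensor_product ::
  "('r::comm_ring_1, 'v) module \<Rightarrow> ('r, 'm) module \<Rightarrow> ('r, ('v \<times> 'm \<Rightarrow>\<^sub>0 'r) set) module" where
  "tensor_product V M =
     (let F = free_module (carrier V \<times> carrier M)
      in quot_module F (module.span class_ring F (tensor_relations V M)))"

text \<open>
  Hattori--Stallings trace of an endomorphism \<open>\<alpha>\<close> of a finitely generated projective module \<open>P\<close>
  over a commutative ring \<open>R\<close> (so that \<open>R/[R,R] = R\<close>): under \<open>P\<^sup>* \<otimes> P \<cong> End P\<close> the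
  endomorphism \<open>\<alpha>\<close> corresponds to some \<open>\<Sum>i. \<phi>\<^sub>i \<otimes> p\<^sub>i\<close>, and its trace is \<open>\<Sum>i. \<phi>\<^sub>i(p\<^sub>i)\<close>.
\<close>

definition hs_trace :: "('r::comm_ring_1, 'm) module \<Rightarrow> ('m \<Rightarrow> 'm) \<Rightarrow> 'r" where
  "hs_trace P \<alpha> =
     (THE r. \<exists>(n::nat) p \<phi>.
        (\<forall>i<n. p i \<in> carrier P \<and> \<phi> i \<in> module_hom class_ring P regular_module) \<and>
        (\<forall>x\<in>carrier P. \<alpha> x = (\<Oplus>\<^bsub>P\<^esub>i\<in>{..<n}. \<phi> i x \<odot>\<^bsub>P\<^esub> p i)) \<and>
        r = (\<Sum>i<n. \<phi> i (p i)))"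

definition hs_rank :: "('r::comm_ring_1, 'm) module \<Rightarrow> 'r" where
  "hs_rank P = hs_trace P id"

text \<open>Meaningful only when \<open>M\<close> is free of finite rank; the value does not depend on the basis.\<close>

definition endo_det :: "('r::comm_ring_1, 'm) module \<Rightarrow> ('m \<Rightarrow> 'm) \<Rightarrow> 'r" where
  "endo_det M F =
     (THE d. \<exists>bs A.
        distinct bs \<and> set bs \<subseteq> carrier M \<and>
        \<not> module.lin_dep class_ring M (set bs) \<and>
        module.span class_ring M (set bs) = carrier M \<and>
        A \<in> carrier_mat (length bs) (length bs) \<and>
        (\<forall>j<length bs. F (bs ! j) = (\<Oplus>\<^bsub>M\<^esub>i\<in>{..<length bs}. A $$ (i, j) \<odot>\<^bsub>M\<^esub> (bs ! i))) \<and>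
        d = Determinant.det A)"

definition perm_module ::
  "'x set \<Rightarrow> ('g::ab_group_add \<Rightarrow> 'x \<Rightarrow> 'x) \<Rightarrow> ('g \<Rightarrow>\<^sub>0 complex, 'x \<Rightarrow>\<^sub>0 complex) module" where
  "perm_module X act =
     \<lparr>carrier = {f. Poly_Mapping.keys f \<subseteq> X}, mult = (\<lambda>_ _. 0), one = 0, zero = 0, add = (+),
      smult = (\<lambda>a f. \<Sum>g\<in>Poly_Mapping.keys a. \<Sum>x\<in>Poly_Mapping.keys f.
         Poly_Mapping.single (act g x) (Poly_Mapping.lookup a g * Poly_Mapping.lookup f x))\<rparr>"

definition C0 ::
  "('x, 'e) serre_graph \<Rightarrow> ('g::ab_group_add \<Rightarrow> 'x \<Rightarrow> 'x) \<Rightarrow>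
     ('g \<Rightarrow>\<^sub>0 complex, 'x \<Rightarrow>\<^sub>0 complex) module" where
  "C0 Y actV = perm_module (vertices Y) actV"

definition edge_relations :: "('x, 'e) serre_graph \<Rightarrow> ('e \<Rightarrow>\<^sub>0 complex) set" where
  "edge_relations Y =
     module.span class_ring (free_module (edges Y) :: (complex, 'e \<Rightarrow>\<^sub>0 complex) module)
       {Poly_Mapping.single e 1 + Poly_Mapping.single (bar Y e) 1 | e. e \<in> edges Y}"

definition C1 ::
  "('x, 'e) serre_graph \<Rightarrow> ('g::ab_group_add \<Rightarrow> 'e \<Rightarrow> 'e) \<Rightarrow>
     ('g \<Rightarrow>\<^sub>0 complex, ('e \<Rightarrow>\<^sub>0 complex) set) module" where
  "C1 Y actE = quot_module (perm_module (edges Y) actE) (edge_relations Y)"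

definition equivariant_euler_char ::
  "('x, 'e) serre_graph \<Rightarrow> ('g::ab_group_add \<Rightarrow> 'x \<Rightarrow> 'x) \<Rightarrow> ('g \<Rightarrow> 'e \<Rightarrow> 'e) \<Rightarrow>
     ('g \<Rightarrow>\<^sub>0 complex)" where
  "equivariant_euler_char Y actV actE = hs_rank (C0 Y actV) - hs_rank (C1 Y actE)"

definition fps_group_algebra :: "complex fps \<Rightarrow> ('g::ab_group_add \<Rightarrow>\<^sub>0 complex) fps" where
  "fps_group_algebra s = Abs_fps (\<lambda>n. Poly_Mapping.single 0 (fps_nth s n))"

text \<open>\<open>fps_ln 1\<close> is the series of \<open>log (1 + X)\<close>.\<close>

definition graph_gamma ::
  "('x, 'e) serre_graph \<Rightarrow> ('g::ab_group_add \<Rightarrow> 'x \<Rightarrow> 'x) \<Rightarrow> ('g \<Rightarrow> 'e \<Rightarrow> 'e) \<Rightarrow>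
     ('g \<Rightarrow>\<^sub>0 complex) fps" where
  "graph_gamma Y actV actE =
     fps_group_algebra (fps_exp 1) oo
       (- fps_const (equivariant_euler_char Y actV actE)
          * fps_group_algebra (fps_ln 1 oo (- (fps_X ^ 2))))"

definition artin_rep :: "('g::{finite, ab_group_add} \<Rightarrow>\<^sub>0 complex, 'v) module \<Rightarrow> bool" where
  "artin_rep V \<longleftrightarrow> module class_ring V \<and> finitely_generated V"

definition restrict_scalars ::
  "('g::ab_group_add \<Rightarrow>\<^sub>0 complex, 'm) module \<Rightarrow> (complex, 'm) module" where
  "restrict_scalars M =
     \<lparr>carrier = carrier M, mult = mult M, one = one M, zero = zero M, add = add M,
      smult = (\<lambda>c x. Poly_Mapping.single 0 c \<odot>\<^bsub>M\<^esub> x)\<rparr>"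

definition complex_dim :: "('g::ab_group_add \<Rightarrow>\<^sub>0 complex, 'm) module \<Rightarrow> nat" where
  "complex_dim M = vectorspace.dim class_ring (restrict_scalars M)"

definition artin_euler_char ::
  "('g::ab_group_add \<Rightarrow>\<^sub>0 complex, 'v) module \<Rightarrow> ('x, 'e) serre_graph \<Rightarrow>
     ('g \<Rightarrow> 'x \<Rightarrow> 'x) \<Rightarrow> ('g \<Rightarrow> 'e \<Rightarrow> 'e) \<Rightarrow> int" where
  "artin_euler_char V Y actV actE =
     int (complex_dim (tensor_product V (C0 Y actV))) -
     int (complex_dim (tensor_product V (C1 Y actE)))"

text \<open>\<open>V[[u]]\<close> as a module over \<open>\<complex>[[u]]\<close>; the sequence \<open>f\<close> stands for \<open>\<Sum>n. f n u\<^sup>n\<close>.\<close>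

definition series_module ::
  "('g::ab_group_add \<Rightarrow>\<^sub>0 complex, 'v) module \<Rightarrow> (complex fps, nat \<Rightarrow> 'v) module" where
  "series_module V =
     \<lparr>carrier = {f. \<forall>n. f n \<in> carrier V}, mult = (\<lambda>_ _ _. \<zero>\<^bsub>V\<^esub>), one = (\<lambda>_. \<zero>\<^bsub>V\<^esub>),
      zero = (\<lambda>_. \<zero>\<^bsub>V\<^esub>), add = (\<lambda>f g n. f n \<oplus>\<^bsub>V\<^esub> g n),
      smult = (\<lambda>s f n. \<Oplus>\<^bsub>V\<^esub>i\<in>{..n}. Poly_Mapping.single 0 (fps_nth s i) \<odot>\<^bsub>V\<^esub> f (n - i))\<rparr>"

definition series_endo ::
  "('g::ab_group_add \<Rightarrow>\<^sub>0 complex, 'v) module \<Rightarrow> ('g \<Rightarrow>\<^sub>0 complex) fps \<Rightarrow>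
     (nat \<Rightarrow> 'v) \<Rightarrow> nat \<Rightarrow> 'v" where
  "series_endo V L f = (\<lambda>n. \<Oplus>\<^bsub>V\<^esub>i\<in>{..n}. fps_nth L i \<odot>\<^bsub>V\<^esub> f (n - i))"

definition sigma_rep ::
  "('g::ab_group_add \<Rightarrow>\<^sub>0 complex, 'v) module \<Rightarrow> ('g \<Rightarrow>\<^sub>0 complex) fps \<Rightarrow> complex fps" where
  "sigma_rep V L = endo_det (series_module V) (series_endo V L)"

definition c_rep ::
  "('g::ab_group_add \<Rightarrow>\<^sub>0 complex, 'v) module \<Rightarrow> ('x, 'e) serre_graph \<Rightarrow>
     ('g \<Rightarrow> 'x \<Rightarrow> 'x) \<Rightarrow> ('g \<Rightarrow> 'e \<Rightarrow> 'e) \<Rightarrow> complex fps" where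
  "c_rep V Y actV actE = sigma_rep V (graph_gamma Y actV actE)"

end

theory Submission
  imports Defs "Jordan_Normal_Form.Schur_Decomposition"
begin

text \<open>
  Only traces matter. A finitely generated complex representation \<open>M\<close> of \<open>G\<close> with complex coordinates
  \<open>l i\<close> in a basis \<open>p i\<close> has the group-algebra-valued coordinates
  \<open>y \<mapsto> 1/|G| \<Sum>g. l i (g\<^sup>-\<^sup>1 y) g\<close> with respect to the same vectors, so it is projective, and its
  Hattori--Stallings rank \<open>r\<close> is the sum of the diagonal coordinates of the \<open>p i\<close>. Tensoring these
  coordinates with those of a complex basis of \<open>V\<close> shows that \<open>V \<otimes> M\<close> has dimension
  \<open>tr (\<rho>\<^sub>V r)\<close>. Taking \<open>M\<close> to be \<open>C\<^sub>0\<close> and \<open>C\<^sub>1\<close> gives \<open>\<chi>\<^sub>V = tr (\<rho>\<^sub>V \<chi>)\<close>, and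
  the theorem becomes the identity \<open>det (exp A) = exp (tr A)\<close> for
  \<open>A = - log (1 - u\<^sup>2) \<rho>\<^sub>V \<chi>\<close>, which follows by triangularising \<open>\<rho>\<^sub>V \<chi>\<close>.
\<close>

section \<open>Dual bases and traces\<close>

text \<open>The exponent \<chi> is an element of the group algebra and not a number, so
  \<open>graph_gamma\<close> is only an exponential series; numbers appear once a representation and
  a trace have been applied. Hence no rank is ever computed: C_0 and C_1 enter only as finitely
  generated modules, and for C_1 the point to settle is that the complex span of the edge relations
  is stable under the group.

  The Hattori-Stallings rank, the dimension and the length of a basis are values of one expression,
  the sum of the diagonal coordinates of a dual basis. A single argument shows that it does not
  depend on the dual basis. This gives meaning to the definite description \<open>hs_trace\<close>,
  computes dimensions, and shows over C[[u]] that two bases have the same length, which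
  \<open>endo_det\<close> needs.

  The determinant identity is proved for exp(tA) with a formal variable t. The logarithm has no
  constant term and is substituted for t afterwards; substitution is a ring homomorphism and so
  commutes with determinants.\<close>

lemma hom_finsum:
  assumes M: "module R M" and N: "module R N" and f: "f \<in> module_hom R M N"
    and x: "\<And>i. i \<in> I \<Longrightarrow> x i \<in> carrier M"
  shows "f (\<Oplus>\<^bsub>M\<^esub>i\<in>I. x i) = (\<Oplus>\<^bsub>N\<^esub>i\<in>I. f (x i))"
proof -
  interpret M: module R M by fact
  interpret N: module R N by fact
  interpret mod_hom R M N f
    by (intro mod_hom.intro mod_hom_axioms.intro assms)
  show ?thesis
    using x
  proof (induction I rule: infinite_finite_induct)
    case (insert i I)
    then have "(\<Oplus>\<^bsub>M\<^esub>j\<in>insert i I. x j) = x i \<oplus>\<^bsub>M\<^esub>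
        (\<Oplus>\<^bsub>M\<^esub>j\<in>I. x j)"
      by (intro M.M.finsum_insert) auto
    moreover have "(\<Oplus>\<^bsub>N\<^esub>j\<in>insert i I. f (x j)) = f (x i)
        \<oplus>\<^bsub>N\<^esub> (\<Oplus>\<^bsub>N\<^esub>j\<in>I. f (x j))"
      using insert by (intro N.M.finsum_insert) auto
    moreover have "(\<Oplus>\<^bsub>M\<^esub>j\<in>I. x j) \<in> carrier M" "x i \<in> carrier M"
      using insert by (auto intro!: M.M.finsum_closed)
    ultimately show ?case using insert by simp
  qed auto
qed

lemma cring_class_ring: "cring (class_ring :: 'r::comm_ring_1 ring)"
  by (rule class_cring.is_cring)

text \<open>The module axioms over \<open>class_ring\<close>, restated with the type class
  operations so that neither membership in its carrier nor its record operations remain. Later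
  proofs select these facts by position.\<close>

lemma class_module_simps:
  assumes "module class_ring M"
  shows "x \<in> carrier M \<Longrightarrow> 1 \<odot>\<^bsub>M\<^esub> x = x"
    and "x \<in> carrier M \<Longrightarrow> 0 \<odot>\<^bsub>M\<^esub> x = \<zero>\<^bsub>M\<^esub>"
    and "x \<in> carrier M \<Longrightarrow> r \<odot>\<^bsub>M\<^esub> x \<in> carrier M"
    and "x \<in> carrier M \<Longrightarrow> (r + s) \<odot>\<^bsub>M\<^esub> x = r
        \<odot>\<^bsub>M\<^esub> x \<oplus>\<^bsub>M\<^esub> s \<odot>\<^bsub>M\<^esub> x"
    and "x \<in> carrier M \<Longrightarrow> y \<in> carrier M \<Longrightarrow> r
        \<odot>\<^bsub>M\<^esub> (x \<oplus>\<^bsub>M\<^esub> y) = r \<odot>\<^bsub>M\<^esub> x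
        \<oplus>\<^bsub>M\<^esub> r \<odot>\<^bsub>M\<^esub> y"
    and "x \<in> carrier M \<Longrightarrow> (r * s) \<odot>\<^bsub>M\<^esub> x = r
        \<odot>\<^bsub>M\<^esub> (s \<odot>\<^bsub>M\<^esub> x)"
    and "r \<odot>\<^bsub>M\<^esub> \<zero>\<^bsub>M\<^esub> = \<zero>\<^bsub>M\<^esub>"
    and "x \<in> carrier M \<Longrightarrow> y \<in> carrier M \<Longrightarrow> x
        \<oplus>\<^bsub>M\<^esub> y \<in> carrier M"
proof -
  interpret module class_ring M by fact
  show "x \<in> carrier M \<Longrightarrow> 1 \<odot>\<^bsub>M\<^esub> x = x"
    "x \<in> carrier M \<Longrightarrow> 0 \<odot>\<^bsub>M\<^esub> x = \<zero>\<^bsub>M\<^esub>"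
    "x \<in> carrier M \<Longrightarrow> r \<odot>\<^bsub>M\<^esub> x \<in> carrier M"
    "x \<in> carrier M \<Longrightarrow> (r + s) \<odot>\<^bsub>M\<^esub> x = r \<odot>\<^bsub>M\<^esub>
        x \<oplus>\<^bsub>M\<^esub> s \<odot>\<^bsub>M\<^esub> x"
    "x \<in> carrier M \<Longrightarrow> y \<in> carrier M \<Longrightarrow> r \<odot>\<^bsub>M\<^esub>
        (x \<oplus>\<^bsub>M\<^esub> y) = r \<odot>\<^bsub>M\<^esub> x \<oplus>\<^bsub>M\<^esub> r
        \<odot>\<^bsub>M\<^esub> y"
    "x \<in> carrier M \<Longrightarrow> (r * s) \<odot>\<^bsub>M\<^esub> x = r \<odot>\<^bsub>M\<^esub>
        (s \<odot>\<^bsub>M\<^esub> x)"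
    "r \<odot>\<^bsub>M\<^esub> \<zero>\<^bsub>M\<^esub> = \<zero>\<^bsub>M\<^esub>"
    "x \<in> carrier M \<Longrightarrow> y \<in> carrier M \<Longrightarrow> x \<oplus>\<^bsub>M\<^esub>
        y \<in> carrier M"
    using smult_one[of x] smult_l_null[of x] smult_closed[of r x] smult_l_distr[of r s x]
      smult_r_distr[of r x y] smult_assoc1[of r s x] smult_r_null[of r]
    by simp_all
qed

lemma regular_module_simps [simp]:
  "carrier regular_module = UNIV" "\<zero>\<^bsub>regular_module\<^esub> = 0"
  "x \<oplus>\<^bsub>regular_module\<^esub> y = x + y" "r \<odot>\<^bsub>regular_module\<^esub> x = r * x"
  by (simp_all add: regular_module_def)

lemma module_regular_module: "module class_ring (regular_module :: ('r::comm_ring_1, 'r) module)"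
  by (rule module_criteria) (auto simp: cring_class_ring algebra_simps intro: exI[of _ "- _"])

lemma finsum_regular_module [simp]: "finsum regular_module f I = sum f I"
proof -
  \<comment> \<open>A finite sum depends only on the carrier, zero and addition, which the two
    records share.\<close>
  have "finsum regular_module f I = finsum class_ring f I"
    by (simp add: finsum_def finprod_def regular_module_def)
  then show ?thesis by (simp add: class_ring_simps)
qed

lemma functional_add:
  assumes "\<phi> \<in> module_hom class_ring M regular_module" "x \<in> carrier M" "y \<in> carrier M"
  shows "\<phi> (x \<oplus>\<^bsub>M\<^esub> y) = \<phi> x + \<phi> y"
  using module_hom_add[OF assms] by simp

lemma functional_smult:
  assumes "\<phi> \<in> module_hom class_ring M regular_module" "x \<in> carrier M"
  shows "\<phi> (r \<odot>\<^bsub>M\<^esub> x) = r * \<phi> x"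
  using module_hom_smult[OF assms(1) _ assms(2)] by simp

lemma functional_finsum:
  assumes "module class_ring M" "\<phi> \<in> module_hom class_ring M regular_module"
    and "\<And>i. i \<in> I \<Longrightarrow> x i \<in> carrier M"
  shows "\<phi> (\<Oplus>\<^bsub>M\<^esub>i\<in>I. x i) = (\<Sum>i\<in>I. \<phi> (x i))"
  using hom_finsum[OF assms(1) module_regular_module assms(2,3)] by simp

lemma functional_lincomb:
  assumes M: "module class_ring M" and \<phi>: "\<phi> \<in> module_hom class_ring M regular_module"
    and x: "\<And>i. i \<in> I \<Longrightarrow> x i \<in> carrier M"
  shows "\<phi> (\<Oplus>\<^bsub>M\<^esub>i\<in>I. a i \<odot>\<^bsub>M\<^esub> x i) = (\<Sum>i\<in>I. a
      i * \<phi> (x i))"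
proof -
  interpret module class_ring M by fact
  have "\<phi> (\<Oplus>\<^bsub>M\<^esub>i\<in>I. a i \<odot>\<^bsub>M\<^esub> x i) = (\<Sum>i\<in>I.
      \<phi> (a i \<odot>\<^bsub>M\<^esub> x i))"
    using x by (intro functional_finsum[OF M \<phi>]) auto
  also have "\<dots> = (\<Sum>i\<in>I. a i * \<phi> (x i))"
    using x by (intro sum.cong functional_smult[OF \<phi>]) auto
  finally show ?thesis .
qed

text \<open>The data of the dual basis lemma, which exist exactly for finitely generated projective
  modules. The \<open>p i\<close> may repeat and may be dependent, and the index set is any finite
  set, so one notion serves for bases, for averaged coordinates and for families indexed by
  pairs.\<close>

definition dual_basis ::
  "('r::comm_ring_1, 'm) module \<Rightarrow> 'i set \<Rightarrow> ('i \<Rightarrow> 'm) \<Rightarrow>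
      ('i \<Rightarrow> 'm \<Rightarrow> 'r) \<Rightarrow> bool" where
  "dual_basis M I p \<phi> \<longleftrightarrow> finite I \<and>
     (\<forall>i\<in>I. p i \<in> carrier M \<and> \<phi> i \<in> module_hom class_ring M regular_module)
         \<and>
     (\<forall>x\<in>carrier M. x = (\<Oplus>\<^bsub>M\<^esub>i\<in>I. \<phi> i x
         \<odot>\<^bsub>M\<^esub> p i))"

lemma dual_basisD:
  assumes "dual_basis M I p \<phi>"
  shows "finite I" "\<And>i. i \<in> I \<Longrightarrow> p i \<in> carrier M"
    "\<And>i. i \<in> I \<Longrightarrow> \<phi> i \<in> module_hom class_ring M regular_module"
    "\<And>x. x \<in> carrier M \<Longrightarrow> (\<Oplus>\<^bsub>M\<^esub>i\<in>I. \<phi> i x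
        \<odot>\<^bsub>M\<^esub> p i) = x"
  using assms unfolding dual_basis_def by (blast, blast, blast, metis)

text \<open>Cyclicity of the trace: expand each \<open>p i\<close> in the \<open>q j\<close>,
  exchange the two sums and contract the \<open>p i\<close>. Exchanging the two factors uses that
  the ring is commutative.\<close>

lemma dual_basis_trace_unique:
  assumes M: "module class_ring M" and p: "dual_basis M I p \<phi>" and q: "dual_basis M J q \<psi>"
  shows "(\<Sum>i\<in>I. \<phi> i (p i)) = (\<Sum>j\<in>J. \<psi> j (q j))"
proof -
  note P = dual_basisD[OF p] and Q = dual_basisD[OF q]
  have "(\<Sum>i\<in>I. \<phi> i (p i)) = (\<Sum>i\<in>I. \<phi> i (\<Oplus>\<^bsub>M\<^esub>j\<in>J.
      \<psi> j (p i) \<odot>\<^bsub>M\<^esub> q j))"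
    using P Q by (intro sum.cong) auto
  also have "\<dots> = (\<Sum>i\<in>I. \<Sum>j\<in>J. \<psi> j (p i) * \<phi> i (q j))"
    using P Q by (intro sum.cong refl functional_lincomb[OF M]) auto
  also have "\<dots> = (\<Sum>j\<in>J. \<Sum>i\<in>I. \<phi> i (q j) * \<psi> j (p i))"
    by (subst sum.swap) (simp add: mult.commute)
  also have "\<dots> = (\<Sum>j\<in>J. \<psi> j (\<Oplus>\<^bsub>M\<^esub>i\<in>I. \<phi> i (q j)
      \<odot>\<^bsub>M\<^esub> p i))"
    using P Q by (intro sum.cong refl functional_lincomb[OF M, symmetric]) auto
  also have "\<dots> = (\<Sum>j\<in>J. \<psi> j (q j))"
    using P Q by (intro sum.cong) auto
  finally show ?thesis .
qed

text \<open>Passes from arbitrary finite index sets to the initial segments of the naturals that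
  \<open>hs_trace\<close> and matrices demand.\<close>

lemma dual_basis_reindex:
  assumes M: "module class_ring M" and p: "dual_basis M I p \<phi>" and h: "bij_betw h J I"
  shows "dual_basis M J (p \<circ> h) (\<phi> \<circ> h)"
proof -
  interpret module class_ring M by fact
  note P = dual_basisD[OF p]
  have hI: "h j \<in> I" if "j \<in> J" for j using h that by (auto simp: bij_betw_def)
  have "x = (\<Oplus>\<^bsub>M\<^esub>j\<in>J. \<phi> (h j) x \<odot>\<^bsub>M\<^esub> p (h j))" if "x
      \<in> carrier M" for x
  proof -
    have "(\<Oplus>\<^bsub>M\<^esub>i\<in>h ` J. \<phi> i x \<odot>\<^bsub>M\<^esub> p i) =
        (\<Oplus>\<^bsub>M\<^esub>j\<in>J. \<phi> (h j) x \<odot>\<^bsub>M\<^esub> p (h j))"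
      using P(2) h hI by (intro finsum_reindex) (auto simp: bij_betw_def)
    then show ?thesis using P(4)[OF that] h by (simp add: bij_betw_def)
  qed
  then show ?thesis
    using P hI bij_betw_finite[OF h] by (auto simp: dual_basis_def)
qed

text \<open>Any dual basis, renumbered along an initial segment, satisfies the definite description
  in \<open>hs_trace\<close>; \<open>dual_basis_trace_unique\<close> makes the value unique.\<close>

lemma hs_rank_eq_trace:
  assumes M: "module class_ring M" and p: "dual_basis M I p \<phi>"
  shows "hs_rank M = (\<Sum>i\<in>I. \<phi> i (p i))"
  unfolding hs_rank_def hs_trace_def
proof (rule the_equality)
  obtain h where h: "bij_betw h {..<card I} I"
    using ex_bij_betw_nat_finite[OF dual_basisD(1)[OF p]] by (auto simp: atLeast0LessThan)
  have "(\<Sum>i\<in>I. \<phi> i (p i)) = (\<Sum>j<card I. \<phi> (h j) (p (h j)))"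
    by (rule sum.reindex_bij_betw[OF h, symmetric])
  then show "\<exists>(n::nat) p' \<phi>'.
        (\<forall>i<n. p' i \<in> carrier M \<and> \<phi>' i \<in> module_hom class_ring M
            regular_module) \<and>
        (\<forall>x\<in>carrier M. id x = (\<Oplus>\<^bsub>M\<^esub>i\<in>{..<n}. \<phi>' i x
            \<odot>\<^bsub>M\<^esub> p' i)) \<and>
        (\<Sum>i\<in>I. \<phi> i (p i)) = (\<Sum>i<n. \<phi>' i (p' i))"
    using dual_basis_reindex[OF M p h] unfolding dual_basis_def
    by (intro exI[of _ "card I"] exI[of _ "p \<circ> h"] exI[of _ "\<phi> \<circ> h"]) auto
next
  fix r
  assume "\<exists>(n::nat) p' \<phi>'.
        (\<forall>i<n. p' i \<in> carrier M \<and> \<phi>' i \<in> module_hom class_ring M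
            regular_module) \<and>
        (\<forall>x\<in>carrier M. id x = (\<Oplus>\<^bsub>M\<^esub>i\<in>{..<n}. \<phi>' i x
            \<odot>\<^bsub>M\<^esub> p' i)) \<and>
        r = (\<Sum>i<n. \<phi>' i (p' i))"
  then obtain n :: nat and p' \<phi>' where "dual_basis M {..<n} p' \<phi>'" "r = (\<Sum>i<n. \<phi>' i
      (p' i))"
    unfolding dual_basis_def by auto
  then show "r = (\<Sum>i\<in>I. \<phi> i (p i))"
    using dual_basis_trace_unique[OF M _ p] by simp
qed

text \<open>Two expansions in \<open>B\<close> that differ at some \<open>b\<close> give a
  nontrivial relation, so the coefficients chosen for \<open>x\<close> are forced. Uniqueness also
  makes them linear, since sums and multiples of expansions are again expansions. The ring is not
  assumed to be a field: the lemma is also applied over C[[u]].\<close>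

lemma basis_coordinates:
  fixes M :: "('r::comm_ring_1, 'm) module"
  assumes M: "module class_ring M" and B: "finite B" "B \<subseteq> carrier M"
    and indep: "\<not> module.lin_dep class_ring M B" and span: "module.span class_ring M B = carrier M"
  obtains \<phi> where "dual_basis M B (\<lambda>b. b) \<phi>"
    and "\<And>b c. b \<in> B \<Longrightarrow> c \<in> B \<Longrightarrow> \<phi> b c = (if b = c then 1
        else 0)"
proof -
  interpret module class_ring M by fact
  have unique: "a b = a' b" if "lincomb a B = lincomb a' B" "b \<in> B" for a a' b
  proof (rule ccontr)
    assume ne: "a b \<noteq> a' b"
    have "lincomb (\<lambda>v. a v \<ominus>\<^bsub>class_ring\<^esub> a' v) B = lincomb a B
        \<ominus>\<^bsub>M\<^esub> lincomb a' B"
      using B by (intro lincomb_diff) auto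
    also have "\<dots> = \<zero>\<^bsub>M\<^esub>"
      using B that by simp
    finally have "lin_dep B"
      using B that(2) ne by (intro lin_dep_crit[OF _ subset_refl, of B "\<lambda>v. a v - a' v" b])
        (auto simp: class_ring_simps)
    then show False using indep by simp
  qed
  have "\<exists>a. x = lincomb a B" if "x \<in> carrier M" for x
    using finite_in_span[OF B] span that by auto
  then obtain co where co: "x = lincomb (co x) B" if "x \<in> carrier M" for x
    by metis
  have coI: "co x b = a b" if "x = lincomb a B" "b \<in> B" for x a b
  proof -
    have "x \<in> carrier M" using that B by auto
    then show ?thesis using unique that co by metis
  qed
  have delta: "co c b = (if b = c then 1 else 0)" if "b \<in> B" "c \<in> B" for b c
  proof (rule coI[OF _ that(1)])
    have "lincomb (\<lambda>b. if b = c then 1 else 0) B = (\<Oplus>\<^bsub>M\<^esub>b\<in>B. if c = b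
        then b else \<zero>\<^bsub>M\<^esub>)"
      unfolding lincomb_def using B that by (intro finsum_cong') (auto simp: class_module_simps[OF M])
    also have "\<dots> = c"
      using B that by (intro finsum_singleton) auto
    finally show "c = lincomb (\<lambda>b. if b = c then 1 else 0) B" ..
  qed
  have hom: "(\<lambda>x. co x b) \<in> module_hom class_ring M regular_module" if "b \<in> B" for b
    unfolding module_hom_def
  proof (simp, intro conjI allI impI; (elim conjE)?)
    fix x y assume x: "x \<in> carrier M" and y: "y \<in> carrier M"
    have "x \<oplus>\<^bsub>M\<^esub> y = lincomb (\<lambda>v. co x v \<oplus>\<^bsub>class_ring\<^esub>
        co y v) B"
      using co[OF x] co[OF y] B by (subst lincomb_sum) auto
    then show "co (x \<oplus>\<^bsub>M\<^esub> y) b = co x b + co y b"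
      using coI that by simp
  next
    fix r x assume x: "x \<in> carrier M"
    have "r \<odot>\<^bsub>M\<^esub> x = lincomb (\<lambda>v. r \<otimes>\<^bsub>class_ring\<^esub> co x v) B"
      using co[OF x] B by (subst lincomb_smult) auto
    then show "co (r \<odot>\<^bsub>M\<^esub> x) b = r * co x b"
      using coI that by simp
  qed
  have "dual_basis M B (\<lambda>b. b) (\<lambda>b x. co x b)"
    using B hom co by (auto simp: dual_basis_def lincomb_def)
  then show ?thesis using that delta by blast
qed

lemma dual_basis_span:
  assumes M: "module class_ring M" and p: "dual_basis M I p \<phi>"
  shows "module.span class_ring M (p ` I) = carrier M"
proof -
  interpret module class_ring M by fact
  note P = dual_basisD[OF p]
  have sub: "p ` I \<subseteq> carrier M" using P by auto
  interpret S: submodule class_ring "span (p ` I)" M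
    using sub by (rule span_is_submodule)
  have "x \<in> span (p ` I)" if "x \<in> carrier M" for x
  proof -
    have "(\<Oplus>\<^bsub>M\<^esub>i\<in>J. \<phi> i x \<odot>\<^bsub>M\<^esub> p i) \<in> span (p ` I)"
        if "J \<subseteq> I" for J
      using finite_subset[OF that P(1)] that
    proof (induction J)
      case (insert j J)
      have "p j \<in> span (p ` I)" using insert.prems in_own_span[OF sub] by auto
      moreover have "(\<Oplus>\<^bsub>M\<^esub>i\<in>insert j J. \<phi> i x \<odot>\<^bsub>M\<^esub> p i)
          = \<phi> j x \<odot>\<^bsub>M\<^esub> p j \<oplus>\<^bsub>M\<^esub>
              (\<Oplus>\<^bsub>M\<^esub>i\<in>J. \<phi> i x \<odot>\<^bsub>M\<^esub> p i)"
        using insert P by (intro finsum_insert) auto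
      ultimately show ?case using insert by auto
    qed auto
    from this[of I] show ?thesis using P(4)[OF that] by simp
  qed
  then show ?thesis using span_is_subset2[OF sub] by auto
qed

text \<open>In a basis every diagonal coordinate is 1, so the trace of the identity counts the
  basis, and any other dual basis has the same trace. A dimension thus becomes an equation in the
  field.\<close>

lemma dim_eq_trace:
  fixes W :: "('k::field, 'm) module"
  assumes W: "vectorspace class_ring W" and p: "dual_basis W I p \<phi>"
  shows "of_nat (vectorspace.dim class_ring W) = (\<Sum>i\<in>I. \<phi> i (p i))"
proof -
  interpret vectorspace class_ring W by fact
  have fd: "fin_dim"
    unfolding fin_dim_def using dual_basisD[OF p] dual_basis_span[OF module_axioms p]
    by (intro exI[of _ "p ` I"]) auto
  obtain B where B: "finite B" "basis B" using finite_basis_exists[OF fd] by auto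
  then obtain \<psi> where \<psi>: "dual_basis W B (\<lambda>b. b) \<psi>"
    "\<And>b c. b \<in> B \<Longrightarrow> c \<in> B \<Longrightarrow> \<psi> b c = (if b = c then 1 else 0)"
    using basis_coordinates[OF module_axioms B(1)] unfolding basis_def by metis
  have "(\<Sum>i\<in>I. \<phi> i (p i)) = (\<Sum>b\<in>B. \<psi> b b)"
    by (rule dual_basis_trace_unique[OF module_axioms p \<psi>(1)])
  also have "\<dots> = of_nat (card B)" using \<psi>(2) by simp
  finally show ?thesis using dim_basis[OF B] by simp
qed

section \<open>Iterated finite sums in an abelian monoid\<close>

lemma finsum_Times:
  assumes M: "abelian_monoid M" and I: "finite I" and J: "finite J"
    and x: "\<And>i j. i \<in> I \<Longrightarrow> j \<in> J \<Longrightarrow> x i j \<in> carrier M"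
  shows "(\<Oplus>\<^bsub>M\<^esub>i\<in>I. \<Oplus>\<^bsub>M\<^esub>j\<in>J. x i j) = finsum M
      (case_prod x) (I \<times> J)"
proof -
  interpret abelian_monoid M by fact
  show ?thesis
    using I x
  proof (induction I)
    case (insert i I)
    have "finsum M (case_prod x) ({i} \<times> J) = (\<Oplus>\<^bsub>M\<^esub>k\<in>Pair i ` J. case_prod
        x k)"
      by (intro arg_cong[where f="finsum M _"]) auto
    also have "\<dots> = (\<Oplus>\<^bsub>M\<^esub>j\<in>J. x i j)"
      using insert.prems by (subst finsum_reindex) (auto simp: inj_on_def)
    finally have 1: "finsum M (case_prod x) ({i} \<times> J) = (\<Oplus>\<^bsub>M\<^esub>j\<in>J. x i j)" .
    have "insert i I \<times> J = {i} \<times> J \<union> I \<times> J" by auto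
    then have "finsum M (case_prod x) (insert i I \<times> J)
        = finsum M (case_prod x) ({i} \<times> J) \<oplus>\<^bsub>M\<^esub> finsum M (case_prod x) (I
            \<times> J)"
      using insert J by (simp only:) (intro finsum_Un_disjoint; auto)
    also have "\<dots> = (\<Oplus>\<^bsub>M\<^esub>i\<in>insert i I. \<Oplus>\<^bsub>M\<^esub>j\<in>J. x i j)"
      using insert 1 by (subst finsum_insert) auto
    finally show ?case ..
  qed simp
qed

lemma finsum_swap:
  assumes M: "abelian_monoid M" and I: "finite I" and J: "finite J"
    and x: "\<And>i j. i \<in> I \<Longrightarrow> j \<in> J \<Longrightarrow> x i j \<in> carrier M"
  shows "(\<Oplus>\<^bsub>M\<^esub>i\<in>I. \<Oplus>\<^bsub>M\<^esub>j\<in>J. x i j) =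
      (\<Oplus>\<^bsub>M\<^esub>j\<in>J. \<Oplus>\<^bsub>M\<^esub>i\<in>I. x i j)"
proof -
  interpret abelian_monoid M by fact
  have "finsum M (case_prod x) (I \<times> J) = finsum M (case_prod x) (prod.swap ` (J \<times> I))"
    by (simp add: product_swap)
  also have "\<dots> = finsum M (\<lambda>k. case_prod x (prod.swap k)) (J \<times> I)"
    using x by (intro finsum_reindex) auto
  also have "\<dots> = finsum M (case_prod (\<lambda>j i. x i j)) (J \<times> I)"
    using x by (intro finsum_cong') auto
  finally show ?thesis
    using finsum_Times[OF M I J, of x] finsum_Times[OF M J I, of "\<lambda>j i. x i j"] x by simp
qed

section \<open>Restriction of scalars and averaging\<close>

lemma smult_sum_left:
  fixes M :: "('r::comm_ring_1, 'm) module"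
  assumes M: "module class_ring M" and x: "x \<in> carrier M"
  shows "(\<Sum>i\<in>I. r i) \<odot>\<^bsub>M\<^esub> x = (\<Oplus>\<^bsub>M\<^esub>i\<in>I. r i
      \<odot>\<^bsub>M\<^esub> x)"
proof -
  have "(\<lambda>s. s \<odot>\<^bsub>M\<^esub> x) \<in> module_hom class_ring regular_module M"
    using class_module_simps[OF M] x by (auto simp: module_hom_def)
  from hom_finsum[OF module_regular_module M this] show ?thesis by simp
qed

text \<open>Multiplication by \<open>r\<close> is an endomorphism because the ring is
  commutative.\<close>

lemma smult_finsum:
  fixes M :: "('r::comm_ring_1, 'm) module"
  assumes M: "module class_ring M" and x: "\<And>i. i \<in> I \<Longrightarrow> x i \<in> carrier M"
  shows "r \<odot>\<^bsub>M\<^esub> (\<Oplus>\<^bsub>M\<^esub>i\<in>I. x i) =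
      (\<Oplus>\<^bsub>M\<^esub>i\<in>I. r \<odot>\<^bsub>M\<^esub> x i)"
proof -
  have "(\<lambda>x. r \<odot>\<^bsub>M\<^esub> x) \<in> module_hom class_ring M M"
    using class_module_simps[OF M]
    by (auto simp: module_hom_def mult.commute[of r] simp flip: class_module_simps(6)[OF M])
  from hom_finsum[OF M M this x] show ?thesis .
qed

lemma submodule_finsum_closed:
  assumes N: "LinearCombinations.submodule R N M" and x: "\<And>i. i \<in> I \<Longrightarrow> x i \<in> N"
  shows "(\<Oplus>\<^bsub>M\<^esub>i\<in>I. x i) \<in> N"
proof -
  interpret N: LinearCombinations.submodule R N M by fact
  interpret module R M by (rule N.module)
  show ?thesis
    using x
  proof (induction I rule: infinite_finite_induct)
    case (insert i I)
    then have "(\<Oplus>\<^bsub>M\<^esub>j\<in>insert i I. x j) = x i \<oplus>\<^bsub>M\<^esub>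
        (\<Oplus>\<^bsub>M\<^esub>j\<in>I. x j)"
      using N.subset by (intro finsum_insert) auto
    then show ?case using insert by auto
  qed auto
qed

section \<open>Expansion in point masses and the underlying complex vector space\<close>

lemma poly_mapping_sum_singles:
  fixes r :: "'a \<Rightarrow>\<^sub>0 'b::comm_monoid_add"
  assumes "finite S" "Poly_Mapping.keys r \<subseteq> S"
  shows "r = (\<Sum>g\<in>S. Poly_Mapping.single g (Poly_Mapping.lookup r g))"
proof (rule poly_mapping_eqI)
  fix k
  have "Poly_Mapping.lookup (\<Sum>g\<in>S. Poly_Mapping.single g (Poly_Mapping.lookup r g)) k
      = (\<Sum>g\<in>S. if g = k then Poly_Mapping.lookup r g else 0)"
    by (simp add: lookup_sum lookup_single when_def)
  also have "\<dots> = Poly_Mapping.lookup r k"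
    using assms by (auto simp: in_keys_iff)
  finally show "Poly_Mapping.lookup r k = Poly_Mapping.lookup (\<Sum>g\<in>S. Poly_Mapping.single g
      (Poly_Mapping.lookup r g)) k" ..
qed

lemma restrict_scalars_simps [simp]:
  "carrier (restrict_scalars M) = carrier M" "\<zero>\<^bsub>restrict_scalars M\<^esub> =
      \<zero>\<^bsub>M\<^esub>"
  "x \<oplus>\<^bsub>restrict_scalars M\<^esub> y = x \<oplus>\<^bsub>M\<^esub> y"
  "c \<odot>\<^bsub>restrict_scalars M\<^esub> x = Poly_Mapping.single 0 c \<odot>\<^bsub>M\<^esub> x"
  by (simp_all add: restrict_scalars_def)

lemma finsum_restrict_scalars [simp]: "finsum (restrict_scalars M) = finsum M"
  by (intro ext) (simp add: finsum_def finprod_def restrict_scalars_def)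

lemma module_restrict_scalars:
  assumes M: "module class_ring M"
  shows "module class_ring (restrict_scalars M)"
proof -
  interpret module class_ring M by fact
  have "\<exists>y\<in>carrier M. x \<oplus>\<^bsub>M\<^esub> y = \<zero>\<^bsub>M\<^esub>" if "x \<in>
      carrier M" for x
    using that r_neg by blast
  then show ?thesis
    using class_module_simps[OF M]
    by (intro module_criteria)
      (auto simp: cring_class_ring single_add a_ac mult_single
        simp flip: class_module_simps(6)[OF M])
qed

lemma vectorspace_restrict_scalars:
  assumes "module class_ring M"
  shows "vectorspace class_ring (restrict_scalars M)"
  by (intro vectorspace.intro module_restrict_scalars assms class_field)

lemma group_algebra_sum_singles:
  fixes r :: "'g::finite \<Rightarrow>\<^sub>0 'b::comm_monoid_add"
  shows "r = (\<Sum>g\<in>UNIV. Poly_Mapping.single g (Poly_Mapping.lookup r g))"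
  by (rule poly_mapping_sum_singles) auto

text \<open>Writing \<open>r\<close> as the sum of its point masses shows that the translates of the
  generators by group elements span over the complex numbers; the group is finite, so there are
  finitely many.\<close>

lemma finitely_generated_finite_dim:
  fixes M :: "('g::{finite, ab_group_add} \<Rightarrow>\<^sub>0 complex, 'm) module"
  assumes M: "module class_ring M" and fg: "finitely_generated M"
  shows "vectorspace.fin_dim class_ring (restrict_scalars M)"
proof -
  interpret module class_ring M by fact
  interpret C: vectorspace class_ring "restrict_scalars M"
    by (rule vectorspace_restrict_scalars[OF M])
  obtain B where B: "finite B" "B \<subseteq> carrier M" "span B = carrier M"
    using fg by (auto simp: finitely_generated_def)
  let ?S = "(\<lambda>(g, b). Poly_Mapping.single g 1 \<odot>\<^bsub>M\<^esub> b) ` (UNIV \<times> B)"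
  have S: "finite ?S" "?S \<subseteq> carrier (restrict_scalars M)" using B by auto
  have sub: "LinearCombinations.submodule class_ring (C.span ?S) (restrict_scalars M)"
    by (rule C.span_is_submodule[OF S(2)])
  interpret sub: LinearCombinations.submodule class_ring "C.span ?S" "restrict_scalars M"
    by (rule sub)
  have rb: "r \<odot>\<^bsub>M\<^esub> b \<in> C.span ?S" if "b \<in> B" for r b
  proof -
    have b: "b \<in> carrier M" using B that by auto
    have "r \<odot>\<^bsub>M\<^esub> b = (\<Oplus>\<^bsub>M\<^esub>g\<in>UNIV. Poly_Mapping.single g
        (Poly_Mapping.lookup r g) \<odot>\<^bsub>M\<^esub> b)"
      by (subst group_algebra_sum_singles[of r], subst smult_sum_left[OF M b]) simp
    also have "\<dots> \<in> C.span ?S"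
    proof (rule submodule_finsum_closed[OF sub, simplified])
      fix g
      have "Poly_Mapping.single g (Poly_Mapping.lookup r g) \<odot>\<^bsub>M\<^esub> b
          = Poly_Mapping.lookup r g \<odot>\<^bsub>restrict_scalars M\<^esub> (Poly_Mapping.single g 1
              \<odot>\<^bsub>M\<^esub> b)"
        using b by (simp add: mult_single flip: class_module_simps(6)[OF M])
      moreover have "Poly_Mapping.single g 1 \<odot>\<^bsub>M\<^esub> b \<in> C.span ?S"
        using C.in_own_span[OF S(2)] that by auto
      ultimately show "Poly_Mapping.single g (Poly_Mapping.lookup r g) \<odot>\<^bsub>M\<^esub> b \<in>
          C.span ?S"
        using sub.smult_closed by auto
    qed
    finally show ?thesis .
  qed
  have "x \<in> C.span ?S" if "x \<in> carrier M" for x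
  proof -
    have "x \<in> span B" using B(3) that by simp
    then obtain a where "lincomb a B = x" using finite_in_span[OF B(1,2)] by blast
    then show ?thesis
      using submodule_finsum_closed[OF sub, of B "\<lambda>b. a b \<odot>\<^bsub>M\<^esub> b"] rb
      by (auto simp: lincomb_def)
  qed
  then have "C.span ?S = carrier (restrict_scalars M)"
    using C.span_is_subset2[OF S(2)] by auto
  then show ?thesis unfolding C.fin_dim_def using S by blast
qed

lemma finitely_generated_complex_basis:
  fixes M :: "('g::{finite, ab_group_add} \<Rightarrow>\<^sub>0 complex, 'm) module"
  assumes M: "module class_ring M" and fg: "finitely_generated M"
  obtains B l where "dual_basis (restrict_scalars M) B (\<lambda>b. b) l"
    and "\<And>b c. b \<in> B \<Longrightarrow> c \<in> B \<Longrightarrow> l b c = (if b = c then 1 else 0)"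
proof -
  interpret C: vectorspace class_ring "restrict_scalars M"
    by (rule vectorspace_restrict_scalars[OF M])
  obtain B where B: "finite B" "C.basis B"
    using C.finite_basis_exists[OF finitely_generated_finite_dim[OF M fg]] by auto
  then show ?thesis
    using basis_coordinates[OF C.module_axioms B(1)] that unfolding C.basis_def by metis
qed

text \<open>Averaging over the group turns complex coordinates into coordinates over the group
    algebra.\<close>

lemma average_functional:
  fixes M :: "('g::{finite, ab_group_add} \<Rightarrow>\<^sub>0 complex, 'm) module"
  assumes M: "module class_ring M"
    and l: "l \<in> module_hom class_ring (restrict_scalars M) regular_module"
  shows "(\<lambda>x. \<Sum>g\<in>UNIV. Poly_Mapping.single g (l (Poly_Mapping.single (- g) 1
      \<odot>\<^bsub>M\<^esub> x) / of_nat (card (UNIV :: 'g set))))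
    \<in> module_hom class_ring M regular_module" (is "?\<phi> \<in> _")
proof -
  note simps = class_module_simps[OF M]
  have add: "?\<phi> (x \<oplus>\<^bsub>M\<^esub> y) = ?\<phi> x + ?\<phi> y" if "x \<in> carrier M" "y
      \<in> carrier M" for x y
    using that by (simp add: simps(3,5) functional_add[OF l, simplified] add_divide_distrib
        single_add sum.distrib)
  \<comment> \<open>Shift the summation variable by \<open>h\<close>: then \<open>h\<close> splits
    off as a factor in front and cancels inside \<open>l\<close>, because -(h + k) + h = -k.\<close>
  have single: "?\<phi> (Poly_Mapping.single h c \<odot>\<^bsub>M\<^esub> x) = Poly_Mapping.single h c *
      ?\<phi> x"
    if x: "x \<in> carrier M" for h c x
  proof -
    have *: "l (Poly_Mapping.single (- (h + k)) 1 \<odot>\<^bsub>M\<^esub> (Poly_Mapping.single h c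
        \<odot>\<^bsub>M\<^esub> x))
        = c * l (Poly_Mapping.single (- k) 1 \<odot>\<^bsub>M\<^esub> x)" for k
    proof -
      have "Poly_Mapping.single (- (h + k)) 1 \<odot>\<^bsub>M\<^esub> (Poly_Mapping.single h c
          \<odot>\<^bsub>M\<^esub> x)
          = c \<odot>\<^bsub>restrict_scalars M\<^esub> (Poly_Mapping.single (- k) 1
              \<odot>\<^bsub>M\<^esub> x)"
        using x by (simp add: mult_single flip: simps(6))
      then show ?thesis using functional_smult[OF l] x simps(3) by simp
    qed
    have "?\<phi> (Poly_Mapping.single h c \<odot>\<^bsub>M\<^esub> x) = (\<Sum>k\<in>UNIV.
        Poly_Mapping.single (h + k)
        (l (Poly_Mapping.single (- (h + k)) 1 \<odot>\<^bsub>M\<^esub> (Poly_Mapping.single h c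
            \<odot>\<^bsub>M\<^esub> x)) / of_nat (card (UNIV :: 'g set))))"
      by (rule sum.reindex_bij_betw[symmetric]) (rule bij_plus)
    also have "\<dots> = Poly_Mapping.single h c * ?\<phi> x"
      by (simp only: *) (simp add: sum_distrib_left mult_single)
    finally show ?thesis .
  qed
  have "?\<phi> (r \<odot>\<^bsub>M\<^esub> x) = r * ?\<phi> x" if x: "x \<in> carrier M" for r x
  proof -
    have 0: "?\<phi> \<zero>\<^bsub>M\<^esub> = 0"
      using single[OF x, of 0 0] simps(2)[OF x] by simp
    \<comment> \<open>That \<open>?\<phi>\<close> is a homomorphism is what is being proved, so
      \<open>hom_finsum\<close> does not apply yet; additivity is extended to finite sums by
      hand.\<close>
    have fin: "?\<phi> (\<Oplus>\<^bsub>M\<^esub>i\<in>I. y i) = (\<Sum>i\<in>I. ?\<phi> (y i))"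
      if "\<And>i. i \<in> I \<Longrightarrow> y i \<in> carrier M" for I :: "'g set" and y
    proof -
      interpret module class_ring M by fact
      show ?thesis
        using finite[of I] that
      proof (induction I)
        case empty
        then show ?case using 0 by simp
      next
        case (insert i I)
        have "(\<Oplus>\<^bsub>M\<^esub>j\<in>insert i I. y j) = y i \<oplus>\<^bsub>M\<^esub>
            (\<Oplus>\<^bsub>M\<^esub>j\<in>I. y j)"
          using insert by (intro finsum_insert) auto
        moreover have "(\<Oplus>\<^bsub>M\<^esub>j\<in>I. y j) \<in> carrier M" "y i \<in> carrier M"
          using insert by (auto intro!: finsum_closed)
        ultimately show ?case using insert add by simp
      qed
    qed
    have "r \<odot>\<^bsub>M\<^esub> x = (\<Oplus>\<^bsub>M\<^esub>g\<in>UNIV. Poly_Mapping.single g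
        (Poly_Mapping.lookup r g) \<odot>\<^bsub>M\<^esub> x)"
      by (subst group_algebra_sum_singles[of r], subst smult_sum_left[OF M x]) simp
    then have "?\<phi> (r \<odot>\<^bsub>M\<^esub> x)
        = (\<Sum>g\<in>UNIV. ?\<phi> (Poly_Mapping.single g (Poly_Mapping.lookup r g)
            \<odot>\<^bsub>M\<^esub> x))"
      using fin[of UNIV "\<lambda>g. Poly_Mapping.single g (Poly_Mapping.lookup r g)
          \<odot>\<^bsub>M\<^esub> x"] simps(3)[OF x]
      by (simp only: simp_thms)
    also have "\<dots> = (\<Sum>g\<in>UNIV. Poly_Mapping.single g (Poly_Mapping.lookup r g)) * ?\<phi> x"
      by (simp only: single[OF x] sum_distrib_right)
    finally show ?thesis using group_algebra_sum_singles[of r] by simp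
  qed
  then show ?thesis using add by (simp add: module_hom_def)
qed

text \<open>For each \<open>g\<close> write x = g (g^-1 x), expand g^-1 x in the complex
  coordinates, and take the mean over the group, as in Maschke's theorem. The vectors
  \<open>p i\<close> are kept, so even when they form a complex basis they are in general dependent
  over the group algebra.\<close>

lemma average_dual_basis:
  fixes M :: "('g::{finite, ab_group_add} \<Rightarrow>\<^sub>0 complex, 'm) module"
  assumes M: "module class_ring M" and p: "dual_basis (restrict_scalars M) I p l"
  obtains \<phi> where "dual_basis M I p \<phi>"
proof -
  interpret module class_ring M by fact
  note simps = class_module_simps[OF M] and P = dual_basisD[OF p, simplified]
  define \<phi> where "\<phi> i x = (\<Sum>g\<in>UNIV. Poly_Mapping.single g
      (l i (Poly_Mapping.single (- g) 1 \<odot>\<^bsub>M\<^esub> x) / of_nat (card (UNIV :: 'g set))))"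
          for i x
  let ?N = "Poly_Mapping.single 0 (1 / of_nat (card (UNIV :: 'g set))) :: 'g \<Rightarrow>\<^sub>0 complex"
  have "x = (\<Oplus>\<^bsub>M\<^esub>i\<in>I. \<phi> i x \<odot>\<^bsub>M\<^esub> p i)" if x: "x \<in>
      carrier M" for x
  proof -
    define y where "y g = Poly_Mapping.single (- g) 1 \<odot>\<^bsub>M\<^esub> x" for g :: 'g
    have y: "y g \<in> carrier M" for g using x by (simp add: y_def simps)
    have coeff: "Poly_Mapping.single g (l i (y g) / of_nat (card (UNIV :: 'g set)))
        = (?N * Poly_Mapping.single g 1) * Poly_Mapping.single 0 (l i (y g))" for g i
      by (simp add: mult_single)
    have "x = (\<Oplus>\<^bsub>M\<^esub>g\<in>(UNIV :: 'g set). ?N \<odot>\<^bsub>M\<^esub> x)"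
    proof -
      have "x = 1 \<odot>\<^bsub>M\<^esub> x" using x by (simp add: simps)
      also have "1 = (\<Sum>g\<in>(UNIV :: 'g set). ?N)"
        by (simp add: mult_single flip: single_of_nat)
      also have "\<dots> \<odot>\<^bsub>M\<^esub> x = (\<Oplus>\<^bsub>M\<^esub>g\<in>(UNIV :: 'g set).
          ?N \<odot>\<^bsub>M\<^esub> x)"
        by (rule smult_sum_left[OF M x])
      finally show ?thesis .
    qed
    also have "\<dots> = (\<Oplus>\<^bsub>M\<^esub>g\<in>UNIV. \<Oplus>\<^bsub>M\<^esub>i\<in>I.
        Poly_Mapping.single g (l i (y g) / of_nat (card (UNIV :: 'g set))) \<odot>\<^bsub>M\<^esub> p i)"
    proof (intro finsum_cong' refl)
      fix g :: 'g
      \<comment> \<open>\<open>x\<close> is the translate of \<open>y g\<close> by \<open>g\<close>;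
        the scalar 1/|G| and \<open>g\<close> are then absorbed into the complex coordinates of
        \<open>y g\<close>.\<close>
      have "?N \<odot>\<^bsub>M\<^esub> x = (?N * Poly_Mapping.single g 1) \<odot>\<^bsub>M\<^esub> y g"
        using x by (simp add: y_def mult_single flip: simps(6))
      also have "y g = (\<Oplus>\<^bsub>M\<^esub>i\<in>I. Poly_Mapping.single 0 (l i (y g))
          \<odot>\<^bsub>M\<^esub> p i)"
        using P(4)[OF y[of g]] by simp
      also have "(?N * Poly_Mapping.single g 1) \<odot>\<^bsub>M\<^esub> \<dots>
          = (\<Oplus>\<^bsub>M\<^esub>i\<in>I. Poly_Mapping.single g (l i (y g) / of_nat (card (UNIV ::
              'g set))) \<odot>\<^bsub>M\<^esub> p i)"
        unfolding coeff using P(2) simps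
        by (subst smult_finsum[OF M]) (auto intro!: finsum_cong' simp: simps)
      finally show "?N \<odot>\<^bsub>M\<^esub> x
          = (\<Oplus>\<^bsub>M\<^esub>i\<in>I. Poly_Mapping.single g (l i (y g) / of_nat (card (UNIV ::
              'g set))) \<odot>\<^bsub>M\<^esub> p i)" .
    qed (use P(2) simps in auto)
    also have "\<dots> = (\<Oplus>\<^bsub>M\<^esub>i\<in>I. \<Oplus>\<^bsub>M\<^esub>g\<in>UNIV.
        Poly_Mapping.single g (l i (y g) / of_nat (card (UNIV :: 'g set))) \<odot>\<^bsub>M\<^esub> p i)"
      using P(1,2) simps by (intro finsum_swap[OF abelian_monoid_axioms]) auto
    also have "\<dots> = (\<Oplus>\<^bsub>M\<^esub>i\<in>I. \<phi> i x \<odot>\<^bsub>M\<^esub> p i)"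
      using P(2) simps(3)
      by (intro finsum_cong') (auto simp: \<phi>_def smult_sum_left[OF M] y_def)
    finally show ?thesis .
  qed
  moreover have "\<phi> i \<in> module_hom class_ring M regular_module" if "i \<in> I" for i
    unfolding \<phi>_def by (rule average_functional[OF M P(3)[OF that]])
  ultimately have "dual_basis M I p \<phi>"
    using P(1,2) by (auto simp: dual_basis_def)
  then show ?thesis using that by blast
qed

section \<open>Quotients and free modules\<close>

text \<open>The coset calculus asks for a subgroup, while a submodule is given by closure under sums
  and scalars; negatives come from multiplication by -1.\<close>

lemma submodule_abelian_subgroup:
  assumes "LinearCombinations.submodule R N M"
  shows "abelian_subgroup N M"
proof -
  interpret N: LinearCombinations.submodule R N M by fact
  interpret module R M by (rule N.module)
  have inv: "\<ominus>\<^bsub>M\<^esub> x \<in> N" if "x \<in> N" for x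
  proof -
    have "(\<ominus>\<^bsub>R\<^esub> \<one>\<^bsub>R\<^esub>) \<odot>\<^bsub>M\<^esub> x \<in> N" by
        (rule N.smult_closed) (use that in auto)
    moreover have "x \<in> carrier M" using that N.subset by auto
    ultimately show ?thesis by (simp add: smult_minus_1)
  qed
  have "subgroup N (add_monoid M)"
    by (rule subgroup.intro)
      (use N.subset N.m_closed N.zero_closed inv in \<open>simp_all flip: a_inv_def\<close>)
  then show ?thesis
    by (intro abelian_subgroupI3 additive_subgroupI abelian_group_axioms)
qed

context
  fixes M :: "('r::comm_ring_1, 'm) module" and N :: "'m set"
  assumes M: "module class_ring M" and N: "LinearCombinations.submodule class_ring N M"
begin

interpretation module class_ring M by (rule M)
interpretation N: LinearCombinations.submodule class_ring N M by (rule N)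
interpretation A: abelian_subgroup N M by (rule submodule_abelian_subgroup[OF N])

lemma quot_module_carrier: "carrier (quot_module M N) = (\<lambda>x. N +>\<^bsub>M\<^esub> x) ` carrier M"
  by (auto simp: quot_module_def A_RCOSETS_def')

lemma quot_module_zero: "\<zero>\<^bsub>quot_module M N\<^esub> = N +>\<^bsub>M\<^esub>
    \<zero>\<^bsub>M\<^esub>"
  using N.subset by (simp add: quot_module_def)

lemma quot_module_add:
  assumes "x \<in> carrier M" "y \<in> carrier M"
  shows "(N +>\<^bsub>M\<^esub> x) \<oplus>\<^bsub>quot_module M N\<^esub> (N +>\<^bsub>M\<^esub> y) = N
      +>\<^bsub>M\<^esub> (x \<oplus>\<^bsub>M\<^esub> y)"
  using A.a_rcos_sum[OF assms] by (simp add: quot_module_def)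

lemma coset_add_left:
  assumes "n \<in> N" "x \<in> carrier M"
  shows "N +>\<^bsub>M\<^esub> (n \<oplus>\<^bsub>M\<^esub> x) = N +>\<^bsub>M\<^esub> x"
proof (rule a_repr_independence[OF _ _ A.a_subgroup, symmetric])
  show "n \<oplus>\<^bsub>M\<^esub> x \<in> N +>\<^bsub>M\<^esub> x"
    using assms N.subset by (intro a_rcosI) auto
qed fact

text \<open>Two representatives differ by some \<open>n \<in> N\<close>, and its multiple by
  \<open>r\<close> is again in \<open>N\<close>, so the union that defines the scalar product is a
  union of equal cosets.\<close>

lemma quot_module_smult:
  assumes x: "x \<in> carrier M"
  shows "r \<odot>\<^bsub>quot_module M N\<^esub> (N +>\<^bsub>M\<^esub> x) = N +>\<^bsub>M\<^esub> (r
      \<odot>\<^bsub>M\<^esub> x)"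
proof -
  have "N +>\<^bsub>M\<^esub> (r \<odot>\<^bsub>M\<^esub> y) = N +>\<^bsub>M\<^esub> (r
      \<odot>\<^bsub>M\<^esub> x)" if "y \<in> N +>\<^bsub>M\<^esub> x" for y
  proof -
    obtain n where n: "n \<in> N" "y = n \<oplus>\<^bsub>M\<^esub> x" using \<open>y \<in> _\<close> by
        (auto simp: a_r_coset_def')
    moreover have "n \<in> carrier M" using n N.subset by auto
    ultimately have "r \<odot>\<^bsub>M\<^esub> y = r \<odot>\<^bsub>M\<^esub> n
        \<oplus>\<^bsub>M\<^esub> r \<odot>\<^bsub>M\<^esub> x"
      using x by (simp add: class_module_simps(5)[OF M])
    moreover have "r \<odot>\<^bsub>M\<^esub> n \<in> N" using n N.smult_closed[of r n] by simp
    ultimately show ?thesis using coset_add_left x by (simp add: class_module_simps(3)[OF M])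
  qed
  moreover have "x \<in> N +>\<^bsub>M\<^esub> x" using x by (rule A.a_rcos_self)
  ultimately have "(\<Union>y\<in>N +>\<^bsub>M\<^esub> x. N +>\<^bsub>M\<^esub> (r
      \<odot>\<^bsub>M\<^esub> y)) = N +>\<^bsub>M\<^esub> (r \<odot>\<^bsub>M\<^esub> x)"
    by blast
  then show ?thesis by (simp add: quot_module_def)
qed

lemma module_quot_module: "module class_ring (quot_module M N)"
proof (rule module_criteria, goal_cases)
  case 4
  show ?case
  proof
    fix X assume "X \<in> carrier (quot_module M N)"
    then obtain x where x: "x \<in> carrier M" "X = N +>\<^bsub>M\<^esub> x" by (auto simp:
        quot_module_carrier)
    then have "X \<oplus>\<^bsub>quot_module M N\<^esub> (N +>\<^bsub>M\<^esub>
        (\<ominus>\<^bsub>M\<^esub> x)) = \<zero>\<^bsub>quot_module M N\<^esub>"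
      by (simp add: quot_module_add quot_module_zero r_neg)
    then show "\<exists>Y\<in>carrier (quot_module M N). X \<oplus>\<^bsub>quot_module M N\<^esub> Y =
        \<zero>\<^bsub>quot_module M N\<^esub>"
      using x by (auto simp: quot_module_carrier)
  qed
qed (auto simp: quot_module_carrier quot_module_zero quot_module_add quot_module_smult
    class_module_simps[OF M] cring_class_ring a_ac)

lemma coset_eqD:
  assumes "x \<in> carrier M" "y \<in> carrier M" "N +>\<^bsub>M\<^esub> x = N +>\<^bsub>M\<^esub> y"
  obtains n where "n \<in> N" "x = n \<oplus>\<^bsub>M\<^esub> y"
  using A.a_rcos_self[OF assms(1)] assms(3) by (auto simp: a_r_coset_def')

lemma coset_hom: "(\<lambda>x. N +>\<^bsub>M\<^esub> x) \<in> module_hom class_ring M (quot_module M N)"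
  by (auto simp: module_hom_def quot_module_carrier quot_module_add quot_module_smult)

text \<open>The lift evaluates \<open>f\<close> at a chosen representative; since \<open>f\<close>
  vanishes on \<open>N\<close>, the choice does not matter.\<close>

lemma quot_module_lift:
  assumes P: "module class_ring P" and f: "f \<in> module_hom class_ring M P"
    and ker: "\<And>n. n \<in> N \<Longrightarrow> f n = \<zero>\<^bsub>P\<^esub>"
  obtains f' where "f' \<in> module_hom class_ring (quot_module M N) P"
    and "\<And>x. x \<in> carrier M \<Longrightarrow> f' (N +>\<^bsub>M\<^esub> x) = f x"
proof -
  interpret P: module class_ring P by fact
  define f' where "f' X = f (SOME x. x \<in> carrier M \<and> X = N +>\<^bsub>M\<^esub> x)" for X
  have eq: "f' (N +>\<^bsub>M\<^esub> x) = f x" if x: "x \<in> carrier M" for x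
  proof -
    define y where "y = (SOME y. y \<in> carrier M \<and> N +>\<^bsub>M\<^esub> x = N +>\<^bsub>M\<^esub> y)"
    have "y \<in> carrier M \<and> N +>\<^bsub>M\<^esub> x = N +>\<^bsub>M\<^esub> y"
      unfolding y_def by (rule someI[of _ x]) (simp add: x)
    then obtain n where n: "n \<in> N" "y = n \<oplus>\<^bsub>M\<^esub> x" "n \<in> carrier M"
      using coset_eqD[of y x] x N.subset by auto
    then have "f y = f n \<oplus>\<^bsub>P\<^esub> f x" using module_hom_add[OF f] x by simp
    also have "\<dots> = f x" using ker[OF n(1)] funcset_mem[OF module_hom_closed[OF f] x] by simp
    finally show ?thesis by (simp add: f'_def y_def)
  qed
  have "f' \<in> module_hom class_ring (quot_module M N) P"
    using module_hom_closed[OF f] module_hom_add[OF f] module_hom_smult[OF f]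
    by (auto simp: module_hom_def quot_module_carrier quot_module_add quot_module_smult eq
        class_module_simps[OF M] Pi_iff)
  then show ?thesis using that eq by blast
qed

end

text \<open>The kernel is a submodule, so it contains the span as soon as it contains
  \<open>S\<close>.\<close>

lemma hom_vanishes_on_span:
  assumes M: "module R M" and P: "module R P" and f: "f \<in> module_hom R M P"
    and S: "S \<subseteq> carrier M" "\<And>s. s \<in> S \<Longrightarrow> f s =
        \<zero>\<^bsub>P\<^esub>" and x: "x \<in> module.span R M S"
  shows "f x = \<zero>\<^bsub>P\<^esub>"
proof -
  interpret mod_hom R M P f
    by (intro mod_hom.intro mod_hom_axioms.intro assms)
  have "S \<subseteq> ker" using S by (auto simp: ker_def)
  then have "module.span R M S \<subseteq> ker"
    by (rule M.span_is_subset[OF _ ker_is_submodule])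
  then show ?thesis using x by (auto simp: ker_def)
qed

lemma finsum_superset:
  assumes M: "abelian_monoid M" and T: "finite T" "S \<subseteq> T"
    and x: "\<And>i. i \<in> S \<Longrightarrow> x i \<in> carrier M" and 0: "\<And>i. i \<in> T - S
        \<Longrightarrow> x i = \<zero>\<^bsub>M\<^esub>"
  shows "finsum M x S = finsum M x T"
proof -
  interpret abelian_monoid M by fact
  have "x i \<in> carrier M" if "i \<in> T" for i
    using that x 0 by (cases "i \<in> S") auto
  then show ?thesis using T 0 by (intro add.finprod_mono_neutral_cong_left) auto
qed

section \<open>Free modules and their universal property\<close>

lemma lookup_map_mult [simp]:
  "Poly_Mapping.lookup (Poly_Mapping.map ((*) r) f) k = (r :: 'r::comm_ring_1) * Poly_Mapping.lookup f k"
  by transfer (simp add: when_def)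

lemma free_module_simps [simp]:
  "carrier (free_module S) = {f. Poly_Mapping.keys f \<subseteq> S}" "\<zero>\<^bsub>free_module
      S\<^esub> = 0"
  "f \<oplus>\<^bsub>free_module S\<^esub> g = f + g" "r \<odot>\<^bsub>free_module S\<^esub> f =
      Poly_Mapping.map ((*) r) f"
  by (simp_all add: free_module_def)

lemma keys_map_mult: "Poly_Mapping.keys (Poly_Mapping.map ((*) (r :: 'r::comm_ring_1)) f) \<subseteq>
    Poly_Mapping.keys f"
  by (auto simp: in_keys_iff)

lemma module_free_module: "module class_ring (free_module S :: ('r::comm_ring_1, 's \<Rightarrow>\<^sub>0
    'r) module)"
proof (rule module_criteria, goal_cases)
  case 4
  show ?case by (auto intro!: exI[of _ "- _"])
next
  case 3
  show ?case using keys_add by fastforce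
next
  case 5
  show ?case using keys_map_mult by fastforce
qed (auto simp: cring_class_ring algebra_simps lookup_add intro!: poly_mapping_eqI)

lemma finsum_free_module:
  assumes "finite I" "\<And>i. i \<in> I \<Longrightarrow> Poly_Mapping.keys (x i) \<subseteq> S"
  shows "finsum (free_module S) x I = sum x I"
proof -
  interpret module class_ring "free_module S" by (rule module_free_module)
  show ?thesis using assms
  proof (induction I)
    case (insert i I)
    then have "finsum (free_module S) x (insert i I)
        = x i \<oplus>\<^bsub>free_module S\<^esub> finsum (free_module S) x I"
      by (intro finsum_insert) auto
    then show ?case using insert by simp
  qed simp
qed

lemma free_module_lift:
  fixes P :: "('r::comm_ring_1, 'p) module"
  assumes P: "module class_ring P" and u: "\<And>s. s \<in> S \<Longrightarrow> u s \<in> carrier P"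
  obtains f where "f \<in> module_hom class_ring (free_module S) P"
    and "\<And>s r. s \<in> S \<Longrightarrow> f (Poly_Mapping.single s r) = r \<odot>\<^bsub>P\<^esub> u s"
proof -
  interpret module class_ring P by fact
  define f where "f a = (\<Oplus>\<^bsub>P\<^esub>s\<in>Poly_Mapping.keys a. Poly_Mapping.lookup a s
      \<odot>\<^bsub>P\<^esub> u s)" for a
  \<comment> \<open>The support may be enlarged to any finite \<open>K\<close> inside
    \<open>S\<close>; additivity needs a common index set for \<open>a\<close>, \<open>b\<close> and
    \<open>a + b\<close>, whose supports differ.\<close>
  have f: "f a = (\<Oplus>\<^bsub>P\<^esub>s\<in>K. Poly_Mapping.lookup a s \<odot>\<^bsub>P\<^esub> u s)"
    if "finite K" "K \<subseteq> S" "Poly_Mapping.keys a \<subseteq> K" for K a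
    unfolding f_def using that u
    by (intro finsum_superset[OF abelian_monoid_axioms]) (auto simp: class_module_simps[OF P]
        not_in_keys_iff_lookup_eq_zero subset_iff)
  have "f \<in> module_hom class_ring (free_module S) P"
    unfolding module_hom_def
  proof (simp, intro conjI allI impI; (elim conjE)?)
    show "f \<in> {f. Poly_Mapping.keys f \<subseteq> S} \<rightarrow> carrier P"
      using u by (auto simp: f_def class_module_simps[OF P] subset_iff intro!: finsum_closed)
  next
    fix a b :: "_ \<Rightarrow>\<^sub>0 'r" assume ab: "Poly_Mapping.keys a \<subseteq> S"
        "Poly_Mapping.keys b \<subseteq> S"
    let ?K = "Poly_Mapping.keys a \<union> Poly_Mapping.keys b"
    have "f (a + b) = (\<Oplus>\<^bsub>P\<^esub>s\<in>?K. Poly_Mapping.lookup a s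
        \<odot>\<^bsub>P\<^esub> u s \<oplus>\<^bsub>P\<^esub> Poly_Mapping.lookup b s
        \<odot>\<^bsub>P\<^esub> u s)"
      using ab u keys_add[of a b]
      by (subst f[of ?K]) (auto intro!: finsum_cong' simp: lookup_add class_module_simps[OF P])
    also have "\<dots> = f a \<oplus>\<^bsub>P\<^esub> f b"
      using ab u by (subst finsum_addf) (auto simp: f[of ?K])
    finally show "f (a + b) = f a \<oplus>\<^bsub>P\<^esub> f b" .
  next
    fix r and a :: "_ \<Rightarrow>\<^sub>0 'r" assume a: "Poly_Mapping.keys a \<subseteq> S"
    have "f (Poly_Mapping.map ((*) r) a)
        = (\<Oplus>\<^bsub>P\<^esub>s\<in>Poly_Mapping.keys a. r \<odot>\<^bsub>P\<^esub>
            (Poly_Mapping.lookup a s \<odot>\<^bsub>P\<^esub> u s))"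
      using a u keys_map_mult[of r a]
      by (subst f[of "Poly_Mapping.keys a"])
        (auto intro!: finsum_cong' simp: class_module_simps(3,6)[OF P])
    also have "\<dots> = r \<odot>\<^bsub>P\<^esub> f a"
      unfolding f_def using a u
      by (intro smult_finsum[OF P, symmetric]) (auto simp: class_module_simps[OF P])
    finally show "f (Poly_Mapping.map ((*) r) a) = r \<odot>\<^bsub>P\<^esub> f a" .
  qed
  moreover have "f (Poly_Mapping.single s r) = r \<odot>\<^bsub>P\<^esub> u s" if "s \<in> S" for s r
  proof -
    have "(\<Oplus>\<^bsub>P\<^esub>t\<in>{s}. Poly_Mapping.lookup (Poly_Mapping.single s r) t
        \<odot>\<^bsub>P\<^esub> u t) = r \<odot>\<^bsub>P\<^esub> u s"
      using u that by (subst finsum_insert) (auto simp: class_module_simps[OF P])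
    then show ?thesis using that by (subst f[of "{s}"]) auto
  qed
  ultimately show ?thesis using that by blast
qed

section \<open>Tensor products\<close>

abbreviation tensor_submodule ::
  "('r::comm_ring_1, 'v) module \<Rightarrow> ('r, 'm) module \<Rightarrow> ('v \<times> 'm
      \<Rightarrow>\<^sub>0 'r) set" where
  "tensor_submodule V M \<equiv>
     module.span class_ring (free_module (carrier V \<times> carrier M)) (tensor_relations V M)"

definition pure_tensor ::
  "('r::comm_ring_1, 'v) module \<Rightarrow> ('r, 'm) module \<Rightarrow> 'v \<Rightarrow> 'm
      \<Rightarrow> ('v \<times> 'm \<Rightarrow>\<^sub>0 'r) set" where
  "pure_tensor V M v m =
     tensor_submodule V M +>\<^bsub>free_module (carrier V \<times> carrier M)\<^esub>
         Poly_Mapping.single (v, m) 1"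

context
  fixes V :: "('r::comm_ring_1, 'v) module" and M :: "('r, 'm) module"
  assumes V: "module class_ring V" and M: "module class_ring M"
begin

private abbreviation "F \<equiv> free_module (carrier V \<times> carrier M) :: ('r, 'v \<times> 'm
    \<Rightarrow>\<^sub>0 'r) module"
private abbreviation "N \<equiv> tensor_submodule V M"
private abbreviation "T \<equiv> tensor_product V M"

interpretation F: module class_ring F by (rule module_free_module)

lemma tensor_product_eq: "T = quot_module F N"
  by (simp add: tensor_product_def Let_def)

lemma tensor_relations_closed: "tensor_relations V M \<subseteq> carrier F"
proof -
  have 1: "Poly_Mapping.single x r \<in> carrier F" if "x \<in> carrier V \<times> carrier M" for x and r
      :: 'r
    using that by auto
  have diff: "f - g \<in> carrier F" if "f \<in> carrier F" "g \<in> carrier F" for f g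
    using that keys_diff[of f g] by auto
  show ?thesis
    unfolding tensor_relations_def
    using class_module_simps(3,8)[OF V] class_module_simps(3,8)[OF M]
    by (auto simp del: free_module_simps intro!: diff 1)
qed

lemma tensor_submodule: "LinearCombinations.submodule class_ring N F"
  by (rule F.span_is_submodule[OF tensor_relations_closed])

lemma module_tensor_product: "module class_ring T"
  unfolding tensor_product_eq by (rule module_quot_module[OF F.module_axioms tensor_submodule])

lemma pure_tensor_closed: "v \<in> carrier V \<Longrightarrow> m \<in> carrier M \<Longrightarrow>
    pure_tensor V M v m \<in> carrier T"
  unfolding tensor_product_eq pure_tensor_def
  by (auto simp: quot_module_carrier[OF F.module_axioms tensor_submodule])

lemma tensor_coset_eqI:
  assumes "f - g \<in> N" "g \<in> carrier F"
  shows "N +>\<^bsub>F\<^esub> f = N +>\<^bsub>F\<^esub> g"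
  using coset_add_left[OF F.module_axioms tensor_submodule assms] by simp

lemma tensor_coset_smult_single:
  assumes "v \<in> carrier V" "m \<in> carrier M"
  shows "N +>\<^bsub>F\<^esub> Poly_Mapping.single (v, m) r = r \<odot>\<^bsub>T\<^esub> pure_tensor V M v m"
  using quot_module_smult[OF F.module_axioms tensor_submodule, of "Poly_Mapping.single (v, m) 1" r] assms
  by (auto simp: pure_tensor_def tensor_product_eq)

lemma tensor_coset_add_singles:
  assumes "v \<in> carrier V" "m \<in> carrier M" "v' \<in> carrier V" "m' \<in> carrier M"
  shows "N +>\<^bsub>F\<^esub> (Poly_Mapping.single (v, m) 1 + Poly_Mapping.single (v', m') 1)
    = pure_tensor V M v m \<oplus>\<^bsub>T\<^esub> pure_tensor V M v' m'"
  using quot_module_add[OF F.module_axioms tensor_submodule,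
      of "Poly_Mapping.single (v, m) 1" "Poly_Mapping.single (v', m') 1"] assms
  by (auto simp: pure_tensor_def tensor_product_eq)

lemma in_tensor_submodule: "x \<in> tensor_relations V M \<Longrightarrow> x \<in> N"
  using F.in_own_span[OF tensor_relations_closed] by auto

text \<open>Additivity and homogeneity are two of the four families in
  \<open>tensor_relations\<close>, read modulo their span; the other two give
  \<open>pure_tensor_hom_right\<close>.\<close>

lemma pure_tensor_hom_left:
  assumes m: "m \<in> carrier M"
  shows "(\<lambda>v. pure_tensor V M v m) \<in> module_hom class_ring V T"
proof -
  have "pure_tensor V M (v \<oplus>\<^bsub>V\<^esub> w) m = pure_tensor V M v m \<oplus>\<^bsub>T\<^esub>
      pure_tensor V M w m"
    if "v \<in> carrier V" "w \<in> carrier V" for v w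
  proof -
    have "Poly_Mapping.single (v \<oplus>\<^bsub>V\<^esub> w, m) 1 - (Poly_Mapping.single (v, m) 1 +
        Poly_Mapping.single (w, m) 1) \<in> N"
      by (rule in_tensor_submodule) (use that m in \<open>auto simp: tensor_relations_def
          algebra_simps\<close>)
    from tensor_coset_eqI[OF this] show ?thesis
      using that m keys_add[of "Poly_Mapping.single (v, m) (1::'r)" "Poly_Mapping.single (w, m) 1"]
      by (auto simp: tensor_coset_add_singles simp flip: pure_tensor_def split: if_splits)
  qed
  moreover have "pure_tensor V M (r \<odot>\<^bsub>V\<^esub> v) m = r \<odot>\<^bsub>T\<^esub>
      pure_tensor V M v m"
    if "v \<in> carrier V" for r v
  proof -
    have "Poly_Mapping.single (r \<odot>\<^bsub>V\<^esub> v, m) 1 - Poly_Mapping.single (v, m) r \<in> N"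
      by (rule in_tensor_submodule) (use that m in \<open>auto simp: tensor_relations_def\<close>)
    from tensor_coset_eqI[OF this] show ?thesis
      using that m by (auto simp: tensor_coset_smult_single simp flip: pure_tensor_def)
  qed
  ultimately show ?thesis using pure_tensor_closed m by (auto simp: module_hom_def)
qed

lemma pure_tensor_hom_right:
  assumes v: "v \<in> carrier V"
  shows "(\<lambda>m. pure_tensor V M v m) \<in> module_hom class_ring M T"
proof -
  have "pure_tensor V M v (m \<oplus>\<^bsub>M\<^esub> n) = pure_tensor V M v m \<oplus>\<^bsub>T\<^esub>
      pure_tensor V M v n"
    if "m \<in> carrier M" "n \<in> carrier M" for m n
  proof -
    have "Poly_Mapping.single (v, m \<oplus>\<^bsub>M\<^esub> n) 1 - (Poly_Mapping.single (v, m) 1 +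
        Poly_Mapping.single (v, n) 1) \<in> N"
      by (rule in_tensor_submodule) (use that v in \<open>auto simp: tensor_relations_def
          algebra_simps\<close>)
    from tensor_coset_eqI[OF this] show ?thesis
      using that v keys_add[of "Poly_Mapping.single (v, m) (1::'r)" "Poly_Mapping.single (v, n) 1"]
      by (auto simp: tensor_coset_add_singles simp flip: pure_tensor_def split: if_splits)
  qed
  moreover have "pure_tensor V M v (r \<odot>\<^bsub>M\<^esub> m) = r \<odot>\<^bsub>T\<^esub>
      pure_tensor V M v m"
    if "m \<in> carrier M" for r m
  proof -
    have "Poly_Mapping.single (v, r \<odot>\<^bsub>M\<^esub> m) 1 - Poly_Mapping.single (v, m) r \<in> N"
      by (rule in_tensor_submodule) (use that v in \<open>auto simp: tensor_relations_def\<close>)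
    from tensor_coset_eqI[OF this] show ?thesis
      using that v by (auto simp: tensor_coset_smult_single simp flip: pure_tensor_def)
  qed
  ultimately show ?thesis using pure_tensor_closed v by (auto simp: module_hom_def)
qed

lemma tensor_product_decomp:
  assumes "X \<in> carrier T"
  obtains K a where "finite K" "K \<subseteq> carrier V \<times> carrier M"
    "X = (\<Oplus>\<^bsub>T\<^esub>k\<in>K. a k \<odot>\<^bsub>T\<^esub> pure_tensor V M (fst k) (snd k))"
proof -
  obtain f where f: "Poly_Mapping.keys f \<subseteq> carrier V \<times> carrier M" "X = N
      +>\<^bsub>F\<^esub> f"
    using assms by (auto simp: tensor_product_eq quot_module_carrier[OF F.module_axioms tensor_submodule])
  let ?s = "\<lambda>k. Poly_Mapping.single k (Poly_Mapping.lookup f k)"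
  interpret T: module class_ring T by (rule module_tensor_product)
  have "f = (\<Sum>k\<in>Poly_Mapping.keys f. ?s k)"
    by (rule poly_mapping_sum_singles) auto
  also have "\<dots> = finsum F ?s (Poly_Mapping.keys f)"
    using f(1) by (subst finsum_free_module) auto
  finally have e: "f = finsum F ?s (Poly_Mapping.keys f)" .
  have "X = N +>\<^bsub>F\<^esub> finsum F ?s (Poly_Mapping.keys f)"
    by (subst e[symmetric]) (rule f(2))
  also have "\<dots> = (\<Oplus>\<^bsub>T\<^esub>k\<in>Poly_Mapping.keys f. N +>\<^bsub>F\<^esub> ?s k)"
    unfolding tensor_product_eq using f(1)
    by (intro hom_finsum[OF F.module_axioms module_quot_module[OF F.module_axioms tensor_submodule]
        coset_hom[OF F.module_axioms tensor_submodule]]) auto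
  also have "\<dots> = (\<Oplus>\<^bsub>T\<^esub>k\<in>Poly_Mapping.keys f. Poly_Mapping.lookup f k
      \<odot>\<^bsub>T\<^esub> pure_tensor V M (fst k) (snd k))"
  proof (intro T.finsum_cong' refl)
    fix k assume "k \<in> Poly_Mapping.keys f"
    then have k: "fst k \<in> carrier V" "snd k \<in> carrier M" using f(1) by auto
    then show "N +>\<^bsub>F\<^esub> ?s k = Poly_Mapping.lookup f k \<odot>\<^bsub>T\<^esub> pure_tensor
        V M (fst k) (snd k)"
      using tensor_coset_smult_single[OF k] by simp
  next
    show "(\<lambda>k. Poly_Mapping.lookup f k \<odot>\<^bsub>T\<^esub> pure_tensor V M (fst k) (snd k))
        \<in> Poly_Mapping.keys f \<rightarrow> carrier T"
      using f(1) by (auto intro!: pure_tensor_closed class_module_simps(3)[OF module_tensor_product])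
  qed
  finally show ?thesis using f(1) by (intro that[of "Poly_Mapping.keys f" "Poly_Mapping.lookup f"]) auto
qed

text \<open>Pure tensors generate, by \<open>tensor_product_decomp\<close>. The lemma serves to
  recognise an endomorphism of the tensor product as the identity.\<close>

lemma tensor_product_hom_ext:
  fixes P :: "('r, 'p) module"
  assumes P: "module class_ring P" and f: "f \<in> module_hom class_ring T P" and g: "g \<in> module_hom
      class_ring T P"
    and eq: "\<And>v m. v \<in> carrier V \<Longrightarrow> m \<in> carrier M \<Longrightarrow> f
        (pure_tensor V M v m) = g (pure_tensor V M v m)"
    and X: "X \<in> carrier T"
  shows "f X = g X"
proof -
  interpret P: module class_ring P by fact
  obtain K a where K: "finite K" "K \<subseteq> carrier V \<times> carrier M"
    and X: "X = (\<Oplus>\<^bsub>T\<^esub>k\<in>K. a k \<odot>\<^bsub>T\<^esub> pure_tensor V M (fst k)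
        (snd k))"
    using tensor_product_decomp[OF X] .
  have t: "pure_tensor V M (fst k) (snd k) \<in> carrier T" if "k \<in> K" for k
    using K that by (auto intro!: pure_tensor_closed)
  have h: "h X = (\<Oplus>\<^bsub>P\<^esub>k\<in>K. a k \<odot>\<^bsub>P\<^esub> h (pure_tensor V M (fst
      k) (snd k)))"
    if h: "h \<in> module_hom class_ring T P" for h
  proof -
    have "h X = (\<Oplus>\<^bsub>P\<^esub>k\<in>K. h (a k \<odot>\<^bsub>T\<^esub> pure_tensor V M (fst
        k) (snd k)))"
      unfolding X using t class_module_simps(3)[OF module_tensor_product]
      by (intro hom_finsum[OF module_tensor_product P h]) auto
    also have "\<dots> = (\<Oplus>\<^bsub>P\<^esub>k\<in>K. a k \<odot>\<^bsub>P\<^esub> h (pure_tensor V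
        M (fst k) (snd k)))"
      using funcset_mem[OF module_hom_closed[OF h] t]
      by (intro P.finsum_cong') (auto simp: t module_hom_smult[OF h] class_module_simps(3)[OF P] simp
          del: split_paired_All)
    finally show ?thesis .
  qed
  have "f (pure_tensor V M (fst k) (snd k)) = g (pure_tensor V M (fst k) (snd k))" if "k \<in> K" for k
    using K that by (auto intro!: eq)
  then show ?thesis
    unfolding h[OF f] h[OF g] using funcset_mem[OF module_hom_closed[OF g] t]
    by (intro P.finsum_cong') (auto simp: class_module_simps(3)[OF P])
qed

text \<open>The linear extension of \<open>\<beta>\<close> to the free module kills each of the four
  families of relations because \<open>\<beta>\<close> is bilinear, hence it kills their span and
  factors through the quotient.\<close>

lemma tensor_product_lift:
  fixes P :: "('r, 'p) module"
  assumes P: "module class_ring P"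
    and left: "\<And>m. m \<in> carrier M \<Longrightarrow> (\<lambda>v. \<beta> v m) \<in> module_hom
        class_ring V P"
    and right: "\<And>v. v \<in> carrier V \<Longrightarrow> (\<lambda>m. \<beta> v m) \<in> module_hom
        class_ring M P"
  obtains f where "f \<in> module_hom class_ring T P"
    and "\<And>v m. v \<in> carrier V \<Longrightarrow> m \<in> carrier M \<Longrightarrow> f
        (pure_tensor V M v m) = \<beta> v m"
proof -
  interpret P: module class_ring P by fact
  note simps = class_module_simps[OF P]
  have \<beta>: "\<beta> v m \<in> carrier P" if "v \<in> carrier V" "m \<in> carrier M" for v m
    using module_hom_closed[OF left] that by auto
  obtain f where f: "f \<in> module_hom class_ring F P"
    and fs: "\<And>s r. s \<in> carrier V \<times> carrier M \<Longrightarrow> f (Poly_Mapping.single s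
        r) = r \<odot>\<^bsub>P\<^esub> case_prod \<beta> s"
    using free_module_lift[OF P, of "carrier V \<times> carrier M" "case_prod \<beta>"] \<beta> by auto
  have f_single: "f (Poly_Mapping.single (v, m) r) = r \<odot>\<^bsub>P\<^esub> \<beta> v m"
    if "v \<in> carrier V" "m \<in> carrier M" for v m r
    using fs[of "(v, m)" r] that by simp
  \<comment> \<open>The relations are differences of finitely supported functions, whereas a
    homomorphism is only known to respect sums and scalars.\<close>
  have f_diff: "f (x - y) = f x \<ominus>\<^bsub>P\<^esub> f y" if "x \<in> carrier F" "y \<in> carrier
      F" for x y
  proof -
    have d: "x - y \<in> carrier F" using that keys_diff[of x y] by auto
    have "f x = f ((x - y) \<oplus>\<^bsub>F\<^esub> y)" by simp
    also have "\<dots> = f (x - y) \<oplus>\<^bsub>P\<^esub> f y" by (rule module_hom_add[OF f d that(2)])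
    finally show ?thesis
      using d that module_hom_closed[OF f] by (auto simp: P.minus_eq P.add.m_assoc P.r_neg Pi_iff)
  qed
  have sF: "Poly_Mapping.single (v, m) r \<in> carrier F" if "v \<in> carrier V" "m \<in> carrier M" for
      v m and r :: 'r
    using that by auto
  have dF: "x - y \<in> carrier F" if "x \<in> carrier F" "y \<in> carrier F" for x y
    using that keys_diff[of x y] by auto
  have cancel: "p \<oplus>\<^bsub>P\<^esub> q \<ominus>\<^bsub>P\<^esub> p \<ominus>\<^bsub>P\<^esub> q =
      \<zero>\<^bsub>P\<^esub>" if "p \<in> carrier P" "q \<in> carrier P" for p q
    using that by (simp add: P.minus_eq P.a_comm[of p q] P.a_assoc P.r_neg P.r_neg2)
  note VC = class_module_simps(3,8)[OF V] and MC = class_module_simps(3,8)[OF M]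
  have "f x = \<zero>\<^bsub>P\<^esub>" if x: "x \<in> tensor_relations V M" for x
  proof -
    consider (a) v w m where "x = Poly_Mapping.single (v \<oplus>\<^bsub>V\<^esub> w, m) 1 -
        Poly_Mapping.single (v, m) 1 - Poly_Mapping.single (w, m) 1"
        "v \<in> carrier V" "w \<in> carrier V" "m \<in> carrier M"
      | (b) v m n where "x = Poly_Mapping.single (v, m \<oplus>\<^bsub>M\<^esub> n) 1 -
          Poly_Mapping.single (v, m) 1 - Poly_Mapping.single (v, n) 1"
        "v \<in> carrier V" "m \<in> carrier M" "n \<in> carrier M"
      | (c) r v m where "x = Poly_Mapping.single (r \<odot>\<^bsub>V\<^esub> v, m) 1 -
          Poly_Mapping.single (v, m) r"
        "v \<in> carrier V" "m \<in> carrier M"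
      | (d) r v m where "x = Poly_Mapping.single (v, r \<odot>\<^bsub>M\<^esub> m) 1 -
          Poly_Mapping.single (v, m) r"
        "v \<in> carrier V" "m \<in> carrier M"
      using x unfolding tensor_relations_def by blast
    then show ?thesis
    proof cases
      case a
      have "f x = \<beta> (v \<oplus>\<^bsub>V\<^esub> w) m \<ominus>\<^bsub>P\<^esub> \<beta> v m
          \<ominus>\<^bsub>P\<^esub> \<beta> w m"
        using a VC by (simp add: f_diff sF dF f_single \<beta> simps(1) del: free_module_simps)
      also have "\<beta> (v \<oplus>\<^bsub>V\<^esub> w) m = \<beta> v m \<oplus>\<^bsub>P\<^esub>
          \<beta> w m"
        using module_hom_add[OF left] a by simp
      finally show ?thesis
        using a \<beta> cancel by simp
    next
      case b
      have "f x = \<beta> v (m \<oplus>\<^bsub>M\<^esub> n) \<ominus>\<^bsub>P\<^esub> \<beta> v m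
          \<ominus>\<^bsub>P\<^esub> \<beta> v n"
        using b MC by (simp add: f_diff sF dF f_single \<beta> simps(1) del: free_module_simps)
      also have "\<beta> v (m \<oplus>\<^bsub>M\<^esub> n) = \<beta> v m \<oplus>\<^bsub>P\<^esub>
          \<beta> v n"
        using module_hom_add[OF right] b by simp
      finally show ?thesis
        using b \<beta> cancel by simp
    next
      case c
      have "f x = \<beta> (r \<odot>\<^bsub>V\<^esub> v) m \<ominus>\<^bsub>P\<^esub> r
          \<odot>\<^bsub>P\<^esub> \<beta> v m"
        using c VC by (simp add: f_diff sF dF f_single \<beta> simps(1) del: free_module_simps)
      also have "\<beta> (r \<odot>\<^bsub>V\<^esub> v) m = r \<odot>\<^bsub>P\<^esub> \<beta> v m"
        using module_hom_smult[OF left] c by simp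
      finally show ?thesis
        using c \<beta> by (simp add: P.minus_eq P.r_neg simps(3))
    next
      case d
      have "f x = \<beta> v (r \<odot>\<^bsub>M\<^esub> m) \<ominus>\<^bsub>P\<^esub> r
          \<odot>\<^bsub>P\<^esub> \<beta> v m"
        using d MC by (simp add: f_diff sF dF f_single \<beta> simps(1) del: free_module_simps)
      also have "\<beta> v (r \<odot>\<^bsub>M\<^esub> m) = r \<odot>\<^bsub>P\<^esub> \<beta> v m"
        using module_hom_smult[OF right] d by simp
      finally show ?thesis
        using d \<beta> by (simp add: P.minus_eq P.r_neg simps(3))
    qed
  qed
  then have "f x = \<zero>\<^bsub>P\<^esub>" if "x \<in> N" for x
    using hom_vanishes_on_span[OF F.module_axioms P f tensor_relations_closed] that by blast
  then obtain f' where f': "f' \<in> module_hom class_ring T P" "\<And>x. x \<in> carrier F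
      \<Longrightarrow> f' (N +>\<^bsub>F\<^esub> x) = f x"
    using quot_module_lift[OF F.module_axioms tensor_submodule P f] unfolding tensor_product_eq by metis
  have "f' (pure_tensor V M v m) = \<beta> v m" if "v \<in> carrier V" "m \<in> carrier M" for v m
    using f'(2)[OF sF[OF that, of 1]] f_single[OF that, of 1] \<beta>[OF that] by (simp add:
        pure_tensor_def simps)
  then show ?thesis using that f'(1) by blast
qed

end

lemma restrict_scalars_functional:
  assumes f: "f \<in> module_hom class_ring M N"
    and l: "l \<in> module_hom class_ring (restrict_scalars N) regular_module"
  shows "(\<lambda>x. l (f x)) \<in> module_hom class_ring (restrict_scalars M) regular_module"
proof -
  have "f x \<in> carrier N" if "x \<in> carrier M" for x
    using module_hom_closed[OF f] that by auto
  then show ?thesis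
    using functional_add[OF l] functional_smult[OF l]
    by (auto simp: module_hom_def module_hom_add[OF f] module_hom_smult[OF f])
qed

text \<open>\<open>V \<otimes> M\<close> has the dual basis \<open>b a \<otimes> p i\<close>, with
    coordinates \<open>v \<otimes> m \<mapsto> l a (\<phi> i m v)\<close>.\<close>

lemma complex_dim_tensor_product:
  fixes V :: "('g::ab_group_add \<Rightarrow>\<^sub>0 complex, 'v) module"
  assumes V: "module class_ring V" and M: "module class_ring M"
    and p: "dual_basis M I p \<phi>" and b: "dual_basis (restrict_scalars V) A b l"
  shows "of_nat (complex_dim (tensor_product V M)) = (\<Sum>a\<in>A. l a ((\<Sum>i\<in>I. \<phi> i (p i))
      \<odot>\<^bsub>V\<^esub> b a))"
proof -
  let ?T = "tensor_product V M"
  let ?t = "pure_tensor V M"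
  note T = module_tensor_product[OF V M]
  interpret T: module class_ring ?T by (rule T)
  note P = dual_basisD[OF p] and B = dual_basisD[OF b, simplified]
  note VS = class_module_simps[OF V] and TS = class_module_simps[OF T]
  \<comment> \<open>The contraction of the second factor against \<open>\<phi> i\<close>; it is
    bilinear in \<open>v\<close> and \<open>m\<close>, so the universal property provides
    it.\<close>
  have "\<exists>f. f \<in> module_hom class_ring ?T V \<and>
      (\<forall>v\<in>carrier V. \<forall>m\<in>carrier M. f (?t v m) = \<phi> i m
          \<odot>\<^bsub>V\<^esub> v)" if i: "i \<in> I" for i
  proof -
    have "(\<lambda>v. \<phi> i m \<odot>\<^bsub>V\<^esub> v) \<in> module_hom class_ring V V" for m
      using VS by (auto simp: module_hom_def mult.commute[of "\<phi> i m"] simp flip: VS(6))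
    moreover have "(\<lambda>m. \<phi> i m \<odot>\<^bsub>V\<^esub> v) \<in> module_hom class_ring M V"
        if "v \<in> carrier V" for v
      using that VS by (auto simp: module_hom_def functional_add[OF P(3)[OF i]] functional_smult[OF
          P(3)[OF i]])
    ultimately obtain f where "f \<in> module_hom class_ring ?T V"
      "\<And>v m. v \<in> carrier V \<Longrightarrow> m \<in> carrier M \<Longrightarrow> f (?t v m) =
          \<phi> i m \<odot>\<^bsub>V\<^esub> v"
      using tensor_product_lift[OF V M V, of "\<lambda>v m. \<phi> i m \<odot>\<^bsub>V\<^esub> v"] by metis
    then show ?thesis by blast
  qed
  then obtain \<psi> where \<psi>: "\<And>i. i \<in> I \<Longrightarrow> \<psi> i \<in> module_hom
      class_ring ?T V"
    and \<psi>t: "\<And>i v m. i \<in> I \<Longrightarrow> v \<in> carrier V \<Longrightarrow> m \<in>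
        carrier M \<Longrightarrow> \<psi> i (?t v m) = \<phi> i m \<odot>\<^bsub>V\<^esub> v"
    by metis
  have \<psi>c: "\<psi> i x \<in> carrier V" if "i \<in> I" "x \<in> carrier ?T" for i x
    using module_hom_closed[OF \<psi>] that by auto
  have tc: "?t v (p i) \<in> carrier ?T" if "i \<in> I" "v \<in> carrier V" for i v
    using pure_tensor_closed[OF V M] that P(2) by auto
  have th: "(\<lambda>v. ?t v (p i)) \<in> module_hom class_ring V ?T" if "i \<in> I" for i
    using pure_tensor_hom_left[OF V M] that P(2) by auto
  \<comment> \<open>Contract with each \<open>\<phi> i\<close>, tensor the result with
    \<open>p i\<close> and add up. This will be the identity, which writes every element as a sum of
    tensors with second factor some \<open>p i\<close>.\<close>
  define \<Theta> where "\<Theta> x = (\<Oplus>\<^bsub>?T\<^esub>i\<in>I. ?t (\<psi> i x) (p i))" for x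
  have \<Theta>: "\<Theta> \<in> module_hom class_ring ?T ?T"
  proof -
    have "\<Theta> x \<in> carrier ?T" if "x \<in> carrier ?T" for x
      using that \<psi>c tc by (auto simp: \<Theta>_def intro!: T.finsum_closed)
    moreover have "\<Theta> (x \<oplus>\<^bsub>?T\<^esub> y) = \<Theta> x \<oplus>\<^bsub>?T\<^esub>
        \<Theta> y" if "x \<in> carrier ?T" "y \<in> carrier ?T" for x y
    proof -
      have "\<Theta> (x \<oplus>\<^bsub>?T\<^esub> y) = (\<Oplus>\<^bsub>?T\<^esub>i\<in>I. ?t (\<psi> i
          x) (p i) \<oplus>\<^bsub>?T\<^esub> ?t (\<psi> i y) (p i))"
        unfolding \<Theta>_def using that
        by (intro T.finsum_cong')
          (auto simp: module_hom_add[OF \<psi>] module_hom_add[OF th] \<psi>c tc)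
      then show ?thesis unfolding \<Theta>_def using that by (simp add: T.finsum_addf Pi_iff \<psi>c tc)
    qed
    moreover have "\<Theta> (r \<odot>\<^bsub>?T\<^esub> x) = r \<odot>\<^bsub>?T\<^esub> \<Theta> x" if
        "x \<in> carrier ?T" for r x
    proof -
      have "\<Theta> (r \<odot>\<^bsub>?T\<^esub> x) = (\<Oplus>\<^bsub>?T\<^esub>i\<in>I. r
          \<odot>\<^bsub>?T\<^esub> ?t (\<psi> i x) (p i))"
        unfolding \<Theta>_def using that
        by (intro T.finsum_cong')
          (auto simp: module_hom_smult[OF \<psi>] module_hom_smult[OF th] \<psi>c tc TS(3))
      then show ?thesis unfolding \<Theta>_def using that by (simp add: smult_finsum[OF T] \<psi>c tc)
    qed
    ultimately show ?thesis by (auto simp: module_hom_def)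
  qed
  have id: "(\<lambda>x. x) \<in> module_hom class_ring ?T ?T" by (auto simp: module_hom_def)
  \<comment> \<open>On a pure tensor the scalar \<open>\<phi> i m\<close> crosses the tensor sign
    from \<open>v\<close> to \<open>p i\<close>, and the dual basis of \<open>M\<close> reassembles
    \<open>m\<close>.\<close>
  have \<Theta>_id: "\<Theta> x = x" if "x \<in> carrier ?T" for x
  proof (rule tensor_product_hom_ext[OF V M T \<Theta> id _ that])
    fix v m assume v: "v \<in> carrier V" and m: "m \<in> carrier M"
    have "\<Theta> (?t v m) = (\<Oplus>\<^bsub>?T\<^esub>i\<in>I. ?t v (\<phi> i m
        \<odot>\<^bsub>M\<^esub> p i))"
      unfolding \<Theta>_def
    proof (intro T.finsum_cong' refl)
      fix i assume i: "i \<in> I"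
      have "?t (\<psi> i (?t v m)) (p i) = \<phi> i m \<odot>\<^bsub>?T\<^esub> ?t v (p i)"
        using \<psi>t[OF i v m] module_hom_smult[OF th[OF i] _ v, of "\<phi> i m"] by simp
      also have "\<dots> = ?t v (\<phi> i m \<odot>\<^bsub>M\<^esub> p i)"
        using module_hom_smult[OF pure_tensor_hom_right[OF V M v] _ P(2)[OF i], of "\<phi> i m"] by simp
      finally show "?t (\<psi> i (?t v m)) (p i) = ?t v (\<phi> i m \<odot>\<^bsub>M\<^esub> p i)" .
    qed (use v P(2) in \<open>auto intro!: pure_tensor_closed[OF V M] class_module_simps(3)[OF M]\<close>)
    also have "\<dots> = ?t v (\<Oplus>\<^bsub>M\<^esub>i\<in>I. \<phi> i m \<odot>\<^bsub>M\<^esub> p i)"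
      using P(2) class_module_simps(3)[OF M]
      by (intro hom_finsum[OF M T pure_tensor_hom_right[OF V M v], symmetric]) auto
    also have "\<dots> = ?t v m" using P(4)[OF m] by simp
    finally show "\<Theta> (?t v m) = ?t v m" .
  qed
  let ?x = "\<lambda>(i, a). ?t (b a) (p i)"
  let ?f = "\<lambda>(i, a) x. l a (\<psi> i x)"
  have "dual_basis (restrict_scalars ?T) (I \<times> A) ?x ?f"
    unfolding dual_basis_def
  proof (intro conjI ballI)
    show "finite (I \<times> A)" using P(1) B(1) by simp
  next
    fix k assume "k \<in> I \<times> A"
    then show "?x k \<in> carrier (restrict_scalars ?T)"
      using tc B(2) by auto
  next
    fix k assume "k \<in> I \<times> A"
    then show "?f k \<in> module_hom class_ring (restrict_scalars ?T) regular_module"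
      using restrict_scalars_functional[OF \<psi>] B(3) by auto
  next
    fix x assume "x \<in> carrier (restrict_scalars ?T)"
    then have x: "x \<in> carrier ?T" by simp
    let ?y = "\<lambda>i a. Poly_Mapping.single 0 (l a (\<psi> i x)) \<odot>\<^bsub>?T\<^esub> ?t (b a) (p i)"
    have "x = \<Theta> x" using \<Theta>_id[OF x] by simp
    also have "\<dots> = (\<Oplus>\<^bsub>?T\<^esub>i\<in>I. \<Oplus>\<^bsub>?T\<^esub>a\<in>A. ?y i a)"
      unfolding \<Theta>_def
    proof (intro T.finsum_cong' refl)
      fix i assume i: "i \<in> I"
      have "?t (\<psi> i x) (p i) = ?t (\<Oplus>\<^bsub>V\<^esub>a\<in>A. Poly_Mapping.single 0 (l a
          (\<psi> i x)) \<odot>\<^bsub>V\<^esub> b a) (p i)"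
        using B(4)[OF \<psi>c[OF i x]] by simp
      also have "\<dots> = (\<Oplus>\<^bsub>?T\<^esub>a\<in>A. ?t (Poly_Mapping.single 0 (l a (\<psi> i
          x)) \<odot>\<^bsub>V\<^esub> b a) (p i))"
        using B(2) VS(3) by (intro hom_finsum[OF V T th[OF i]]) auto
      also have "\<dots> = (\<Oplus>\<^bsub>?T\<^esub>a\<in>A. ?y i a)"
        using B(2) i by (intro T.finsum_cong') (auto simp: module_hom_smult[OF th] TS(3) tc)
      finally show "?t (\<psi> i x) (p i) = (\<Oplus>\<^bsub>?T\<^esub>a\<in>A. ?y i a)" .
    qed (use B(2) tc TS(3) in \<open>auto intro!: T.finsum_closed\<close>)
    also have "\<dots> = finsum ?T (case_prod ?y) (I \<times> A)"
      using P(1) B(1,2) tc TS(3) by (intro finsum_Times[OF T.abelian_monoid_axioms]) auto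
    also have "\<dots> = (\<Oplus>\<^bsub>?T\<^esub>k\<in>I \<times> A. Poly_Mapping.single 0 (?f k x)
        \<odot>\<^bsub>?T\<^esub> ?x k)"
      using B(2) tc TS(3) by (intro T.finsum_cong') auto
    finally show "x = (\<Oplus>\<^bsub>restrict_scalars ?T\<^esub>k\<in>I \<times> A. ?f k x
        \<odot>\<^bsub>restrict_scalars ?T\<^esub> ?x k)"
      by simp
  qed
  \<comment> \<open>The diagonal coordinate at \<open>(i, a)\<close> is \<open>l a\<close> of
    \<open>\<phi> i (p i)\<close> acting on \<open>b a\<close>. Summing over \<open>i\<close> inside
    \<open>l a\<close> leaves only the trace of the dual basis of \<open>M\<close>.\<close>
  from dim_eq_trace[OF vectorspace_restrict_scalars[OF T] this]
  have "of_nat (complex_dim ?T) = (\<Sum>i\<in>I. \<Sum>a\<in>A. l a (\<psi> i (?t (b a) (p i))))"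
    by (simp add: complex_dim_def sum.cartesian_product case_prod_beta)
  also have "\<dots> = (\<Sum>i\<in>I. \<Sum>a\<in>A. l a (\<phi> i (p i) \<odot>\<^bsub>V\<^esub> b a))"
    using \<psi>t P(2) B(2) by (intro sum.cong) auto
  also have "\<dots> = (\<Sum>a\<in>A. \<Sum>i\<in>I. l a (\<phi> i (p i) \<odot>\<^bsub>V\<^esub> b a))"
    by (rule sum.swap)
  also have "\<dots> = (\<Sum>a\<in>A. l a ((\<Sum>i\<in>I. \<phi> i (p i)) \<odot>\<^bsub>V\<^esub> b a))"
    using B(2) VS(3)
    by (intro sum.cong refl)
      (simp add: smult_sum_left[OF V] functional_finsum[OF module_restrict_scalars[OF V] B(3), simplified])
  finally show ?thesis .
qed

section \<open>Permutation modules and the chain modules of a graph\<close>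

lemma single_sum: "Poly_Mapping.single k (\<Sum>i\<in>I. c i) = (\<Sum>i\<in>I. Poly_Mapping.single k (c i))"
  by (induction I rule: infinite_finite_induct) (simp_all add: single_add)

text \<open>Agrees with the scalar multiplication of \<open>perm_module\<close> on functions
  supported in \<open>X\<close>. Summing over fixed index sets instead of the supports makes
  additivity in both arguments a manipulation of sums.\<close>

definition perm_smult ::
  "'x set \<Rightarrow> ('g::finite \<Rightarrow> 'x \<Rightarrow> 'x) \<Rightarrow> ('g
      \<Rightarrow>\<^sub>0 complex) \<Rightarrow> ('x \<Rightarrow>\<^sub>0 complex) \<Rightarrow> ('x
      \<Rightarrow>\<^sub>0 complex)" where
  "perm_smult X act a f = (\<Sum>g\<in>UNIV. \<Sum>x\<in>X.
     Poly_Mapping.single (act g x) (Poly_Mapping.lookup a g * Poly_Mapping.lookup f x))"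

lemma perm_smult_sum_left:
  "perm_smult X act (\<Sum>i\<in>I. a i) f = (\<Sum>i\<in>I. perm_smult X act (a i) f)"
  unfolding perm_smult_def lookup_sum sum_distrib_right single_sum
  by (simp add: sum.swap[of _ I])

lemma perm_smult_sum_right:
  "perm_smult X act a (\<Sum>i\<in>I. f i) = (\<Sum>i\<in>I. perm_smult X act a (f i))"
  unfolding perm_smult_def lookup_sum sum_distrib_left single_sum
  by (simp add: sum.swap[of _ I])

lemma perm_smult_add_left: "perm_smult X act (a + b) f = perm_smult X act a f + perm_smult X act b f"
  by (simp add: perm_smult_def lookup_add distrib_right single_add sum.distrib)

lemma perm_smult_add_right: "perm_smult X act a (f + f') = perm_smult X act a f + perm_smult X act a f'"
  by (simp add: perm_smult_def lookup_add distrib_left single_add sum.distrib)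

lemma perm_smult_single:
  assumes X: "finite X" "x \<in> X"
  shows "perm_smult X act (Poly_Mapping.single g c) (Poly_Mapping.single x d) = Poly_Mapping.single (act
      g x) (c * d)"
proof -
  have "perm_smult X act (Poly_Mapping.single g c) (Poly_Mapping.single x d)
      = (\<Sum>h\<in>UNIV. if h = g then (\<Sum>y\<in>X. if y = x then Poly_Mapping.single (act g x) (c *
          d) else 0) else 0)"
    unfolding perm_smult_def
    by (intro sum.cong refl) (auto simp: lookup_single when_def intro!: sum.cong)
  then show ?thesis using X by simp
qed

lemma perm_smult_map_mult:
  "perm_smult X act a (Poly_Mapping.map ((*) c) f) = Poly_Mapping.map ((*) c) (perm_smult X act a f)"
  by (rule poly_mapping_eqI)
    (auto simp: perm_smult_def lookup_sum sum_distrib_left lookup_single when_def intro!: sum.cong)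

context
  fixes X :: "'x set" and act :: "'g::{finite, ab_group_add} \<Rightarrow> 'x \<Rightarrow> 'x"
  assumes X: "finite X" and act: "set_action X act"
begin

private abbreviation "P \<equiv> perm_module X act"

lemma set_action_closed: "x \<in> X \<Longrightarrow> act g x \<in> X"
  and set_action_0: "x \<in> X \<Longrightarrow> act 0 x = x"
  and set_action_add: "x \<in> X \<Longrightarrow> act (g + h) x = act g (act h x)"
  using act by (auto simp: set_action_def)

lemma perm_module_simps:
  "carrier P = {f. Poly_Mapping.keys f \<subseteq> X}" "\<zero>\<^bsub>P\<^esub> = 0" "f
      \<oplus>\<^bsub>P\<^esub> f' = f + f'"
  by (simp_all add: perm_module_def)

lemma perm_module_smult:
  assumes "Poly_Mapping.keys f \<subseteq> X"
  shows "a \<odot>\<^bsub>P\<^esub> f = perm_smult X act a f"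
proof -
  have "a \<odot>\<^bsub>P\<^esub> f = (\<Sum>g\<in>Poly_Mapping.keys a. \<Sum>x\<in>X.
      Poly_Mapping.single (act g x) (Poly_Mapping.lookup a g * Poly_Mapping.lookup f x))"
    unfolding perm_module_def module.simps
    by (intro sum.cong refl sum.mono_neutral_left) (use X assms in \<open>auto simp: in_keys_iff\<close>)
  also have "\<dots> = perm_smult X act a f"
    unfolding perm_smult_def
    by (rule sum.mono_neutral_left) (auto simp: in_keys_iff)
  finally show ?thesis .
qed

lemma keys_perm_smult: "Poly_Mapping.keys (perm_smult X act a f) \<subseteq> X"
proof -
  have "Poly_Mapping.keys (\<Sum>x\<in>X. Poly_Mapping.single (act g x) (Poly_Mapping.lookup a g *
      Poly_Mapping.lookup f x)) \<subseteq> X" for g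
    using keys_sum[of "\<lambda>x. Poly_Mapping.single (act g x) (Poly_Mapping.lookup a g *
        Poly_Mapping.lookup f x)" X]
      set_action_closed by (fastforce split: if_splits)
  then show ?thesis
    unfolding perm_smult_def using keys_sum by fastforce
qed

text \<open>Both sides are additive in \<open>a\<close>, \<open>b\<close> and \<open>f\<close>, so
  it suffices to compare them on point masses, where the identity is the action law.\<close>

lemma perm_smult_assoc:
  assumes f: "Poly_Mapping.keys f \<subseteq> X"
  shows "perm_smult X act (a * b) f = perm_smult X act a (perm_smult X act b f)"
proof -
  let ?s = "\<lambda>r g. Poly_Mapping.single g (Poly_Mapping.lookup r g)"
  have fs: "(\<Sum>x\<in>X. ?s f x) = f"
    using poly_mapping_sum_singles[OF X f] by simp
  have as: "(\<Sum>g\<in>UNIV. ?s r g) = r" for r :: "'g \<Rightarrow>\<^sub>0 complex"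
    using group_algebra_sum_singles[of r] by simp
  have "perm_smult X act ((\<Sum>g\<in>UNIV. ?s a g) * (\<Sum>h\<in>UNIV. ?s b h)) (\<Sum>x\<in>X. ?s f x)
      = (\<Sum>x\<in>X. \<Sum>g\<in>UNIV. \<Sum>h\<in>UNIV. perm_smult X act (?s a g * ?s b h) (?s f x))"
    by (simp only: sum_product perm_smult_sum_left perm_smult_sum_right)
  also have "\<dots> = (\<Sum>x\<in>X. \<Sum>g\<in>UNIV. \<Sum>h\<in>UNIV. perm_smult X act (?s a g)
      (perm_smult X act (?s b h) (?s f x)))"
    using X set_action_closed by (intro sum.cong refl) (simp add: mult_single perm_smult_single
        set_action_add mult.assoc)
  also have "\<dots> = (\<Sum>x\<in>X. \<Sum>h\<in>UNIV. \<Sum>g\<in>UNIV. perm_smult X act (?s a g)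
      (perm_smult X act (?s b h) (?s f x)))"
    by (intro sum.cong refl sum.swap)
  also have "\<dots> = perm_smult X act (\<Sum>g\<in>UNIV. ?s a g) (perm_smult X act (\<Sum>h\<in>UNIV.
      ?s b h) (\<Sum>x\<in>X. ?s f x))"
    by (simp only: perm_smult_sum_left perm_smult_sum_right)
  finally show ?thesis by (simp only: fs as)
qed

lemma perm_smult_one:
  assumes f: "Poly_Mapping.keys f \<subseteq> X"
  shows "perm_smult X act 1 f = f"
proof -
  let ?s = "\<lambda>r g. Poly_Mapping.single g (Poly_Mapping.lookup r g)"
  have fs: "(\<Sum>x\<in>X. ?s f x) = f"
    using poly_mapping_sum_singles[OF X f] by simp
  have "perm_smult X act (Poly_Mapping.single 0 1) (\<Sum>x\<in>X. ?s f x) = (\<Sum>x\<in>X. ?s f x)"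
    unfolding perm_smult_sum_right using X
    by (intro sum.cong refl) (simp add: perm_smult_single set_action_0 del: single_one)
  then show ?thesis by (simp add: fs)
qed

lemma module_perm_module: "module class_ring P"
proof -
  have keys: "Poly_Mapping.keys (f + f') \<subseteq> X" if "Poly_Mapping.keys f \<subseteq> X"
      "Poly_Mapping.keys f' \<subseteq> X"
    for f f' :: "'x \<Rightarrow>\<^sub>0 complex"
    using that keys_add[of f f'] by blast
  have "\<exists>f'. Poly_Mapping.keys f' \<subseteq> X \<and> f + f' = 0" if "Poly_Mapping.keys f
      \<subseteq> X" for f :: "'x \<Rightarrow>\<^sub>0 complex"
    using that by (intro exI[of _ "- f"]) simp
  then show ?thesis
    by (intro module_criteria)
      (auto simp: cring_class_ring perm_module_simps perm_module_smult keys keys_perm_smult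
        perm_smult_add_left perm_smult_add_right perm_smult_assoc perm_smult_one algebra_simps)
qed

lemma finsum_perm_module:
  assumes "finite I" "\<And>i. i \<in> I \<Longrightarrow> Poly_Mapping.keys (f i) \<subseteq> X"
  shows "finsum P f I = sum f I"
proof -
  have "finsum P f I = finsum (free_module X :: (complex, _) module) f I"
    by (simp add: finsum_def finprod_def perm_module_def free_module_def)
  then show ?thesis using finsum_free_module[OF assms] by simp
qed

lemma finitely_generated_perm_module: "finitely_generated P"
proof -
  interpret module class_ring P by (rule module_perm_module)
  let ?B = "(\<lambda>x. Poly_Mapping.single x 1) ` X"
  have B: "finite ?B" "?B \<subseteq> carrier P" using X by (auto simp: perm_module_simps)
  have sub: "LinearCombinations.submodule class_ring (span ?B) P" by (rule span_is_submodule[OF B(2)])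
  have "f \<in> span ?B" if "f \<in> carrier P" for f
  proof -
    have f: "Poly_Mapping.keys f \<subseteq> X" using that by (simp add: perm_module_simps)
    have "Poly_Mapping.single x (Poly_Mapping.lookup f x) \<in> span ?B" if "x \<in> X" for x
    proof -
      have "Poly_Mapping.single 0 (Poly_Mapping.lookup f x) \<odot>\<^bsub>P\<^esub> Poly_Mapping.single
          x 1 \<in> span ?B"
        using in_own_span[OF B(2)] that
        by (intro LinearCombinations.submodule.smult_closed[OF sub]) auto
      then show ?thesis using X that by (simp add: perm_module_smult perm_smult_single set_action_0)
    qed
    then have "(\<Oplus>\<^bsub>P\<^esub>x\<in>X. Poly_Mapping.single x (Poly_Mapping.lookup f x)) \<in>
        span ?B"
      by (rule submodule_finsum_closed[OF sub])
    then show ?thesis using X poly_mapping_sum_singles[OF X f] by (subst (asm) finsum_perm_module) auto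
  qed
  then show ?thesis
    unfolding finitely_generated_def using B span_is_subset2[OF B(2)] by blast
qed

end

section \<open>The chain modules of the graph\<close>

lemma finitely_generated_image:
  assumes M: "module class_ring M" and N: "module class_ring N" and f: "f \<in> module_hom class_ring M N"
    and surj: "f ` carrier M = carrier N" and fg: "finitely_generated M"
  shows "finitely_generated N"
proof -
  interpret M: module class_ring M by fact
  interpret N: module class_ring N by fact
  obtain B where B: "finite B" "B \<subseteq> carrier M" "M.span B = carrier M"
    using fg by (auto simp: finitely_generated_def)
  have fB: "f ` B \<subseteq> carrier N" using B surj by auto
  have sub: "LinearCombinations.submodule class_ring (N.span (f ` B)) N"
    by (rule N.span_is_submodule[OF fB])
  have "y \<in> N.span (f ` B)" if y: "y \<in> carrier N" for y
  proof -
    obtain x where x: "x \<in> carrier M" "y = f x" using y unfolding surj[symmetric] by auto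
    then have "x \<in> M.span B" using B by simp
    then obtain a where a: "M.lincomb a B = x" using M.finite_in_span[OF B(1,2)] by blast
    have "y = (\<Oplus>\<^bsub>N\<^esub>b\<in>B. f (a b \<odot>\<^bsub>M\<^esub> b))"
      unfolding x(2) a[symmetric] M.lincomb_def
      using B(2) class_module_simps(3)[OF M] by (intro hom_finsum[OF M N f]) auto
    also have "\<dots> \<in> N.span (f ` B)"
    proof (rule submodule_finsum_closed[OF sub])
      fix b assume b: "b \<in> B"
      then have "f (a b \<odot>\<^bsub>M\<^esub> b) = a b \<odot>\<^bsub>N\<^esub> f b"
        using B by (intro module_hom_smult[OF f]) auto
      then show "f (a b \<odot>\<^bsub>M\<^esub> b) \<in> N.span (f ` B)"
        using N.in_own_span[OF fB] b LinearCombinations.submodule.smult_closed[OF sub, of "a b" "f b"] by auto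
    qed
    finally show ?thesis .
  qed
  then show ?thesis
    unfolding finitely_generated_def using B(1) fB N.span_is_subset2[OF fB] by blast
qed

text \<open>\<open>edge_relations\<close> is only a complex span, so stability under the group
  algebra has to be shown. It holds on generators since \<open>bar\<close> commutes with the action:
  a group element maps the relation of \<open>e\<close> to the relation of its translate.\<close>

lemma edge_relations_submodule:
  fixes actE :: "'g::{finite, ab_group_add} \<Rightarrow> 'e \<Rightarrow> 'e"
  assumes fin: "finite_graph Y" and act: "graph_action Y actV actE"
  shows "LinearCombinations.submodule class_ring (edge_relations Y) (perm_module (edges Y) actE)"
proof -
  interpret graph_action Y actV actE by fact
  have E: "finite (edges Y)" using fin by (simp add: finite_graph_def)
  let ?E = "edges Y" and ?F = "free_module (edges Y) :: (complex, 'e \<Rightarrow>\<^sub>0 complex) module"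
  let ?W = "edge_relations Y"
  let ?r = "\<lambda>e. Poly_Mapping.single e 1 + Poly_Mapping.single (bar Y e) 1 :: 'e
      \<Rightarrow>\<^sub>0 complex"
  let ?S = "{?r e | e. e \<in> ?E}"
  interpret F: module class_ring ?F by (rule module_free_module)
  have S: "?S \<subseteq> carrier ?F"
    using bar_closed keys_add by fastforce
  have W: "?W = F.span ?S" by (simp add: edge_relations_def)
  have subW: "LinearCombinations.submodule class_ring ?W ?F"
    unfolding W by (rule F.span_is_submodule[OF S])
  interpret W: LinearCombinations.submodule class_ring ?W ?F by (rule subW)
  \<comment> \<open>The vectors of \<open>?W\<close> whose multiples by the group algebra all stay
    in \<open>?W\<close>. They form a complex subspace, so finding the generators in it is enough to
    conclude that it is all of \<open>?W\<close>.\<close>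
  let ?U = "{w \<in> ?W. \<forall>a. perm_smult ?E actE a w \<in> ?W}"
  have subU: "LinearCombinations.submodule class_ring ?U ?F"
    using W.subset W.m_closed W.zero_closed W.smult_closed
    by (intro LinearCombinations.submodule.intro F.module_axioms)
      (auto simp: perm_smult_add_right perm_smult_map_mult, simp add: perm_smult_def)
  have "?r e \<in> ?U" if e: "e \<in> ?E" for e
  proof -
    have rW: "?r e \<in> ?W" if "e \<in> ?E" for e
      unfolding W using F.in_own_span[OF S] that by blast
    have "perm_smult ?E actE a (?r e) \<in> ?W" for a
    proof -
      have "perm_smult ?E actE a (?r e)
          = (\<Sum>g\<in>UNIV. perm_smult ?E actE (Poly_Mapping.single g (Poly_Mapping.lookup a g)) (?r e))"
        by (subst (1) group_algebra_sum_singles[of a]) (rule perm_smult_sum_left)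
      also have "\<dots> = (\<Sum>g\<in>UNIV. Poly_Mapping.map ((*) (Poly_Mapping.lookup a g)) (?r (actE
          g e)))"
      proof (intro sum.cong refl)
        fix g
        have "actE g (bar Y e) = bar Y (actE g e)" using bar_act[OF e] by simp
        then show "perm_smult ?E actE (Poly_Mapping.single g (Poly_Mapping.lookup a g)) (?r e)
            = Poly_Mapping.map ((*) (Poly_Mapping.lookup a g)) (?r (actE g e))"
          using E e bar_closed[OF e]
          by (intro poly_mapping_eqI)
            (simp add: perm_smult_add_right perm_smult_single lookup_add lookup_single when_def)
      qed
      also have "\<dots> = finsum ?F (\<lambda>g. Poly_Mapping.map ((*) (Poly_Mapping.lookup a g)) (?r
          (actE g e))) UNIV"
      proof (rule finsum_free_module[symmetric])
        fix g
        have "actE g e \<in> ?E" using actE e by (simp add: set_action_def)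
        then show "Poly_Mapping.keys (Poly_Mapping.map ((*) (Poly_Mapping.lookup a g)) (?r (actE g e)))
            \<subseteq> ?E"
          using S keys_map_mult[of "Poly_Mapping.lookup a g" "?r (actE g e)"] by auto
      qed simp
      also have "\<dots> \<in> ?W"
      proof (rule submodule_finsum_closed[OF subW])
        fix g
        have "actE g e \<in> ?E" using actE e by (simp add: set_action_def)
        from W.smult_closed[OF _ rW[OF this], of "Poly_Mapping.lookup a g"]
        show "Poly_Mapping.map ((*) (Poly_Mapping.lookup a g)) (?r (actE g e)) \<in> ?W" by simp
      qed
      finally show ?thesis .
    qed
    then show ?thesis using rW e by simp
  qed
  then have "?W \<subseteq> ?U"
    unfolding W by (intro F.span_is_subset[OF _ subU[unfolded W]]) auto
  moreover have "Poly_Mapping.keys w \<subseteq> ?E" if "w \<in> ?W" for w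
    using W.subset that by auto
  ultimately have "c \<odot>\<^bsub>perm_module ?E actE\<^esub> w \<in> ?W" if "w \<in> ?W" for c w
    using that by (subst perm_module_smult[OF E actE]) auto
  then show ?thesis
    using W.subset W.m_closed W.zero_closed
    by (intro LinearCombinations.submodule.intro module_perm_module[OF E actE])
      (auto simp: perm_module_simps[OF E actE])
qed

lemma module_C0:
  assumes Y: "finite_graph Y" and act: "graph_action Y actV (actE :: 'g::{finite, ab_group_add}
      \<Rightarrow> _)"
  shows "module class_ring (C0 Y actV)" "finitely_generated (C0 Y actV)"
proof -
  have X: "finite (vertices Y)" using Y by (simp add: finite_graph_def)
  note actV = graph_action.actV[OF act]
  show "module class_ring (C0 Y actV)" "finitely_generated (C0 Y actV)"
    unfolding C0_def by (rule module_perm_module[OF X actV] finitely_generated_perm_module[OF X actV])+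
qed

lemma module_C1:
  assumes Y: "finite_graph Y" and act: "graph_action Y actV (actE :: 'g::{finite, ab_group_add}
      \<Rightarrow> _)"
  shows "module class_ring (C1 Y actE)" "finitely_generated (C1 Y actE)"
proof -
  have E: "finite (edges Y)" using Y by (simp add: finite_graph_def)
  note actE = graph_action.actE[OF act]
  note P = module_perm_module[OF E actE] and N = edge_relations_submodule[OF Y act]
  show mod: "module class_ring (C1 Y actE)"
    unfolding C1_def by (rule module_quot_module[OF P N])
  show "finitely_generated (C1 Y actE)"
    unfolding C1_def
    by (rule finitely_generated_image[OF P mod[unfolded C1_def] coset_hom[OF P N]
          quot_module_carrier[OF P N, symmetric] finitely_generated_perm_module[OF E actE]])
qed

section \<open>Determinants of endomorphisms\<close>

text \<open>Applying the coordinate \<open>\<phi> v\<close> to a relation returns its coefficient at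
  \<open>v\<close>. This is the converse of \<open>basis_coordinates\<close>, required because
  \<open>endo_det\<close> speaks of independent spanning lists.\<close>

lemma dual_basis_indep:
  fixes M :: "('r::comm_ring_1, 'm) module"
  assumes M: "module class_ring M" and B: "dual_basis M B (\<lambda>b. b) \<phi>"
    and \<phi>: "\<And>b c. b \<in> B \<Longrightarrow> c \<in> B \<Longrightarrow> \<phi> b c = (if b =
        c then 1 else 0)"
  shows "\<not> module.lin_dep class_ring M B"
proof
  interpret module class_ring M by fact
  note D = dual_basisD[OF B]
  assume "lin_dep B"
  then obtain a v where a: "lincomb a B = \<zero>\<^bsub>M\<^esub>" "v \<in> B" "a v \<noteq> 0"
    using finite_lin_dep[OF D(1)] D(2) by auto
  have "0 = \<phi> v (0 \<odot>\<^bsub>M\<^esub> v)"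
    using functional_smult[OF D(3)[OF a(2)] D(2)[OF a(2)], of 0] by simp
  also have "0 \<odot>\<^bsub>M\<^esub> v = lincomb a B"
    using a D(2) class_module_simps(2)[OF M] by simp
  also have "\<phi> v \<dots> = (\<Sum>b\<in>B. a b * \<phi> v b)"
    unfolding lincomb_def using D a(2) by (intro functional_lincomb[OF M]) auto
  also have "\<dots> = (\<Sum>b\<in>B. if v = b then a b else 0)"
    using \<phi>[OF a(2)] by (intro sum.cong) auto
  also have "\<dots> = a v" using D(1) a(2) by simp
  finally show False using a(3) by simp
qed

text \<open>Change of basis: with the transition matrices \<open>P\<close> and \<open>Q\<close>,
  whose entries are the coordinates of one basis in the other, C = Q A P and Q P = 1.\<close>

lemma endo_det_unique:
  fixes M :: "('r::comm_ring_1, 'm) module"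
  assumes char: "inj (of_nat :: nat \<Rightarrow> 'r)" and M: "module class_ring M" and F: "F \<in>
      module_hom class_ring M M"
    and bs: "distinct bs" "dual_basis M (set bs) (\<lambda>b. b) \<phi>"
      "\<And>b c. b \<in> set bs \<Longrightarrow> c \<in> set bs \<Longrightarrow> \<phi> b c = (if b =
          c then 1 else 0)"
    and A: "A \<in> carrier_mat (length bs) (length bs)"
      "\<And>j. j < length bs \<Longrightarrow> F (bs ! j) = (\<Oplus>\<^bsub>M\<^esub>i\<in>{..<length
          bs}. A $$ (i, j) \<odot>\<^bsub>M\<^esub> (bs ! i))"
    and cs: "distinct cs" "dual_basis M (set cs) (\<lambda>b. b) \<psi>"
      "\<And>b c. b \<in> set cs \<Longrightarrow> c \<in> set cs \<Longrightarrow> \<psi> b c = (if b =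
          c then 1 else 0)"
    and C: "C \<in> carrier_mat (length cs) (length cs)"
      "\<And>j. j < length cs \<Longrightarrow> F (cs ! j) = (\<Oplus>\<^bsub>M\<^esub>i\<in>{..<length
          cs}. C $$ (i, j) \<odot>\<^bsub>M\<^esub> (cs ! i))"
  shows "Determinant.det A = Determinant.det C"
proof -
  interpret module class_ring M by fact
  \<comment> \<open>Each length is the trace of the identity, and the trace does not depend on the
    basis. Injectivity of \<open>of_nat\<close> turns this equation in the ring into equality of the
    lengths.\<close>
  have "of_nat (length bs) = (\<Sum>b\<in>set bs. \<phi> b b)"
    using bs(1,3) by (simp add: distinct_card)
  also have "\<dots> = (\<Sum>c\<in>set cs. \<psi> c c)"
    by (rule dual_basis_trace_unique[OF M bs(2) cs(2)])
  also have "\<dots> = of_nat (length cs)"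
    using cs(1,3) by (simp add: distinct_card)
  finally have len: "length cs = length bs" using char by (simp add: inj_eq)
  define n where "n = length bs"
  let ?b = "\<lambda>i. bs ! i" and ?c = "\<lambda>i. cs ! i"
  have bsn: "bij_betw ?b {..<n} (set bs)" "bij_betw ?c {..<n} (set cs)"
    using bij_betw_nth[OF bs(1)] bij_betw_nth[OF cs(1)] len by (auto simp: n_def)
  note D = dual_basisD[OF dual_basis_reindex[OF M bs(2) bsn(1)], unfolded o_def]
    and E = dual_basisD[OF dual_basis_reindex[OF M cs(2) bsn(2)], unfolded o_def]
  have \<phi>: "\<phi> (?b i) (?b j) = (if i = j then 1 else 0)" if "i < n" "j < n" for i j
    using bs that by (simp add: n_def nth_eq_iff_index_eq)
  have \<psi>: "\<psi> (?c i) (?c j) = (if i = j then 1 else 0)" if "i < n" "j < n" for i j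
    using cs that len by (simp add: n_def nth_eq_iff_index_eq)
  have \<phi>h: "\<phi> (?b i) \<in> module_hom class_ring M regular_module" if "i < n" for i using D(3)
      that by simp
  have \<psi>h: "\<psi> (?c i) \<in> module_hom class_ring M regular_module" if "i < n" for i using E(3)
      that by simp
  have bM: "?b i \<in> carrier M" if "i < n" for i using D(2) that by simp
  have cM: "?c i \<in> carrier M" if "i < n" for i using E(2) that by simp
  define P where "P = mat n n (\<lambda>(i, j). \<phi> (?b i) (?c j))"
  define Q where "Q = mat n n (\<lambda>(i, j). \<psi> (?c i) (?b j))"
  have dim: "P \<in> carrier_mat n n" "Q \<in> carrier_mat n n" "A \<in> carrier_mat n n" "C \<in>
      carrier_mat n n"
    using A C len by (auto simp: P_def Q_def n_def)
  \<comment> \<open>One order of the product suffices: the determinants commute, so det Q, det A and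
    det P regroup as det (Q P) det A.\<close>
  have QP: "Q * P = 1\<^sub>m n"
  proof (rule eq_matI)
    fix i j assume "i < dim_row (1\<^sub>m n)" "j < dim_col (1\<^sub>m n)"
    then have ij: "i < n" "j < n" by auto
    have "(Q * P) $$ (i, j) = (\<Sum>k<n. \<phi> (?b k) (?c j) * \<psi> (?c i) (?b k))"
      using ij dim by (simp add: P_def Q_def scalar_prod_def atLeast0LessThan mult.commute)
    also have "\<dots> = \<psi> (?c i) (\<Oplus>\<^bsub>M\<^esub>k\<in>{..<n}. \<phi> (?b k) (?c j)
        \<odot>\<^bsub>M\<^esub> ?b k)"
      using bM by (intro functional_lincomb[OF M \<psi>h[OF ij(1)], symmetric]) auto
    also have "\<dots> = (1\<^sub>m n) $$ (i, j)"
      using D(4)[OF cM[OF ij(2)]] ij \<psi> by simp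
    finally show "(Q * P) $$ (i, j) = (1\<^sub>m n) $$ (i, j)" .
  qed (use dim in auto)
  have "C = Q * A * P"
  proof (rule eq_matI)
    fix i j assume "i < dim_row (Q * A * P)" "j < dim_col (Q * A * P)"
    then have ij: "i < n" "j < n" using dim by auto
    have Fc: "F (?b k) \<in> carrier M" if "k < n" for k
      using module_hom_closed[OF F] bM[OF that] by auto
    have "C $$ (i, j) = (\<Sum>k<n. C $$ (k, j) * \<psi> (?c i) (?c k))"
      using ij \<psi> by (simp add: if_distrib[of "(*) _"] cong: if_cong)
    also have "\<dots> = \<psi> (?c i) (F (?c j))"
      using ij cM C(2)[of j] len
      by (simp add: n_def) (subst functional_lincomb[OF M \<psi>h], auto simp: n_def)
    also have "F (?c j) = F (\<Oplus>\<^bsub>M\<^esub>k\<in>{..<n}. \<phi> (?b k) (?c j)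
        \<odot>\<^bsub>M\<^esub> ?b k)"
      using D(4)[OF cM[OF ij(2)]] by simp
    also have "\<dots> = (\<Oplus>\<^bsub>M\<^esub>k\<in>{..<n}. F (\<phi> (?b k) (?c j)
        \<odot>\<^bsub>M\<^esub> ?b k))"
      using bM class_module_simps(3)[OF M] by (intro hom_finsum[OF M M F]) auto
    also have "\<dots> = (\<Oplus>\<^bsub>M\<^esub>k\<in>{..<n}. \<phi> (?b k) (?c j)
        \<odot>\<^bsub>M\<^esub> F (?b k))"
      using bM Fc class_module_simps(3)[OF M]
      by (intro finsum_cong') (auto simp: module_hom_smult[OF F])
    also have "\<psi> (?c i) \<dots> = (\<Sum>k<n. \<phi> (?b k) (?c j) * \<psi> (?c i) (F (?b k)))"
      using Fc by (intro functional_lincomb[OF M \<psi>h[OF ij(1)]]) auto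
    also have "\<dots> = (\<Sum>k<n. (\<Sum>l<n. \<psi> (?c i) (?b l) * A $$ (l, k)) * \<phi> (?b k) (?c j))"
    proof (intro sum.cong refl)
      fix k assume "k \<in> {..<n}"
      then have k: "k < n" by simp
      have "\<psi> (?c i) (F (?b k)) = (\<Sum>l<n. A $$ (l, k) * \<psi> (?c i) (?b l))"
        using A(2)[of k] k bM functional_lincomb[OF M \<psi>h[OF ij(1)], of "{..<n}" ?b "\<lambda>l. A $$
            (l, k)"]
        by (simp add: n_def)
      then show "\<phi> (?b k) (?c j) * \<psi> (?c i) (F (?b k))
          = (\<Sum>l<n. \<psi> (?c i) (?b l) * A $$ (l, k)) * \<phi> (?b k) (?c j)"
        by (simp add: mult.commute)
    qed
    also have "\<dots> = (Q * A * P) $$ (i, j)"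
      using ij dim by (simp add: P_def Q_def scalar_prod_def atLeast0LessThan)
    finally show "C $$ (i, j) = (Q * A * P) $$ (i, j)" .
  qed (use dim in auto)
  then have "Determinant.det C = Determinant.det Q * Determinant.det A * Determinant.det P"
    using dim by (simp add: det_mult[of _ n])
  also have "\<dots> = Determinant.det (Q * P) * Determinant.det A"
    using dim by (simp add: det_mult[of _ n] ac_simps)
  finally show ?thesis using QP by simp
qed

text \<open>The given basis is a witness for the definite description. A competing basis comes
  without coordinates; \<open>basis_coordinates\<close> supplies them, so that
  \<open>endo_det_unique\<close> applies.\<close>

lemma endo_det_eq:
  fixes M :: "('r::comm_ring_1, 'm) module"
  assumes char: "inj (of_nat :: nat \<Rightarrow> 'r)" and M: "module class_ring M" and F: "F \<in>
      module_hom class_ring M M"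
    and bs: "distinct bs" "dual_basis M (set bs) (\<lambda>b. b) \<phi>"
      "\<And>b c. b \<in> set bs \<Longrightarrow> c \<in> set bs \<Longrightarrow> \<phi> b c = (if b =
          c then 1 else 0)"
  shows "endo_det M F = Determinant.det (mat (length bs) (length bs) (\<lambda>(i, j). \<phi> (bs ! i) (F
      (bs ! j))))"
    (is "_ = Determinant.det ?A")
proof -
  interpret module class_ring M by fact
  note D = dual_basisD[OF bs(2)]
  have A: "?A \<in> carrier_mat (length bs) (length bs)" by simp
  have FA: "F (bs ! j) = (\<Oplus>\<^bsub>M\<^esub>i\<in>{..<length bs}. ?A $$ (i, j)
      \<odot>\<^bsub>M\<^esub> (bs ! i))" if j: "j < length bs" for j
  proof -
    have "F (bs ! j) \<in> carrier M"
      using module_hom_closed[OF F] D(2) j by auto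
    then have "F (bs ! j) = (\<Oplus>\<^bsub>M\<^esub>i\<in>{..<length bs}. \<phi> (bs ! i) (F (bs ! j))
        \<odot>\<^bsub>M\<^esub> (bs ! i))"
      using dual_basisD(4)[OF dual_basis_reindex[OF M bs(2) bij_betw_nth[OF bs(1) refl refl]], of "F (bs
          ! j)"]
      by simp
    also have "\<dots> = (\<Oplus>\<^bsub>M\<^esub>i\<in>{..<length bs}. ?A $$ (i, j)
        \<odot>\<^bsub>M\<^esub> (bs ! i))"
      using j D(2) class_module_simps(3)[OF M] by (intro finsum_cong') auto
    finally show ?thesis .
  qed
  show ?thesis
    unfolding endo_det_def
  proof (rule the_equality)
    have "set bs \<subseteq> carrier M" using D(2) by auto
    moreover have "span (set bs) = carrier M"
      using dual_basis_span[OF M bs(2)] by simp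
    ultimately show "\<exists>bs A. distinct bs \<and> set bs \<subseteq> carrier M \<and> \<not> lin_dep
        (set bs) \<and>
        span (set bs) = carrier M \<and> A \<in> carrier_mat (length bs) (length bs) \<and>
        (\<forall>j<length bs. F (bs ! j) = (\<Oplus>\<^bsub>M\<^esub>i\<in>{..<length bs}. A $$ (i, j)
            \<odot>\<^bsub>M\<^esub> (bs ! i))) \<and>
        Determinant.det ?A = Determinant.det A"
      using bs(1) dual_basis_indep[OF M bs(2,3)] A FA by blast
  next
    fix d
    assume "\<exists>bs A. distinct bs \<and> set bs \<subseteq> carrier M \<and> \<not> lin_dep (set bs)
        \<and>
        span (set bs) = carrier M \<and> A \<in> carrier_mat (length bs) (length bs) \<and>
        (\<forall>j<length bs. F (bs ! j) = (\<Oplus>\<^bsub>M\<^esub>i\<in>{..<length bs}. A $$ (i, j)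
            \<odot>\<^bsub>M\<^esub> (bs ! i))) \<and>
        d = Determinant.det A"
    then obtain cs C where cs: "distinct cs" "set cs \<subseteq> carrier M" "\<not> lin_dep (set cs)"
      "span (set cs) = carrier M" and C: "C \<in> carrier_mat (length cs) (length cs)"
        "\<And>j. j < length cs \<Longrightarrow> F (cs ! j) = (\<Oplus>\<^bsub>M\<^esub>i\<in>{..<length
            cs}. C $$ (i, j) \<odot>\<^bsub>M\<^esub> (cs ! i))"
      and d: "d = Determinant.det C"
      by blast
    obtain \<psi> where "dual_basis M (set cs) (\<lambda>b. b) \<psi>"
      "\<And>b c. b \<in> set cs \<Longrightarrow> c \<in> set cs \<Longrightarrow> \<psi> b c = (if b =
          c then 1 else 0)"
      using basis_coordinates[OF M finite_set cs(2,3,4)] by blast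
    from endo_det_unique[OF char M F bs A FA cs(1) this C] show "d = Determinant.det ?A"
      using d by simp
  qed
qed

section \<open>Power series over a representation\<close>

text \<open>Supplies the hypothesis \<open>char\<close> of \<open>endo_det_eq\<close> for power
  series, where the constant term separates the naturals.\<close>

lemma inj_of_nat_fps: "inj (of_nat :: nat \<Rightarrow> 'a::{comm_ring_1, ring_char_0} fps)"
proof (rule injI)
  fix m n :: nat assume "of_nat m = (of_nat n :: 'a fps)"
  then have "fps_nth (of_nat m :: 'a fps) 0 = fps_nth (of_nat n) 0" by simp
  then show "m = n" by (simp flip: fps_of_nat)
qed

lemma series_module_simps [simp]:
  "carrier (series_module V) = {f. \<forall>n. f n \<in> carrier V}"
  "\<zero>\<^bsub>series_module V\<^esub> = (\<lambda>_. \<zero>\<^bsub>V\<^esub>)"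
  "f \<oplus>\<^bsub>series_module V\<^esub> g = (\<lambda>n. f n \<oplus>\<^bsub>V\<^esub> g n)"
  "s \<odot>\<^bsub>series_module V\<^esub> f = (\<lambda>n. \<Oplus>\<^bsub>V\<^esub>i\<in>{..n}.
      Poly_Mapping.single 0 (fps_nth s i) \<odot>\<^bsub>V\<^esub> f (n - i))"
  by (simp_all add: series_module_def)

definition series_const :: "('r, 'v) module \<Rightarrow> 'v \<Rightarrow> nat \<Rightarrow> 'v" where
  "series_const V b n = (if n = 0 then b else \<zero>\<^bsub>V\<^esub>)"

definition series_coord :: "('v \<Rightarrow> complex) \<Rightarrow> (nat \<Rightarrow> 'v) \<Rightarrow>
    complex fps" where
  "series_coord l f = Abs_fps (\<lambda>n. l (f n))"

context
  fixes V :: "('g::{finite, ab_group_add} \<Rightarrow>\<^sub>0 complex, 'v) module" and B l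
  assumes V: "module class_ring V" and B: "dual_basis (restrict_scalars V) B (\<lambda>b. b) l"
    and l: "\<And>b c. b \<in> B \<Longrightarrow> c \<in> B \<Longrightarrow> l b c = (if b = c then 1
        else 0)"
begin

interpretation module class_ring V by (rule V)

private abbreviation "S \<equiv> series_module V"

private lemmas VS = class_module_simps[OF V]
private lemmas D = dual_basisD[OF B, simplified]
private lemmas RV = module_restrict_scalars[OF V]

private lemma l_finsum:
  assumes "b \<in> B" "\<And>i. i \<in> I \<Longrightarrow> x i \<in> carrier V"
  shows "l b (\<Oplus>\<^bsub>V\<^esub>i\<in>I. x i) = (\<Sum>i\<in>I. l b (x i))"
  using functional_finsum[OF RV D(3)[OF assms(1)], of I x] assms(2) by simp

private lemma l_add: "b \<in> B \<Longrightarrow> x \<in> carrier V \<Longrightarrow> y \<in> carrier V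
    \<Longrightarrow> l b (x \<oplus>\<^bsub>V\<^esub> y) = l b x + l b y"
  using functional_add[OF D(3), of b x y] by simp

private lemma l_smult: "b \<in> B \<Longrightarrow> x \<in> carrier V \<Longrightarrow> l b
    (Poly_Mapping.single 0 c \<odot>\<^bsub>V\<^esub> x) = c * l b x"
  using functional_smult[OF D(3), of b x c] by simp

private lemma l_zero: "b \<in> B \<Longrightarrow> l b \<zero>\<^bsub>V\<^esub> = 0"
  using l_smult[of b "\<zero>\<^bsub>V\<^esub>" 0] by (simp add: VS)

private lemma coord_ext:
  assumes "x \<in> carrier V" "y \<in> carrier V" "\<And>b. b \<in> B \<Longrightarrow> l b x = l b y"
  shows "x = y"
proof -
  have "x = (\<Oplus>\<^bsub>V\<^esub>b\<in>B. Poly_Mapping.single 0 (l b x) \<odot>\<^bsub>V\<^esub> b)"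
    using D(4)[OF assms(1)] by simp
  also have "\<dots> = (\<Oplus>\<^bsub>V\<^esub>b\<in>B. Poly_Mapping.single 0 (l b y)
      \<odot>\<^bsub>V\<^esub> b)"
    using assms(3) D(2) by (intro finsum_cong') (auto simp: VS)
  also have "\<dots> = y" using D(4)[OF assms(2)] by simp
  finally show ?thesis .
qed

text \<open>Reduces identities in \<open>V[[u]]\<close> to identities between complex power series.
  The module axioms and the linearity of \<open>series_endo\<close> are obtained in this way,
  without handling convolutions of vectors.\<close>

lemma series_coord_ext:
  assumes "f \<in> carrier S" "g \<in> carrier S" "\<And>b. b \<in> B \<Longrightarrow> series_coord (l
      b) f = series_coord (l b) g"
  shows "f = g"
proof
  fix n
  have "l b (f n) = l b (g n)" if "b \<in> B" for b
    using arg_cong[OF assms(3)[OF that], of "\<lambda>s. fps_nth s n"] by (simp add: series_coord_def)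
  then show "f n = g n" using assms by (intro coord_ext) auto
qed

lemma series_coord_add:
  assumes "b \<in> B" "f \<in> carrier S" "g \<in> carrier S"
  shows "series_coord (l b) (f \<oplus>\<^bsub>S\<^esub> g) = series_coord (l b) f + series_coord (l b) g"
  using assms by (intro fps_ext) (simp add: series_coord_def l_add)

lemma series_coord_smult:
  assumes "b \<in> B" "f \<in> carrier S"
  shows "series_coord (l b) (s \<odot>\<^bsub>S\<^esub> f) = s * series_coord (l b) f"
  using assms by (intro fps_ext) (simp add: series_coord_def l_finsum l_smult VS fps_mult_nth atLeast0AtMost)

lemma series_smult_closed: "f \<in> carrier S \<Longrightarrow> s \<odot>\<^bsub>S\<^esub> f \<in> carrier S"
  by (auto simp: VS intro!: finsum_closed)

lemma series_add_closed: "f \<in> carrier S \<Longrightarrow> g \<in> carrier S \<Longrightarrow> f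
    \<oplus>\<^bsub>S\<^esub> g \<in> carrier S"
  by auto

lemma module_series_module: "module class_ring S"
proof (rule module_criteria, goal_cases)
  case 4
  have "(\<lambda>n. \<ominus>\<^bsub>V\<^esub> f n) \<in> carrier S \<and> f \<oplus>\<^bsub>S\<^esub>
      (\<lambda>n. \<ominus>\<^bsub>V\<^esub> f n) = \<zero>\<^bsub>S\<^esub>" if "f \<in> carrier S" for f
    using that by (auto simp: r_neg)
  then show ?case by blast
qed (use series_smult_closed series_add_closed in
    \<open>auto simp: cring_class_ring a_ac series_coord_smult series_coord_add algebra_simps
      simp del: series_module_simps(1,3,4) intro!: series_coord_ext\<close>, auto)

lemma series_coord_functional:
  assumes "b \<in> B"
  shows "series_coord (l b) \<in> module_hom class_ring S regular_module"
  using series_coord_add[OF assms] series_coord_smult[OF assms]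
  by (auto simp: module_hom_def simp del: series_module_simps)

lemma series_const_closed: "b \<in> carrier V \<Longrightarrow> series_const V b \<in> carrier S"
  by (auto simp: series_const_def)

lemma series_coord_const:
  assumes "b \<in> B" "c \<in> B"
  shows "series_coord (l b) (series_const V c) = (if b = c then 1 else 0)"
  using assms by (intro fps_ext) (auto simp: series_coord_def series_const_def l l_zero)

text \<open>A complex basis of \<open>V\<close>, seen as constant series, is a basis of
  \<open>V[[u]]\<close> over C[[u]]. Since \<open>endo_det_eq\<close> wants a basis indexed by its
  own elements, the index is the constant series \<open>c\<close>, and \<open>c 0\<close> recovers
  the vector.\<close>

lemma series_dual_basis:
  "dual_basis S (series_const V ` B) (\<lambda>f. f) (\<lambda>c. series_coord (l (c 0)))"
proof -
  interpret S: module class_ring S by (rule module_series_module)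
  have c0: "series_const V b 0 = b" for b by (simp add: series_const_def)
  have inj: "inj_on (series_const V) B" by (rule inj_on_inverseI[of _ "\<lambda>c. c 0"]) (rule c0)
  have "f = (\<Oplus>\<^bsub>S\<^esub>c\<in>series_const V ` B. series_coord (l (c 0)) f
      \<odot>\<^bsub>S\<^esub> c)" if f: "f \<in> carrier S" for f
  proof -
    let ?x = "\<lambda>b. series_coord (l b) f \<odot>\<^bsub>S\<^esub> series_const V b"
    have cS: "series_const V b \<in> carrier S" if "b \<in> B" for b
      using series_const_closed D(2) that by blast
    have xS: "?x b \<in> carrier S" if "b \<in> B" for b
      by (rule series_smult_closed[OF cS[OF that]])
    have "(\<Oplus>\<^bsub>S\<^esub>c\<in>series_const V ` B. series_coord (l (c 0)) f
        \<odot>\<^bsub>S\<^esub> c) = (\<Oplus>\<^bsub>S\<^esub>b\<in>B. ?x b)"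
      using xS inj by (subst S.finsum_reindex) (auto simp: c0 simp del: series_module_simps)
    also have "\<dots> = f"
    proof (rule series_coord_ext[OF _ f])
      show "(\<Oplus>\<^bsub>S\<^esub>b\<in>B. ?x b) \<in> carrier S"
        using xS by (intro S.finsum_closed) blast
      fix a assume a: "a \<in> B"
      have "series_coord (l a) (\<Oplus>\<^bsub>S\<^esub>b\<in>B. ?x b)
          = (\<Sum>b\<in>B. series_coord (l b) f * series_coord (l a) (series_const V b))"
        by (rule functional_lincomb[OF module_series_module series_coord_functional[OF a] cS])
      also have "\<dots> = (\<Sum>b\<in>B. if a = b then series_coord (l b) f else 0)"
        using a by (intro sum.cong) (auto simp: series_coord_const)
      also have "\<dots> = series_coord (l a) f" using a D(1) by simp
      finally show "series_coord (l a) (\<Oplus>\<^bsub>S\<^esub>b\<in>B. ?x b) = series_coord (l a) f" .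
    qed
    finally show ?thesis ..
  qed
  then show ?thesis
    using D(1,2) series_const_closed series_coord_functional
    unfolding dual_basis_def by (auto simp: c0 simp del: series_module_simps)
qed

lemma series_endo_closed: "f \<in> carrier S \<Longrightarrow> series_endo V L f \<in> carrier S"
  by (auto simp: series_endo_def VS intro!: finsum_closed)

text \<open>Once each coefficient of \<open>L\<close> is written as a complex matrix, the
  convolution in \<open>series_endo\<close> becomes the Cauchy product of power series; the sum over
  \<open>b\<close> is a matrix-vector product over C[[u]].\<close>

lemma series_coord_endo:
  assumes a: "a \<in> B" and f: "f \<in> carrier S"
  shows "series_coord (l a) (series_endo V L f)
    = (\<Sum>b\<in>B. Abs_fps (\<lambda>n. l a (fps_nth L n \<odot>\<^bsub>V\<^esub> b)) * series_coord
        (l b) f)"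
proof (rule fps_ext)
  fix n
  have *: "l a (r \<odot>\<^bsub>V\<^esub> x) = (\<Sum>b\<in>B. l a (r \<odot>\<^bsub>V\<^esub> b) * l b
      x)" if x: "x \<in> carrier V" for r x
  proof -
    have "r \<odot>\<^bsub>V\<^esub> x = r \<odot>\<^bsub>V\<^esub> (\<Oplus>\<^bsub>V\<^esub>b\<in>B.
        Poly_Mapping.single 0 (l b x) \<odot>\<^bsub>V\<^esub> b)"
      using D(4)[OF x] by simp
    also have "\<dots> = (\<Oplus>\<^bsub>V\<^esub>b\<in>B. r \<odot>\<^bsub>V\<^esub>
        (Poly_Mapping.single 0 (l b x) \<odot>\<^bsub>V\<^esub> b))"
      using D(2) by (intro smult_finsum[OF V]) (auto simp: VS)
    also have "\<dots> = (\<Oplus>\<^bsub>V\<^esub>b\<in>B. Poly_Mapping.single 0 (l b x)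
        \<odot>\<^bsub>V\<^esub> (r \<odot>\<^bsub>V\<^esub> b))"
      using D(2) by (intro finsum_cong') (auto simp: VS(3) mult.commute simp flip: VS(6))
    finally show ?thesis using D(2) a by (simp add: l_finsum l_smult VS(3) mult.commute)
  qed
  have "fps_nth (series_coord (l a) (series_endo V L f)) n = (\<Sum>i\<le>n. l a (fps_nth L i
      \<odot>\<^bsub>V\<^esub> f (n - i)))"
    using a f by (simp add: series_coord_def series_endo_def l_finsum VS(3))
  also have "\<dots> = (\<Sum>i\<le>n. \<Sum>b\<in>B. l a (fps_nth L i \<odot>\<^bsub>V\<^esub> b) * l b
      (f (n - i)))"
    using f by (intro sum.cong refl *) auto
  also have "\<dots> = (\<Sum>b\<in>B. \<Sum>i\<le>n. l a (fps_nth L i \<odot>\<^bsub>V\<^esub> b) * l b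
      (f (n - i)))"
    by (rule sum.swap)
  also have "\<dots> = fps_nth (\<Sum>b\<in>B. Abs_fps (\<lambda>n. l a (fps_nth L n
      \<odot>\<^bsub>V\<^esub> b)) * series_coord (l b) f) n"
    by (simp add: fps_sum_nth fps_mult_nth series_coord_def atLeast0AtMost)
  finally show "fps_nth (series_coord (l a) (series_endo V L f)) n
    = fps_nth (\<Sum>b\<in>B. Abs_fps (\<lambda>n. l a (fps_nth L n \<odot>\<^bsub>V\<^esub> b)) *
        series_coord (l b) f) n" .
qed

lemma series_endo_hom: "series_endo V L \<in> module_hom class_ring S S"
proof -
  have "series_endo V L (f \<oplus>\<^bsub>S\<^esub> g) = series_endo V L f \<oplus>\<^bsub>S\<^esub>
      series_endo V L g"
    if "f \<in> carrier S" "g \<in> carrier S" for f g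
    using that series_add_closed series_endo_closed
    by (intro series_coord_ext)
      (simp_all add: series_coord_endo series_coord_add distrib_left sum.distrib del: series_module_simps)
  moreover have "series_endo V L (s \<odot>\<^bsub>S\<^esub> f) = s \<odot>\<^bsub>S\<^esub> series_endo
      V L f" if "f \<in> carrier S" for s f
    using that series_smult_closed series_endo_closed
    by (intro series_coord_ext)
      (simp_all add: series_coord_endo series_coord_smult sum_distrib_left ac_simps del: series_module_simps)
  ultimately show ?thesis
    using series_endo_closed unfolding module_hom_def by (auto simp del: series_module_simps)
qed

lemma sigma_rep_eq_det:
  assumes bs: "distinct bs" "set bs = B"
  shows "sigma_rep V L = Determinant.det (mat (length bs) (length bs)
    (\<lambda>(i, j). Abs_fps (\<lambda>n. l (bs ! i) (fps_nth L n \<odot>\<^bsub>V\<^esub> (bs ! j)))))"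
proof -
  have c0: "series_const V b 0 = b" for b by (simp add: series_const_def)
  have inj: "inj_on (series_const V) B" by (rule inj_on_inverseI[of _ "\<lambda>c. c 0"]) (rule c0)
  let ?cs = "map (series_const V) bs"
  have d: "distinct ?cs" using bs inj by (simp add: distinct_map)
  have dual: "dual_basis S (set ?cs) (\<lambda>f. f) (\<lambda>c. series_coord (l (c 0)))"
    using series_dual_basis bs by simp
  have delta: "series_coord (l (b 0)) c = (if b = c then 1 else 0)" if "b \<in> set ?cs" "c \<in> set
      ?cs" for b c
    using that bs inj by (auto simp: c0 series_coord_const inj_on_eq_iff)
  have "sigma_rep V L = Determinant.det (mat (length ?cs) (length ?cs)
      (\<lambda>(i, j). series_coord (l ((?cs ! i) 0)) (series_endo V L (?cs ! j))))"
    unfolding sigma_rep_def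
    by (rule endo_det_eq[OF inj_of_nat_fps module_series_module series_endo_hom d dual delta])
  also have "mat (length ?cs) (length ?cs)
      (\<lambda>(i, j). series_coord (l ((?cs ! i) 0)) (series_endo V L (?cs ! j)))
    = mat (length bs) (length bs) (\<lambda>(i, j). Abs_fps (\<lambda>n. l (bs ! i) (fps_nth L n
        \<odot>\<^bsub>V\<^esub> (bs ! j))))"
  proof (rule eq_matI)
    fix i j assume "i < dim_row (mat (length bs) (length bs) (\<lambda>(i, j). Abs_fps (\<lambda>n. l (bs
        ! i) (fps_nth L n \<odot>\<^bsub>V\<^esub> (bs ! j)))))"
      "j < dim_col (mat (length bs) (length bs) (\<lambda>(i, j). Abs_fps (\<lambda>n. l (bs ! i)
          (fps_nth L n \<odot>\<^bsub>V\<^esub> (bs ! j)))))"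
    then have ij: "i < length bs" "j < length bs" by auto
    then have b: "bs ! i \<in> B" "bs ! j \<in> B" using bs by auto
    have "series_coord (l (bs ! i)) (series_endo V L (series_const V (bs ! j)))
        = (\<Sum>b\<in>B. if b = bs ! j then Abs_fps (\<lambda>n. l (bs ! i) (fps_nth L n
            \<odot>\<^bsub>V\<^esub> b)) else 0)"
      using series_const_closed D(2) b
      by (subst series_coord_endo) (auto simp: series_coord_const intro!: sum.cong simp del:
          series_module_simps)
    also have "\<dots> = Abs_fps (\<lambda>n. l (bs ! i) (fps_nth L n \<odot>\<^bsub>V\<^esub> (bs ! j)))"
      using b D(1) by simp
    finally show "mat (length ?cs) (length ?cs)
        (\<lambda>(i, j). series_coord (l ((?cs ! i) 0)) (series_endo V L (?cs ! j))) $$ (i, j)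
      = mat (length bs) (length bs) (\<lambda>(i, j). Abs_fps (\<lambda>n. l (bs ! i) (fps_nth L n
          \<odot>\<^bsub>V\<^esub> (bs ! j)))) $$ (i, j)"
      using ij by (simp add: c0)
  qed auto
  finally show ?thesis .
qed

end

section \<open>The exponential of a matrix\<close>

text \<open>The matrix exponential exp(tA) with t the formal variable: the coefficient of t^k is A^k
  / k!, so no convergence is involved.\<close>

definition mat_fps_exp :: "complex mat \<Rightarrow> complex fps mat" where
  "mat_fps_exp A = mat (dim_row A) (dim_row A) (\<lambda>(i, j). Abs_fps (\<lambda>k. (A ^\<^sub>m k) $$
      (i, j) / fact k))"

text \<open>Both claims share one induction: a diagonal entry of the product reduces to a single
  term only because both factors vanish below the diagonal.\<close>

lemma upper_triangular_pow:
  fixes U :: "'a::comm_ring_1 mat"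
  assumes U: "U \<in> carrier_mat n n" "upper_triangular U"
  shows "(\<forall>i<n. \<forall>j<i. (U ^\<^sub>m k) $$ (i, j) = 0) \<and> (\<forall>i<n. (U ^\<^sub>m
      k) $$ (i, i) = U $$ (i, i) ^ k)"
proof (induction k)
  case 0
  then show ?case using U by auto
next
  case (Suc k)
  have Uk: "U ^\<^sub>m k \<in> carrier_mat n n" using U by simp
  have entry: "(U ^\<^sub>m Suc k) $$ (i, j) = (\<Sum>m<n. (U ^\<^sub>m k) $$ (i, m) * U $$ (m, j))" if
      "i < n" "j < n" for i j
    using that Uk U by (simp add: scalar_prod_def atLeast0LessThan)
  have low: "U $$ (i, j) = 0" if "i < n" "j < i" for i j
    using upper_triangularD[OF U(2)] that U by auto
  have "(U ^\<^sub>m Suc k) $$ (i, j) = 0" if "i < n" "j < i" for i j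
  proof -
    have "(U ^\<^sub>m k) $$ (i, m) * U $$ (m, j) = 0" if "m < n" for m
      using Suc low \<open>i < n\<close> \<open>j < i\<close> that by (cases "m < i") auto
    then show ?thesis using that entry by simp
  qed
  moreover have "(U ^\<^sub>m Suc k) $$ (i, i) = U $$ (i, i) ^ Suc k" if "i < n" for i
  proof -
    have "(U ^\<^sub>m k) $$ (i, m) * U $$ (m, i) = (if m = i then U $$ (i, i) ^ Suc k else 0)" if "m <
        n" for m
      using Suc low \<open>i < n\<close> that by (cases m i rule: linorder_cases) auto
    then have "(U ^\<^sub>m Suc k) $$ (i, i) = (\<Sum>m<n. if m = i then U $$ (i, i) ^ Suc k else 0)"
      using entry[OF that that] by (simp cong: sum.cong_simp)
    then show ?thesis using that by simp
  qed
  ultimately show ?case by blast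
qed

lemma index_mult_mat3:
  fixes A :: "'a::comm_semiring_1 mat"
  assumes "A \<in> carrier_mat n n" "B \<in> carrier_mat n n" "C \<in> carrier_mat n n" "i < n" "j < n"
  shows "(A * B * C) $$ (i, j) = (\<Sum>m<n. (\<Sum>l<n. A $$ (i, l) * B $$ (l, m)) * C $$ (m, j))"
proof -
  have "(A * B * C) $$ (i, j) = (\<Sum>m<n. (A * B) $$ (i, m) * C $$ (m, j))"
    using assms by (subst index_mult_mat(1)) (auto simp: scalar_prod_def atLeast0LessThan)
  then show ?thesis
    using assms by (simp add: scalar_prod_def atLeast0LessThan)
qed

lemma fps_exp_sum: "finite I \<Longrightarrow> fps_exp (\<Sum>i\<in>I. c i) = (\<Prod>i\<in>I. fps_exp (c
    i :: 'a::field_char_0))"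
  by (induction I rule: finite_induct) (simp_all add: fps_exp_add_mult)

lemma comm_ring_hom_fps_const: "comm_ring_hom (fps_const :: 'a::comm_ring_1 \<Rightarrow> 'a fps)"
  by unfold_locales (simp_all flip: fps_const_add fps_const_mult)

text \<open>If A = P U Q with U triangular and P, Q mutually inverse, then exp(tA) = P exp(tU) Q
  coefficient by coefficient. The matrix exp(tU) is triangular with the exponentials of the diagonal
  of U on its diagonal, and U has the trace of A.\<close>

lemma det_mat_fps_exp:
  assumes A: "A \<in> carrier_mat n n"
  shows "Determinant.det (mat_fps_exp A) = fps_exp (\<Sum>i<n. A $$ (i, i))"
proof -
  \<comment> \<open>Over the complex numbers the characteristic polynomial splits, which is what
    Schur triangularisation requires.\<close>
  obtain as where "char_poly A = (\<Prod>a\<leftarrow>as. [:- a, 1:])"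
    using char_poly_factorized[OF A] by auto
  then obtain U where U: "U \<in> carrier_mat n n" "upper_triangular U" "similar_mat A U"
    using schur_decomposition_exists[OF A] by auto
  then obtain P Q where wit: "similar_mat_wit A U P Q" by (auto simp: similar_mat_def)
  have PQ: "P \<in> carrier_mat n n" "Q \<in> carrier_mat n n" "P * Q = 1\<^sub>m n" "Q * P = 1\<^sub>m n"
    using similar_mat_witD2[OF A wit] by auto
  interpret c: comm_ring_hom "fps_const :: complex \<Rightarrow> complex fps" by (rule
      comm_ring_hom_fps_const)
  let ?c = "map_mat fps_const :: complex mat \<Rightarrow> complex fps mat"
  have dim: "mat_fps_exp U \<in> carrier_mat n n" "mat_fps_exp A \<in> carrier_mat n n"
    "?c P \<in> carrier_mat n n" "?c Q \<in> carrier_mat n n"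
    using U A PQ by (auto simp: mat_fps_exp_def)
  have "mat_fps_exp A = ?c P * mat_fps_exp U * ?c Q"
  proof (rule eq_matI)
    fix i j assume "i < dim_row (?c P * mat_fps_exp U * ?c Q)" "j < dim_col (?c P * mat_fps_exp U * ?c Q)"
    then have ij: "i < n" "j < n" using PQ by auto
    show "mat_fps_exp A $$ (i, j) = (?c P * mat_fps_exp U * ?c Q) $$ (i, j)"
    proof (rule fps_ext)
      fix k
      have Uk: "U ^\<^sub>m k \<in> carrier_mat n n" using U by simp
      have "fps_nth (mat_fps_exp A $$ (i, j)) k = (P * U ^\<^sub>m k * Q) $$ (i, j) / fact k"
        using ij A similar_mat_wit_pow_id[OF wit] by (simp add: mat_fps_exp_def)
      also have "\<dots> = (\<Sum>m<n. (\<Sum>l<n. P $$ (i, l) * (U ^\<^sub>m k) $$ (l, m)) * Q $$ (m,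
          j)) / fact k"
        using ij PQ Uk by (subst index_mult_mat3) auto
      also have "\<dots> = fps_nth ((?c P * mat_fps_exp U * ?c Q) $$ (i, j)) k"
        using ij PQ(1,2) U(1) dim
        by (subst index_mult_mat3[of _ n])
          (auto simp: fps_sum_nth mat_fps_exp_def sum_divide_distrib sum_distrib_right intro!: sum.cong)
      finally show "fps_nth (mat_fps_exp A $$ (i, j)) k = fps_nth ((?c P * mat_fps_exp U * ?c Q) $$ (i,
          j)) k" .
    qed
  qed (use dim in auto)
  then have "Determinant.det (mat_fps_exp A)
      = Determinant.det (?c P) * Determinant.det (mat_fps_exp U) * Determinant.det (?c Q)"
    by (simp only: det_mult[OF mult_carrier_mat[OF dim(3,1)] dim(4)] det_mult[OF dim(3,1)])
  also have "\<dots> = fps_const (Determinant.det P * Determinant.det Q) * Determinant.det (mat_fps_exp U)"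
    by (simp only: c.hom_det c.hom_mult ac_simps)
  also have "Determinant.det P * Determinant.det Q = 1"
    using det_mult[OF PQ(1,2)] PQ(3) by simp
  also have "fps_const 1 * Determinant.det (mat_fps_exp U) = Determinant.det (mat_fps_exp U)"
    by simp
  also have "\<dots> = prod_list (diag_mat (mat_fps_exp U))"
  proof (rule det_upper_triangular[OF upper_triangularI dim(1)])
    fix i j assume "j < i" "i < dim_row (mat_fps_exp U)"
    then show "mat_fps_exp U $$ (i, j) = 0"
      using U(1) upper_triangular_pow[OF U(1,2)] by (intro fps_ext) (simp add: mat_fps_exp_def)
  qed
  also have "\<dots> = (\<Prod>i<n. mat_fps_exp U $$ (i, i))"
    using dim prod.distinct_set_conv_list[of "[0..<n]" "\<lambda>i. mat_fps_exp U $$ (i, i)"]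
    by (simp add: diag_mat_def atLeast0LessThan)
  also have "\<dots> = (\<Prod>i<n. fps_exp (U $$ (i, i)))"
    using U(1) upper_triangular_pow[OF U(1,2)]
    by (intro prod.cong refl fps_ext) (simp add: mat_fps_exp_def)
  also have "\<dots> = fps_exp (\<Sum>i<n. U $$ (i, i))"
    by (simp add: fps_exp_sum)
  also have "(\<Sum>i<n. U $$ (i, i)) = (\<Sum>i<n. A $$ (i, i))"
  proof -
    \<comment> \<open>Invariance of the trace under similarity: moving \<open>Q\<close> in front of
      \<open>P\<close> produces Q P = 1.\<close>
    have "(\<Sum>i<n. A $$ (i, i)) = (\<Sum>i<n. \<Sum>m<n. \<Sum>l<n. P $$ (i, l) * U $$ (l, m) * Q $$
        (m, i))"
    proof (intro sum.cong refl)
      fix i assume "i \<in> {..<n}"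
      then have "(P * U * Q) $$ (i, i) = (\<Sum>m<n. (\<Sum>l<n. P $$ (i, l) * U $$ (l, m)) * Q $$ (m, i))"
        using PQ U by (intro index_mult_mat3) auto
      then show "A $$ (i, i) = (\<Sum>m<n. \<Sum>l<n. P $$ (i, l) * U $$ (l, m) * Q $$ (m, i))"
        by (subst similar_mat_witD2(3)[OF A wit]) (simp add: sum_distrib_right)
    qed
    also have "\<dots> = (\<Sum>m<n. \<Sum>l<n. \<Sum>i<n. P $$ (i, l) * U $$ (l, m) * Q $$ (m, i))"
      by (subst sum.swap) (intro sum.cong refl sum.swap)
    also have "\<dots> = (\<Sum>m<n. \<Sum>l<n. U $$ (l, m) * (\<Sum>i<n. Q $$ (m, i) * P $$ (i, l)))"
      by (simp add: sum_distrib_left ac_simps)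
    also have "\<dots> = (\<Sum>m<n. \<Sum>l<n. U $$ (l, m) * (Q * P) $$ (m, l))"
      using PQ(1,2) by (intro sum.cong refl) (simp add: scalar_prod_def atLeast0LessThan)
    also have "\<dots> = (\<Sum>m<n. U $$ (m, m))"
      unfolding PQ(4) by (simp add: if_distrib[of "(*) _"] cong: if_cong)
    finally show ?thesis ..
  qed
  finally show ?thesis .
qed

text \<open>The series exp - 1 has no constant term and has \<open>fps_ln 1\<close> as its inverse
  under composition. This gives exp(log(1 + X)) = 1 + X, into which -X^2 is substituted.\<close>

lemma fps_exp_1_compose_ln: "fps_exp 1 oo (fps_ln 1 oo (- (fps_X ^ 2))) = (1 - fps_X ^ 2 :: complex fps)"
proof -
  have 0: "fps_nth (fps_ln 1 :: complex fps) 0 = 0" by (simp add: fps_ln_def)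
  have "(fps_exp 1 - 1) oo fps_inv (fps_exp 1 - 1) = (fps_X :: complex fps)"
    by (rule fps_inv_right) simp_all
  then have "(fps_exp 1 - 1) oo fps_ln 1 = (fps_X :: complex fps)"
    by (simp add: fps_ln_fps_exp_inv)
  then have "fps_exp 1 oo fps_ln 1 = (1 + fps_X :: complex fps)"
    by (simp add: fps_compose_sub_distrib algebra_simps)
  then have "fps_exp 1 oo (fps_ln 1 oo (- (fps_X ^ 2))) = (1 + fps_X) oo (- (fps_X ^ 2) :: complex fps)"
    using 0 by (subst fps_compose_assoc) auto
  also have "\<dots> = 1 - fps_X ^ 2"
    by (simp add: fps_compose_add_distrib fps_X_fps_compose_startby0)
  finally show ?thesis .
qed

text \<open>Substitution respects powers and inverses, so the case of exponent 1 gives the natural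
  exponents, and taking inverses gives the negative ones. Only for integers is the right side a
  power in the sense of \<open>powi\<close>; \<chi>_V is an integer, whereas the exponent in the
  group algebra is not.\<close>

lemma fps_exp_compose_ln: "fps_exp (of_int k) oo (fps_ln 1 oo (- (fps_X ^ 2))) = ((1 - fps_X ^ 2) powi k
    :: complex fps)"
proof -
  let ?s = "fps_ln 1 oo (- (fps_X ^ 2)) :: complex fps"
  have 0: "fps_nth ?s 0 = 0" by (simp add: fps_ln_def)
  have nat: "fps_exp (of_nat n) oo ?s = (1 - fps_X ^ 2) ^ n" for n
    using fps_compose_power[OF 0, of "fps_exp 1" n] fps_exp_1_compose_ln by (simp add: fps_exp_power_mult)
  show ?thesis
  proof (cases "k \<ge> 0")
    case True
    then show ?thesis using nat[of "nat k"] by (simp add: power_int_def)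
  next
    case False
    have "fps_exp (of_int k) = inverse (fps_exp (of_nat (nat (- k))) :: complex fps)"
      using False by (simp add: fps_exp_neg[symmetric])
    then have "fps_exp (of_int k) oo ?s = inverse (fps_exp (of_nat (nat (- k))) oo ?s)"
      by (simp add: fps_inverse_compose[OF 0])
    then show ?thesis using False nat[of "nat (- k)"]
      by (simp add: power_int_def fps_inverse_power)
  qed
qed

text \<open>Lets determinants of matrices of series commute with substitution.\<close>

lemma comm_ring_hom_fps_compose:
  assumes "fps_nth s 0 = 0"
  shows "comm_ring_hom (\<lambda>f :: 'a::idom fps. f oo s)"
  using assms by unfold_locales (simp_all add: fps_compose_add_distrib fps_compose_mult_distrib)

section \<open>The Euler factor\<close>

lemma fps_group_algebra_1: "fps_group_algebra 1 = 1"
  by (rule fps_ext) (simp add: fps_group_algebra_def)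

lemma fps_group_algebra_mult: "fps_group_algebra (s * t) = fps_group_algebra s * fps_group_algebra t"
  by (rule fps_ext) (simp add: fps_group_algebra_def fps_mult_nth single_sum mult_single)

lemma fps_group_algebra_power: "fps_group_algebra s ^ k = fps_group_algebra (s ^ k)"
  by (induction k) (simp_all add: fps_group_algebra_1 fps_group_algebra_mult)

text \<open>Each coefficient is a polynomial in \<open>r\<close> with complex scalars, so its action
  on \<open>V\<close> is determined by the powers of the matrix of \<open>r\<close>.\<close>

lemma fps_group_algebra_exp_compose_nth:
  "fps_nth (fps_group_algebra (fps_exp 1) oo (fps_const r * fps_group_algebra s)) n
    = (\<Sum>k=0..n. Poly_Mapping.single 0 (fps_nth (s ^ k) n / fact k) * r ^ k)"
proof -
  have "fps_nth ((fps_const r * fps_group_algebra s) ^ k) n = r ^ k * Poly_Mapping.single 0 (fps_nth (s ^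
      k) n)" for k
    by (simp add: power_mult_distrib fps_const_power fps_group_algebra_power)
      (simp add: fps_group_algebra_def)
  then show ?thesis
    unfolding fps_compose_nth
    by (intro sum.cong refl) (simp add: fps_group_algebra_def mult_single ac_simps flip: mult.assoc)
qed

text \<open>If \<open>A\<close> is the matrix of \<open>r\<close> on \<open>V\<close>, then the
  matrix of the whole series is exp(tA) with \<open>s\<close> substituted for t. Its determinant is
  the exponential of the trace of \<open>A\<close>, with the same substitution.\<close>

lemma sigma_rep_exp:
  fixes V :: "('g::{finite, ab_group_add} \<Rightarrow>\<^sub>0 complex, 'v) module"
  assumes V: "module class_ring V" and B: "dual_basis (restrict_scalars V) B (\<lambda>b. b) l"
    and l: "\<And>b c. b \<in> B \<Longrightarrow> c \<in> B \<Longrightarrow> l b c = (if b = c then 1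
        else 0)"
    and s: "fps_nth s 0 = 0"
  shows "sigma_rep V (fps_group_algebra (fps_exp 1) oo (fps_const r * fps_group_algebra s))
    = fps_exp (\<Sum>b\<in>B. l b (r \<odot>\<^bsub>V\<^esub> b)) oo s"
proof -
  interpret module class_ring V by fact
  note VS = class_module_simps[OF V] and D = dual_basisD[OF B, simplified]
  obtain bs where bs: "distinct bs" "set bs = B" using finite_distinct_list[OF D(1)] by auto
  define n where "n = length bs"
  have bij: "bij_betw ((!) bs) {..<n} B" using bij_betw_nth[OF bs(1) _ bs(2)[symmetric]] by (simp add: n_def)
  have bsB: "bs ! i \<in> B" if "i < n" for i using that bs by (auto simp: n_def)
  have bsV: "bs ! i \<in> carrier V" if "i < n" for i using bsB D(2) that by auto
  define A where "A = mat n n (\<lambda>(i, j). l (bs ! i) (r \<odot>\<^bsub>V\<^esub> (bs ! j)))"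
  have A: "A \<in> carrier_mat n n" by (simp add: A_def)
  have l_smult: "l b (Poly_Mapping.single 0 c \<odot>\<^bsub>V\<^esub> x) = c * l b x" if "b \<in> B" "x
      \<in> carrier V" for b c x
    using functional_smult[OF D(3), of b x c] that by simp
  have l_finsum: "l b (\<Oplus>\<^bsub>V\<^esub>i\<in>I. x i) = (\<Sum>i\<in>I. l b (x i))"
    if "b \<in> B" "\<And>i. i \<in> I \<Longrightarrow> x i \<in> carrier V" for b and I :: "nat set" and x
    using functional_finsum[OF module_restrict_scalars[OF V] D(3)[OF that(1)], of I x] that(2) by simp
  \<comment> \<open>Powers of \<open>A\<close> are the matrices of powers of \<open>r\<close>. In
    the induction step \<open>r\<close> times a basis vector is expanded in the basis, and
    \<open>r ^ k\<close> is moved past the complex coordinates.\<close>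
  have pow: "(A ^\<^sub>m k) $$ (i, j) = l (bs ! i) (r ^ k \<odot>\<^bsub>V\<^esub> (bs ! j))" if "i < n"
      "j < n" for k i j
    using that
  proof (induction k arbitrary: j)
    case 0
    then show ?case using A bs bsB bsV l by (auto simp: VS(1) nth_eq_iff_index_eq n_def)
  next
    case (Suc k)
    let ?x = "r \<odot>\<^bsub>V\<^esub> (bs ! j)"
    have x: "?x \<in> carrier V" using bsV Suc by (simp add: VS)
    have "r ^ Suc k \<odot>\<^bsub>V\<^esub> (bs ! j) = r ^ k \<odot>\<^bsub>V\<^esub> ?x"
      using bsV Suc by (simp add: mult.commute flip: VS(6))
    also have "?x = (\<Oplus>\<^bsub>V\<^esub>m\<in>{..<n}. Poly_Mapping.single 0 (l (bs ! m) ?x)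
        \<odot>\<^bsub>V\<^esub> (bs ! m))"
      using dual_basisD(4)[OF dual_basis_reindex[OF module_restrict_scalars[OF V] B bij], of ?x] x by simp
    also have "r ^ k \<odot>\<^bsub>V\<^esub> \<dots> = (\<Oplus>\<^bsub>V\<^esub>m\<in>{..<n}. r ^ k
        \<odot>\<^bsub>V\<^esub> (Poly_Mapping.single 0 (l (bs ! m) ?x) \<odot>\<^bsub>V\<^esub> (bs ! m)))"
      using bsV by (intro smult_finsum[OF V]) (auto simp: VS(3))
    also have "\<dots> = (\<Oplus>\<^bsub>V\<^esub>m\<in>{..<n}. Poly_Mapping.single 0 (l (bs ! m) ?x)
        \<odot>\<^bsub>V\<^esub> (r ^ k \<odot>\<^bsub>V\<^esub> (bs ! m)))"
      using bsV by (intro finsum_cong') (auto simp: VS(3) mult.commute simp flip: VS(6))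
    finally have "l (bs ! i) (r ^ Suc k \<odot>\<^bsub>V\<^esub> (bs ! j))
        = l (bs ! i) (\<Oplus>\<^bsub>V\<^esub>m\<in>{..<n}. Poly_Mapping.single 0 (l (bs ! m) ?x)
            \<odot>\<^bsub>V\<^esub> (r ^ k \<odot>\<^bsub>V\<^esub> (bs ! m)))"
      by (rule arg_cong)
    also have "\<dots> = (\<Sum>m<n. l (bs ! i) (Poly_Mapping.single 0 (l (bs ! m) ?x)
        \<odot>\<^bsub>V\<^esub> (r ^ k \<odot>\<^bsub>V\<^esub> (bs ! m))))"
      using bsB bsV Suc.prems by (intro l_finsum) (auto simp: VS(3))
    also have "\<dots> = (\<Sum>m<n. l (bs ! i) (r ^ k \<odot>\<^bsub>V\<^esub> (bs ! m)) * l (bs ! m) ?x)"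
      using bsB bsV Suc.prems by (intro sum.cong refl) (simp add: l_smult VS(3))
    also have "\<dots> = (\<Sum>m<n. (A ^\<^sub>m k) $$ (i, m) * A $$ (m, j))"
      using Suc by (intro sum.cong refl) (simp add: A_def)
    also have "\<dots> = (A ^\<^sub>m Suc k) $$ (i, j)"
      using Suc.prems A by (simp add: scalar_prod_def atLeast0LessThan)
    finally show ?case ..
  qed
  let ?L = "fps_group_algebra (fps_exp 1) oo (fps_const r * fps_group_algebra s)"
  \<comment> \<open>Allows the substitution of \<open>s\<close> to be pulled out of the
    determinant.\<close>
  interpret s: comm_ring_hom "\<lambda>f. f oo s" by (rule comm_ring_hom_fps_compose[OF s])
  have "sigma_rep V ?L = Determinant.det (mat n n (\<lambda>(i, j). Abs_fps (\<lambda>m. l (bs ! i)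
      (fps_nth ?L m \<odot>\<^bsub>V\<^esub> (bs ! j)))))"
    unfolding n_def by (rule sigma_rep_eq_det[OF V B l bs])
  also have "mat n n (\<lambda>(i, j). Abs_fps (\<lambda>m. l (bs ! i) (fps_nth ?L m
      \<odot>\<^bsub>V\<^esub> (bs ! j)))) = map_mat (\<lambda>f. f oo s) (mat_fps_exp A)"
    (is "?X = ?Z")
  proof (rule eq_matI)
    fix i j assume "i < dim_row ?Z" "j < dim_col ?Z"
    then have ij: "i < n" "j < n" using A by (auto simp: mat_fps_exp_def)
    have "l (bs ! i) (fps_nth ?L m \<odot>\<^bsub>V\<^esub> (bs ! j)) = fps_nth (mat_fps_exp A $$ (i, j)
        oo s) m" for m
    proof -
      have "fps_nth ?L m \<odot>\<^bsub>V\<^esub> (bs ! j)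
          = (\<Oplus>\<^bsub>V\<^esub>k\<in>{0..m}. Poly_Mapping.single 0 (fps_nth (s ^ k) m / fact k)
              \<odot>\<^bsub>V\<^esub> (r ^ k \<odot>\<^bsub>V\<^esub> (bs ! j)))"
        unfolding fps_group_algebra_exp_compose_nth smult_sum_left[OF V bsV[OF ij(2)]]
        using bsV[OF ij(2)] by (intro finsum_cong') (auto simp: VS)
      then have "l (bs ! i) (fps_nth ?L m \<odot>\<^bsub>V\<^esub> (bs ! j))
          = (\<Sum>k=0..m. fps_nth (s ^ k) m / fact k * l (bs ! i) (r ^ k \<odot>\<^bsub>V\<^esub> (bs ! j)))"
        using bsV[OF ij(2)] bsB[OF ij(1)] by (simp add: l_finsum l_smult VS(3))
      also have "\<dots> = fps_nth (mat_fps_exp A $$ (i, j) oo s) m"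
        unfolding fps_compose_nth using ij A
        by (intro sum.cong refl) (simp add: mat_fps_exp_def pow)
      finally show ?thesis .
    qed
    then show "?X $$ (i, j) = ?Z $$ (i, j)"
      using ij A by (intro fps_ext) (simp add: mat_fps_exp_def)
  qed (use A in \<open>auto simp: mat_fps_exp_def\<close>)
  also have "Determinant.det ?Z = Determinant.det (mat_fps_exp A) oo s"
    by (rule s.hom_det)
  also have "\<dots> = fps_exp (\<Sum>i<n. A $$ (i, i)) oo s"
    by (simp only: det_mat_fps_exp[OF A])
  also have "(\<Sum>i<n. A $$ (i, i)) = (\<Sum>i<n. l (bs ! i) (r \<odot>\<^bsub>V\<^esub> (bs ! i)))"
    by (simp add: A_def)
  also have "\<dots> = (\<Sum>b\<in>B. l b (r \<odot>\<^bsub>V\<^esub> b))"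
    by (rule sum.reindex_bij_betw[OF bij])
  finally show ?thesis .
qed

text \<open>A complex basis of \<open>M\<close>, made into a dual basis over the group algebra by
  averaging, has trace \<open>hs_rank M\<close>; this removes the choice of dual basis from
  \<open>complex_dim_tensor_product\<close>.\<close>

lemma complex_dim_tensor_product_trace:
  fixes V :: "('g::{finite, ab_group_add} \<Rightarrow>\<^sub>0 complex, 'v) module"
  assumes V: "module class_ring V" and B: "dual_basis (restrict_scalars V) B b l"
    and M: "module class_ring M" "finitely_generated M"
  shows "of_nat (complex_dim (tensor_product V M)) = (\<Sum>a\<in>B. l a (hs_rank M
      \<odot>\<^bsub>V\<^esub> b a))"
proof -
  obtain C k where "dual_basis (restrict_scalars M) C (\<lambda>c. c) k"
    by (rule finitely_generated_complex_basis[OF M])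
  from average_dual_basis[OF M(1) this] obtain \<phi> where \<phi>: "dual_basis M C (\<lambda>c. c) \<phi>" .
  show ?thesis
    using complex_dim_tensor_product[OF V M(1) \<phi> B] by (simp add: hs_rank_eq_trace[OF M(1) \<phi>])
qed

theorem theorem5p10:
  fixes Y :: "('x, 'e) serre_graph"
    and actV :: "'g::{finite, ab_group_add} \<Rightarrow> 'x \<Rightarrow> 'x"
    and actE :: "'g \<Rightarrow> 'e \<Rightarrow> 'e"
    and V :: "('g \<Rightarrow>\<^sub>0 complex, 'v) module"
  assumes "finite_graph Y"
    and "graph_action Y actV actE"
    and "without_inversion Y actE"
    and "artin_rep V"
  shows "c_rep V Y actV actE = (1 - fps_X ^ 2) powi (- artin_euler_char V Y actV actE)"
proof -
  have V: "module class_ring V" "finitely_generated V"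
    using assms(4) by (auto simp: artin_rep_def)
  note C0 = module_C0[OF assms(1,2)] and C1 = module_C1[OF assms(1,2)]
  obtain B l where B: "dual_basis (restrict_scalars V) B (\<lambda>b. b) l"
    and l: "\<And>b c. b \<in> B \<Longrightarrow> c \<in> B \<Longrightarrow> l b c = (if b = c then 1
        else 0)"
    by (rule finitely_generated_complex_basis[OF V], rule that) blast+
  note D = dual_basisD[OF B, simplified]
  let ?\<chi> = "equivariant_euler_char Y actV actE" and ?s = "fps_ln 1 oo (- (fps_X ^ 2)) :: complex fps"
  have s: "fps_nth ?s 0 = 0" by (simp add: fps_ln_def)
  have "graph_gamma Y actV actE = fps_group_algebra (fps_exp 1) oo (fps_const (- ?\<chi>) *
      fps_group_algebra ?s)"
    by (simp add: graph_gamma_def)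
  then have "c_rep V Y actV actE = fps_exp (\<Sum>b\<in>B. l b (- ?\<chi> \<odot>\<^bsub>V\<^esub> b)) oo ?s"
    unfolding c_rep_def using sigma_rep_exp[OF V(1) B l s] by simp
  also have "(\<Sum>b\<in>B. l b (- ?\<chi> \<odot>\<^bsub>V\<^esub> b)) = of_int (- artin_euler_char V Y
      actV actE)"
  proof -
    \<comment> \<open>The difference \<chi> = rank C_0 - rank C_1 is rearranged so that only sums
      occur, since module actions and functionals are known to respect sums.\<close>
    have "l b (hs_rank (C1 Y actE) \<odot>\<^bsub>V\<^esub> b)
        = l b (- ?\<chi> \<odot>\<^bsub>V\<^esub> b) + l b (hs_rank (C0 Y actV) \<odot>\<^bsub>V\<^esub>
            b)" if "b \<in> B" for b
    proof -
      have "hs_rank (C1 Y actE) \<odot>\<^bsub>V\<^esub> b = (- ?\<chi> + hs_rank (C0 Y actV))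
          \<odot>\<^bsub>V\<^esub> b"
        by (simp add: equivariant_euler_char_def)
      also have "\<dots> = (- ?\<chi> \<odot>\<^bsub>V\<^esub> b) \<oplus>\<^bsub>V\<^esub> (hs_rank (C0
          Y actV) \<odot>\<^bsub>V\<^esub> b)"
        using D(2)[OF that] by (rule class_module_simps(4)[OF V(1)])
      finally show ?thesis
        using functional_add[OF D(3)[OF that], of "- ?\<chi> \<odot>\<^bsub>V\<^esub> b" "hs_rank (C0 Y
            actV) \<odot>\<^bsub>V\<^esub> b"]
          class_module_simps(3)[OF V(1) D(2)[OF that]] by simp
    qed
    then have "(\<Sum>b\<in>B. l b (hs_rank (C1 Y actE) \<odot>\<^bsub>V\<^esub> b))
        = (\<Sum>b\<in>B. l b (- ?\<chi> \<odot>\<^bsub>V\<^esub> b)) + (\<Sum>b\<in>B. l b (hs_rank (C0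
            Y actV) \<odot>\<^bsub>V\<^esub> b))"
      by (simp add: sum.distrib)
    then show ?thesis
      \<comment> \<open>The two trace sums over \<open>B\<close> are the dimensions of the tensor
        products with C_0 and C_1, so the trace of -\<chi> on \<open>V\<close> is an
        integer.\<close>
      using complex_dim_tensor_product_trace[OF V(1) B C0] complex_dim_tensor_product_trace[OF V(1) B C1]
      by (simp add: artin_euler_char_def algebra_simps)
  qed
  also have "fps_exp (of_int (- artin_euler_char V Y actV actE)) oo ?s
      = (1 - fps_X ^ 2) powi (- artin_euler_char V Y actV actE)"
    by (rule fps_exp_compose_ln)
  finally show ?thesis .
qed

end
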